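(* Let $(V,c,b)$ be a braided Lie algebra over a field $K$. Then the canonical map $i_U:V\to U(V,c,b)$ induces an isomorphism of braided vector spaces between $V$ and $P(U(V,c,b))$, namely the corestriction $i^{[\infty]}:V\to P(U(V,c,b))$ of $i_U$.
   Context: Fix a field $K$; all vector spaces, tensor products and maps are over $K$ ($K$-linear). An object also denotes its identity map. Braided vector space $(V,c)$: $c:V\otimes V\to V\otimes V$ linear with $(c\otimes V)(V\otimes c)(c\otimes V)=(V\otimes c)(c\otimes V)(V\otimes c)$; a morphism $f:(V,c_V)\to(W,c_W)$ is linear with $c_W(f\otimes f)=(f\otimes f)c_V$. Braided algebra $(A,m,u,c)$: an associative unital algebra and braided vector space with $c(m\otimes A)=(A\otimes m)(c\otimes A)(A\otimes c)$, $c(A\otimes m)=(m\otimes A)(A\otimes c)(c\otimes A)$, $c(u\otimes A)=A\otimes u$, $c(A\otimes u)=u\otimes A$. Braided coalgebra $(C,\Delta,\varepsilon,c)$: a coassociative counital coalgebra and braided vector space with $(\Delta\otimes C)c=(C\otimes c)(c\otimes C)(C\otimes\Delta)$, $(C\otimes\Delta)c=(c\otimes C)(C\otimes c)(\Delta\otimes C)$, $(\varepsilon\otimes C)c=C\otimes\varepsilon$, $(C\otimes\varepsilon)c=\varepsilon\otimes C$. Braided bialgebra $(B,m,u,\Delta,\varepsilon,c)$: a braided algebra and braided coalgebra with $\Delta m=(m\otimes m)(B\otimes c\otimes B)(\Delta\otimes\Delta)$, $\Delta(1)=1\otimes 1$, and $\varepsilon$ an algebra map. Morphisms of braided (bi)algebras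 are (bi)algebra maps that are morphisms of braided vector spaces. $P(B)=\{x\in B\mid \Delta(x)=x\otimes1+1\otimes x\}$. The braiding $c$ of $B$ satisfies $c(P(B)\otimes B)\subseteq B\otimes P(B)$ and $c(B\otimes P(B))\subseteq P(B)\otimes B$, so it restricts to a braiding $c_P$ on $P(B)$, with which $P(B)$ is regarded as a braided vector space. A braided bialgebra map $f:B\to B'$ induces $P(f):P(B)\to P(B')$. Braided tensor algebra $T(V,c)$: the tensor algebra $T(V)$ with the unique braiding $c_T$ extending $c$ and making it a braided algebra, and with $\Delta_T$, $\varepsilon_T$ the algebra maps $\Delta_T:T(V)\to T(V)\otimes_c T(V)$, $\varepsilon_T:T(V)\to K$ such that $\Delta_T(v)=v\otimes1+1\otimes v$, $\varepsilon_T(v)=0$ for $v\in V$, where $T\otimes_cT$ has multiplication $(m_T\otimes m_T)(T\otimes c_T\otimes T)$. A bracket on a braided vector space $(V,c)$ is a family $b=(b^{[n]})_{n\in\mathbb N}$ of linear maps defined together with braided bialgebras $U^{[n]}$ and braided vector space morphisms $i^{[n]}:V\to P^{[n]}:=P(U^{[n]})$ as follows. $U^{[0]}=T(V,c)$ and $i^{[0]}$ is the inclusion. For each $n$, $b^{[n]}:P^{[n]}\to V$ is linear and, with $V^{[n]}:=i^{[n]}(V)$ and $c$ the braiding of $U^{[n]}$, one has on $P^{[n]}\otimes V^{[n]}$ and $V^{[n]}\otimes P^{[n]}$ respectively $c(i^{[n]}b^{[n]}\otimes V^{[n]})=(V^{[n]}\otimes i^{[n]}b^{[n]})c$ and $c(V^{[n]}\otimes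 i^{[n]}b^{[n]})=(i^{[n]}b^{[n]}\otimes V^{[n]})c$ (these make sense as $c$ maps $P^{[n]}\otimes V^{[n]}$ into $V^{[n]}\otimes P^{[n]}$ and conversely). Then $U^{[n+1]}=U^{[n]}/\big((\mathrm{Id}-i^{[n]}b^{[n]})[P^{[n]}]\big)$ (quotient by the two-sided ideal generated) with the unique braided bialgebra structure making the projection $\pi_n^{n+1}:U^{[n]}\to U^{[n+1]}$ a braided bialgebra map, and $i^{[n+1]}=P(\pi_n^{n+1})i^{[n]}$. The universal enveloping algebra is the direct limit $U(V,c,b)=\varinjlim U^{[n]}$ (a braided bialgebra), with canonical map $i_U:V\to U(V,c,b)$, whose image lies in $P(U(V,c,b))$. $(V,c,b)$ is a braided Lie algebra if $i_U$ is injective. *)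

theory Defs
  imports "HOL-Algebra.Module" "HOL-Algebra.QuotRing"
begin

section \<open>Tensor algebra and tensor powers\<close>

text \<open>
  Vector spaces over a field \<open>K\<close> are HOL-Algebra modules over \<open>K\<close> (the fields \<open>mult\<close> and \<open>one\<close> of
  the record are irrelevant unless the space is an algebra). All tensor powers \<open>V\<^sup>\<otimes>\<^sup>n\<close> are
  realised as the homogeneous parts of one tensor algebra \<open>T(V)\<close>, so that associativity and unit
  constraints are identities: \<open>V\<^sup>\<otimes>\<^sup>0 = K\<cdot>1\<close>, and the product of \<open>T(V)\<close> is the tensor product of elements.
\<close>

definition linear_map ::
  "('k, 'm) ring_scheme \<Rightarrow> ('k, 'a, 'x) module_scheme \<Rightarrow> ('k, 'b, 'y) module_scheme \<Rightarrow> ('a \<Rightarrow> 'b) \<Rightarrow> bool"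
where
  "linear_map K M N f \<longleftrightarrow>
     f \<in> carrier M \<rightarrow> carrier N \<and>
     (\<forall>x\<in>carrier M. \<forall>y\<in>carrier M. f (x \<oplus>\<^bsub>M\<^esub> y) = f x \<oplus>\<^bsub>N\<^esub> f y) \<and>
     (\<forall>a\<in>carrier K. \<forall>x\<in>carrier M. f (a \<odot>\<^bsub>M\<^esub> x) = a \<odot>\<^bsub>N\<^esub> f x)"

definition support :: "('k, 'm) ring_scheme \<Rightarrow> ('w \<Rightarrow> 'k) \<Rightarrow> 'w set" where
  "support K p = {w. p w \<noteq> \<zero>\<^bsub>K\<^esub>}"

text \<open>The free associative unital \<open>K\<close>-algebra on a set \<open>X\<close> (words form a basis).\<close>

definition free_algebra :: "('k, 'm) ring_scheme \<Rightarrow> 'v set \<Rightarrow> ('k, 'v list \<Rightarrow> 'k) module" where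
  "free_algebra K X =
     \<lparr>carrier = {p. range p \<subseteq> carrier K \<and> finite (support K p) \<and> support K p \<subseteq> lists X},
      mult = (\<lambda>p q w. \<Oplus>\<^bsub>K\<^esub>i\<in>{..length w}. p (take i w) \<otimes>\<^bsub>K\<^esub> q (drop i w)),
      one = (\<lambda>w. if w = [] then \<one>\<^bsub>K\<^esub> else \<zero>\<^bsub>K\<^esub>),
      zero = (\<lambda>w. \<zero>\<^bsub>K\<^esub>),
      add = (\<lambda>p q w. p w \<oplus>\<^bsub>K\<^esub> q w),
      smult = (\<lambda>a p w. a \<otimes>\<^bsub>K\<^esub> p w)\<rparr>"

definition word :: "('k, 'm) ring_scheme \<Rightarrow> 'v list \<Rightarrow> 'v list \<Rightarrow> 'k" where
  "word K w = (\<lambda>u. if u = w then \<one>\<^bsub>K\<^esub> else \<zero>\<^bsub>K\<^esub>)"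

definition quotient_algebra :: "('k, 'a, 'x) module_scheme \<Rightarrow> 'a set \<Rightarrow> ('k, 'a set) module" where
  "quotient_algebra A I =
     ring.extend (A Quot I) (module.fields (\<lambda>a X. \<Union>x\<in>X. I +>\<^bsub>A\<^esub> (a \<odot>\<^bsub>A\<^esub> x)))"

text \<open>The ideal making the inclusion of the vector space \<open>V\<close> into the free algebra on the
  set \<open>carrier V\<close> linear.\<close>

definition linearity_ideal ::
  "('k, 'm) ring_scheme \<Rightarrow> ('k, 'v, 'x) module_scheme \<Rightarrow> ('v list \<Rightarrow> 'k) set"
where
  "linearity_ideal K V = (let F = free_algebra K (carrier V) in
     Idl\<^bsub>F\<^esub>
      ({word K [x \<oplus>\<^bsub>V\<^esub> y] \<ominus>\<^bsub>F\<^esub> (word K [x] \<oplus>\<^bsub>F\<^esub> word K [y]) | x y.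
          x \<in> carrier V \<and> y \<in> carrier V} \<union>
       {word K [a \<odot>\<^bsub>V\<^esub> x] \<ominus>\<^bsub>F\<^esub> (a \<odot>\<^bsub>F\<^esub> word K [x]) | a x.
          a \<in> carrier K \<and> x \<in> carrier V}))"

definition tensor_algebra ::
  "('k, 'm) ring_scheme \<Rightarrow> ('k, 'v, 'x) module_scheme \<Rightarrow> ('k, ('v list \<Rightarrow> 'k) set) module"
where
  "tensor_algebra K V = quotient_algebra (free_algebra K (carrier V)) (linearity_ideal K V)"

text \<open>The pure tensor \<open>v\<^sub>1 \<otimes> \<dots> \<otimes> v\<^sub>n\<close> of a list \<open>[v\<^sub>1, \<dots>, v\<^sub>n]\<close>.\<close>

definition tens ::
  "('k, 'm) ring_scheme \<Rightarrow> ('k, 'v, 'x) module_scheme \<Rightarrow> 'v list \<Rightarrow> ('v list \<Rightarrow> 'k) set"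
where
  "tens K V w = linearity_ideal K V +>\<^bsub>free_algebra K (carrier V)\<^esub> word K w"

text \<open>For subspaces \<open>S\<^sub>1, \<dots>, S\<^sub>n\<close> of \<open>V\<close>, the tensor product \<open>S\<^sub>1 \<otimes> \<dots> \<otimes> S\<^sub>n\<close>, identified (\<open>K\<close> being a
  field) with its image in \<open>V\<^sup>\<otimes>\<^sup>n\<close>.\<close>

definition tensor_product ::
  "('k, 'm) ring_scheme \<Rightarrow> ('k, 'v, 'x) module_scheme \<Rightarrow> 'v set list \<Rightarrow> ('k, ('v list \<Rightarrow> 'k) set) module"
where
  "tensor_product K V Ss = (tensor_algebra K V)
     \<lparr>carrier := {X \<in> carrier (tensor_algebra K V). \<exists>p\<in>X. support K p \<subseteq> listset Ss}\<rparr>"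

definition tensor_power ::
  "('k, 'm) ring_scheme \<Rightarrow> ('k, 'v, 'x) module_scheme \<Rightarrow> nat \<Rightarrow> ('k, ('v list \<Rightarrow> 'k) set) module"
where
  "tensor_power K V n = tensor_product K V (replicate n (carrier V))"

text \<open>For a map \<open>\<phi>\<close> on words that is multilinear on \<open>S\<^sub>1 \<times> \<dots> \<times> S\<^sub>n\<close>, the induced linear map
  \<open>S\<^sub>1 \<otimes> \<dots> \<otimes> S\<^sub>n \<rightarrow> N\<close>, sending \<open>v\<^sub>1 \<otimes> \<dots> \<otimes> v\<^sub>n\<close> to \<open>\<phi> [v\<^sub>1, \<dots>, v\<^sub>n]\<close>. The value does not depend on the
  chosen representative \<open>p\<close>; this is only meaningful for such \<open>\<phi>\<close>.\<close>

definition tensor_lift ::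
  "('k, 'm) ring_scheme \<Rightarrow> ('k, 'v, 'x) module_scheme \<Rightarrow> ('k, 'b, 'y) module_scheme \<Rightarrow>
   'v set list \<Rightarrow> ('v list \<Rightarrow> 'b) \<Rightarrow> ('v list \<Rightarrow> 'k) set \<Rightarrow> 'b"
where
  "tensor_lift K V N Ss \<phi> X =
     (let p = (SOME p. p \<in> X \<and> support K p \<subseteq> listset Ss)
      in \<Oplus>\<^bsub>N\<^esub>w\<in>support K p. p w \<odot>\<^bsub>N\<^esub> \<phi> w)"

text \<open>\<open>f\<^sub>1 \<otimes> \<dots> \<otimes> f\<^sub>n : S\<^sub>1 \<otimes> \<dots> \<otimes> S\<^sub>n \<rightarrow> W\<^sup>\<otimes>\<^sup>n\<close> for linear maps \<open>f\<^sub>j : S\<^sub>j \<rightarrow> W\<close>.\<close>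

definition tensor_maps ::
  "('k, 'm) ring_scheme \<Rightarrow> ('k, 'v, 'x) module_scheme \<Rightarrow> ('k, 'w, 'y) module_scheme \<Rightarrow>
   'v set list \<Rightarrow> ('v \<Rightarrow> 'w) list \<Rightarrow> ('v list \<Rightarrow> 'k) set \<Rightarrow> ('w list \<Rightarrow> 'k) set"
where
  "tensor_maps K V W Ss fs =
     tensor_lift K V (tensor_algebra K W) Ss (\<lambda>w. tens K W (map2 (\<lambda>f v. f v) fs w))"

definition tensor_square_map ::
  "('k, 'm) ring_scheme \<Rightarrow> ('k, 'v, 'x) module_scheme \<Rightarrow> ('k, 'w, 'y) module_scheme \<Rightarrow>
   ('v \<Rightarrow> 'w) \<Rightarrow> ('v list \<Rightarrow> 'k) set \<Rightarrow> ('w list \<Rightarrow> 'k) set"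
where
  "tensor_square_map K V W f = tensor_maps K V W [carrier V, carrier V] [f, f]"

text \<open>\<open>f \<otimes> g : A\<^sup>\<otimes>\<^sup>(\<^sup>p\<^sup>+\<^sup>r\<^sup>) \<rightarrow> A\<^sup>\<otimes>\<^sup>(\<^sup>q\<^sup>+\<^sup>s\<^sup>)\<close> for linear maps \<open>f : A\<^sup>\<otimes>\<^sup>p \<rightarrow> A\<^sup>\<otimes>\<^sup>q\<close> and \<open>g : A\<^sup>\<otimes>\<^sup>r \<rightarrow> A\<^sup>\<otimes>\<^sup>s\<close>. Only the
  degrees \<open>p\<close>, \<open>r\<close> of the domains have to be given.\<close>

definition tensor_hom ::
  "('k, 'm) ring_scheme \<Rightarrow> ('k, 'a, 'x) module_scheme \<Rightarrow> nat \<Rightarrow> nat \<Rightarrow>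
   (('a list \<Rightarrow> 'k) set \<Rightarrow> ('a list \<Rightarrow> 'k) set) \<Rightarrow> (('a list \<Rightarrow> 'k) set \<Rightarrow> ('a list \<Rightarrow> 'k) set) \<Rightarrow>
   ('a list \<Rightarrow> 'k) set \<Rightarrow> ('a list \<Rightarrow> 'k) set"
where
  "tensor_hom K A p r f g =
     tensor_lift K A (tensor_algebra K A) (replicate (p + r) (carrier A))
       (\<lambda>w. f (tens K A (take p w)) \<otimes>\<^bsub>tensor_algebra K A\<^esub> g (tens K A (drop p w)))"


section \<open>Braided vector spaces, algebras, coalgebras and bialgebras\<close>

record ('k, 'v) braided_space = "('k, 'v) module" +
  braiding :: "('v list \<Rightarrow> 'k) set \<Rightarrow> ('v list \<Rightarrow> 'k) set"

record ('k, 'v) braided_bialgebra = "('k, 'v) braided_space" +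
  comult :: "'v \<Rightarrow> ('v list \<Rightarrow> 'k) set"
  counit :: "'v \<Rightarrow> 'k"

text \<open>The structure maps as maps between tensor powers:
  \<open>m : A\<^sup>\<otimes>\<^sup>2 \<rightarrow> A\<^sup>\<otimes>\<^sup>1\<close>, \<open>u : A\<^sup>\<otimes>\<^sup>0 \<rightarrow> A\<^sup>\<otimes>\<^sup>1\<close>, \<open>\<Delta> : A\<^sup>\<otimes>\<^sup>1 \<rightarrow> A\<^sup>\<otimes>\<^sup>2\<close>, \<open>\<epsilon> : A\<^sup>\<otimes>\<^sup>1 \<rightarrow> A\<^sup>\<otimes>\<^sup>0\<close>.\<close>

definition mult_map ::
  "('k, 'm) ring_scheme \<Rightarrow> ('k, 'a, 'x) module_scheme \<Rightarrow> ('a list \<Rightarrow> 'k) set \<Rightarrow> ('a list \<Rightarrow> 'k) set"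
where
  "mult_map K A = tensor_lift K A (tensor_algebra K A) [carrier A, carrier A]
     (\<lambda>w. tens K A [w ! 0 \<otimes>\<^bsub>A\<^esub> w ! 1])"

definition unit_map ::
  "('k, 'm) ring_scheme \<Rightarrow> ('k, 'a, 'x) module_scheme \<Rightarrow> ('a list \<Rightarrow> 'k) set \<Rightarrow> ('a list \<Rightarrow> 'k) set"
where
  "unit_map K A = tensor_lift K A (tensor_algebra K A) [] (\<lambda>w. tens K A [\<one>\<^bsub>A\<^esub>])"

definition comult_map ::
  "('k, 'm) ring_scheme \<Rightarrow> ('k, 'a, 'x) braided_bialgebra_scheme \<Rightarrow>
   ('a list \<Rightarrow> 'k) set \<Rightarrow> ('a list \<Rightarrow> 'k) set"
where
  "comult_map K A = tensor_lift K A (tensor_algebra K A) [carrier A] (\<lambda>w. comult A (w ! 0))"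

definition counit_map ::
  "('k, 'm) ring_scheme \<Rightarrow> ('k, 'a, 'x) braided_bialgebra_scheme \<Rightarrow>
   ('a list \<Rightarrow> 'k) set \<Rightarrow> ('a list \<Rightarrow> 'k) set"
where
  "counit_map K A = tensor_lift K A (tensor_algebra K A) [carrier A]
     (\<lambda>w. counit A (w ! 0) \<odot>\<^bsub>tensor_algebra K A\<^esub> tens K A [])"

locale braided_vector_space = field K + module K V for K (structure) and V (structure) +
  assumes braiding_linear:
    "linear_map K (tensor_power K V 2) (tensor_power K V 2) (braiding V)"
  and braid_equation:
    "X \<in> carrier (tensor_power K V 3) \<Longrightarrow>
       tensor_hom K V 2 1 (braiding V) id
         (tensor_hom K V 1 2 id (braiding V)
           (tensor_hom K V 2 1 (braiding V) id X)) =
       tensor_hom K V 1 2 id (braiding V)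
         (tensor_hom K V 2 1 (braiding V) id
           (tensor_hom K V 1 2 id (braiding V) X))"

locale braided_algebra = braided_vector_space K A + ring A for K (structure) and A (structure) +
  assumes smult_mult_left:
    "\<lbrakk>a \<in> carrier K; x \<in> carrier A; y \<in> carrier A\<rbrakk> \<Longrightarrow>
       (a \<odot>\<^bsub>A\<^esub> x) \<otimes>\<^bsub>A\<^esub> y = a \<odot>\<^bsub>A\<^esub> (x \<otimes>\<^bsub>A\<^esub> y)"
  and smult_mult_right:
    "\<lbrakk>a \<in> carrier K; x \<in> carrier A; y \<in> carrier A\<rbrakk> \<Longrightarrow>
       x \<otimes>\<^bsub>A\<^esub> (a \<odot>\<^bsub>A\<^esub> y) = a \<odot>\<^bsub>A\<^esub> (x \<otimes>\<^bsub>A\<^esub> y)"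
  and braiding_mult_left:
    "X \<in> carrier (tensor_power K A 3) \<Longrightarrow>
       braiding A (tensor_hom K A 2 1 (mult_map K A) id X) =
       tensor_hom K A 1 2 id (mult_map K A)
         (tensor_hom K A 2 1 (braiding A) id
           (tensor_hom K A 1 2 id (braiding A) X))"
  and braiding_mult_right:
    "X \<in> carrier (tensor_power K A 3) \<Longrightarrow>
       braiding A (tensor_hom K A 1 2 id (mult_map K A) X) =
       tensor_hom K A 2 1 (mult_map K A) id
         (tensor_hom K A 1 2 id (braiding A)
           (tensor_hom K A 2 1 (braiding A) id X))"
  and braiding_unit_left:
    "X \<in> carrier (tensor_power K A 1) \<Longrightarrow>
       braiding A (tensor_hom K A 0 1 (unit_map K A) id X) =
       tensor_hom K A 1 0 id (unit_map K A) X"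
  and braiding_unit_right:
    "X \<in> carrier (tensor_power K A 1) \<Longrightarrow>
       braiding A (tensor_hom K A 1 0 id (unit_map K A) X) =
       tensor_hom K A 0 1 (unit_map K A) id X"

locale braided_coalgebra = braided_vector_space K C for K (structure) and C (structure) +
  assumes comult_linear: "linear_map K C (tensor_power K C 2) (comult C)"
  and counit_closed: "x \<in> carrier C \<Longrightarrow> counit C x \<in> carrier K"
  and counit_add:
    "\<lbrakk>x \<in> carrier C; y \<in> carrier C\<rbrakk> \<Longrightarrow> counit C (x \<oplus>\<^bsub>C\<^esub> y) = counit C x \<oplus>\<^bsub>K\<^esub> counit C y"
  and counit_smult:
    "\<lbrakk>a \<in> carrier K; x \<in> carrier C\<rbrakk> \<Longrightarrow> counit C (a \<odot>\<^bsub>C\<^esub> x) = a \<otimes>\<^bsub>K\<^esub> counit C x"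
  and coassociative:
    "x \<in> carrier C \<Longrightarrow>
       tensor_hom K C 1 1 (comult_map K C) id (comult C x) =
       tensor_hom K C 1 1 id (comult_map K C) (comult C x)"
  and counit_left:
    "x \<in> carrier C \<Longrightarrow> tensor_hom K C 1 1 (counit_map K C) id (comult C x) = tens K C [x]"
  and counit_right:
    "x \<in> carrier C \<Longrightarrow> tensor_hom K C 1 1 id (counit_map K C) (comult C x) = tens K C [x]"
  and braiding_comult_left:
    "X \<in> carrier (tensor_power K C 2) \<Longrightarrow>
       tensor_hom K C 1 1 (comult_map K C) id (braiding C X) =
       tensor_hom K C 1 2 id (braiding C)
         (tensor_hom K C 2 1 (braiding C) id
           (tensor_hom K C 1 1 id (comult_map K C) X))"
  and braiding_comult_right:
    "X \<in> carrier (tensor_power K C 2) \<Longrightarrow>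
       tensor_hom K C 1 1 id (comult_map K C) (braiding C X) =
       tensor_hom K C 2 1 (braiding C) id
         (tensor_hom K C 1 2 id (braiding C)
           (tensor_hom K C 1 1 (comult_map K C) id X))"
  and braiding_counit_left:
    "X \<in> carrier (tensor_power K C 2) \<Longrightarrow>
       tensor_hom K C 1 1 (counit_map K C) id (braiding C X) =
       tensor_hom K C 1 1 id (counit_map K C) X"
  and braiding_counit_right:
    "X \<in> carrier (tensor_power K C 2) \<Longrightarrow>
       tensor_hom K C 1 1 id (counit_map K C) (braiding C X) =
       tensor_hom K C 1 1 (counit_map K C) id X"

locale braided_bialgebra = braided_algebra K B + braided_coalgebra K B
  for K (structure) and B (structure) +
  assumes comult_mult:
    "X \<in> carrier (tensor_power K B 2) \<Longrightarrow>
       comult_map K B (mult_map K B X) =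
       tensor_hom K B 2 2 (mult_map K B) (mult_map K B)
         (tensor_hom K B 1 3 id (tensor_hom K B 2 1 (braiding B) id)
           (tensor_hom K B 1 1 (comult_map K B) (comult_map K B) X))"
  and comult_one: "comult B \<one>\<^bsub>B\<^esub> = tens K B [\<one>\<^bsub>B\<^esub>, \<one>\<^bsub>B\<^esub>]"
  and counit_hom: "counit B \<in> ring_hom B K"

definition braided_morphism ::
  "('k, 'm) ring_scheme \<Rightarrow> ('k, 'v, 'x) braided_space_scheme \<Rightarrow> ('k, 'w, 'y) braided_space_scheme \<Rightarrow>
   ('v \<Rightarrow> 'w) \<Rightarrow> bool"
where
  "braided_morphism K V W f \<longleftrightarrow>
     braided_vector_space K V \<and> braided_vector_space K W \<and> linear_map K V W f \<and>
     (\<forall>X\<in>carrier (tensor_power K V 2).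
        braiding W (tensor_square_map K V W f X) = tensor_square_map K V W f (braiding V X))"

definition braided_iso ::
  "('k, 'm) ring_scheme \<Rightarrow> ('k, 'v, 'x) braided_space_scheme \<Rightarrow> ('k, 'w, 'y) braided_space_scheme \<Rightarrow>
   ('v \<Rightarrow> 'w) \<Rightarrow> bool"
where
  "braided_iso K V W f \<longleftrightarrow> braided_morphism K V W f \<and>
     (\<exists>g. braided_morphism K W V g \<and>
        (\<forall>v\<in>carrier V. g (f v) = v) \<and> (\<forall>w\<in>carrier W. f (g w) = w))"

definition braided_bialgebra_map ::
  "('k, 'm) ring_scheme \<Rightarrow> ('k, 'a, 'x) braided_bialgebra_scheme \<Rightarrow>
   ('k, 'b, 'y) braided_bialgebra_scheme \<Rightarrow> ('a \<Rightarrow> 'b) \<Rightarrow> bool"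
where
  "braided_bialgebra_map K A B f \<longleftrightarrow>
     braided_bialgebra K A \<and> braided_bialgebra K B \<and>
     braided_morphism K A B f \<and> f \<in> ring_hom A B \<and>
     (\<forall>x\<in>carrier A. comult B (f x) = tensor_square_map K A B f (comult A x)) \<and>
     (\<forall>x\<in>carrier A. counit B (f x) = counit A x)"


section \<open>Primitive elements\<close>

definition primitives ::
  "('k, 'm) ring_scheme \<Rightarrow> ('k, 'a, 'x) braided_bialgebra_scheme \<Rightarrow> 'a set"
where
  "primitives K B = {x \<in> carrier B.
     comult B x = tens K B [x, \<one>\<^bsub>B\<^esub>] \<oplus>\<^bsub>tensor_algebra K B\<^esub> tens K B [\<one>\<^bsub>B\<^esub>, x]}"

text \<open>\<open>P(B)\<close> as a braided vector space. Its tensor square is built from \<open>P(B)\<close> alone, so \<open>c\<^sub>P\<close> is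
  characterised by \<open>(j \<otimes> j) c\<^sub>P = c (j \<otimes> j)\<close> for the inclusion \<open>j : P(B) \<rightarrow> B\<close>; uniqueness holds as
  \<open>j \<otimes> j\<close> is injective.\<close>

definition primitive_space ::
  "('k, 'm) ring_scheme \<Rightarrow> ('k, 'a, 'x) braided_bialgebra_scheme \<Rightarrow> ('k, 'a) braided_space"
where
  "primitive_space K B =
     (let P = (module.truncate B)\<lparr>carrier := primitives K B\<rparr> in
      module.extend P (braided_space.fields
        (\<lambda>X. THE Y. Y \<in> carrier (tensor_power K P 2) \<and>
           tensor_square_map K P B (\<lambda>x. x) Y =
             braiding B (tensor_square_map K P B (\<lambda>x. x) X))))"


section \<open>Braided tensor algebra and brackets\<close>

text \<open>\<open>T\<close> is the braided bialgebra \<open>T(V,c)\<close>. Multiplicativity of \<open>\<Delta>\<^sub>T\<close> and \<open>\<epsilon>\<^sub>T\<close> is part of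
  \<^const>\<open>braided_bialgebra\<close>; the structure is uniquely determined by these conditions.\<close>

definition braided_tensor_algebra ::
  "('k, 'm) ring_scheme \<Rightarrow> ('k, 'v, 'x) braided_space_scheme \<Rightarrow>
   ('k, ('v list \<Rightarrow> 'k) set) braided_bialgebra \<Rightarrow> bool"
where
  "braided_tensor_algebra K V T \<longleftrightarrow>
     braided_bialgebra K T \<and>
     module.truncate T = tensor_algebra K V \<and>
     braided_morphism K V T (\<lambda>v. tens K V [v]) \<and>
     (\<forall>v\<in>carrier V.
        comult T (tens K V [v]) =
          tens K T [tens K V [v], \<one>\<^bsub>T\<^esub>] \<oplus>\<^bsub>tensor_algebra K T\<^esub> tens K T [\<one>\<^bsub>T\<^esub>, tens K V [v]] \<and>
        counit T (tens K V [v]) = \<zero>\<^bsub>K\<^esub>)"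

text \<open>\<open>B\<close> with projection \<open>q\<close> is the quotient braided bialgebra \<open>A/J\<close>. Since the iterated quotients
  below have to live in one type, \<open>B\<close> is identified with the algebra of cosets \<open>A Quot J\<close> through
  an isomorphism under which \<open>q\<close> is the canonical projection.\<close>

definition quotient_bialgebra ::
  "('k, 'm) ring_scheme \<Rightarrow> ('k, 'a, 'x) braided_bialgebra_scheme \<Rightarrow> 'a set \<Rightarrow>
   ('k, 'b, 'y) braided_bialgebra_scheme \<Rightarrow> ('a \<Rightarrow> 'b) \<Rightarrow> bool"
where
  "quotient_bialgebra K A J B q \<longleftrightarrow>
     (\<exists>\<phi>\<in>ring_iso (A Quot J) B. \<forall>x\<in>carrier A. q x = \<phi> (J +>\<^bsub>A\<^esub> x)) \<and>
     braided_bialgebra_map K A B q"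

text \<open>\<open>i\<^sup>[\<^sup>n\<^sup>]\<close>, where \<open>\<pi> n : U\<^sup>[\<^sup>n\<^sup>] \<rightarrow> U\<^sup>[\<^sup>n\<^sup>+\<^sup>1\<^sup>]\<close> are the projections.\<close>

primrec stage_incl ::
  "('k, 'm) ring_scheme \<Rightarrow> ('k, 'v, 'x) module_scheme \<Rightarrow>
   (nat \<Rightarrow> ('v list \<Rightarrow> 'k) set \<Rightarrow> ('v list \<Rightarrow> 'k) set) \<Rightarrow> nat \<Rightarrow> 'v \<Rightarrow> ('v list \<Rightarrow> 'k) set"
where
  "stage_incl K V \<pi> 0 = (\<lambda>v. tens K V [v])"
| "stage_incl K V \<pi> (Suc n) = \<pi> n \<circ> stage_incl K V \<pi> n"

text \<open>A bracket \<open>b\<close> on \<open>(V,c)\<close> together with the braided bialgebras \<open>U\<^sup>[\<^sup>n\<^sup>]\<close> and projections \<open>\<pi> n\<close>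
  it comes with. The type of \<open>U n\<close> is that of \<open>T(V)\<close>, which is large enough for all quotients of
  \<open>T(V)\<close>.\<close>

locale bracket = braided_vector_space K V
  for K (structure) and V (structure) +
  fixes b :: "nat \<Rightarrow> ('b list \<Rightarrow> 'a) set \<Rightarrow> 'b"
    and U :: "nat \<Rightarrow> ('a, ('b list \<Rightarrow> 'a) set) braided_bialgebra"
    and \<pi> :: "nat \<Rightarrow> ('b list \<Rightarrow> 'a) set \<Rightarrow> ('b list \<Rightarrow> 'a) set"
  assumes stage_0: "braided_tensor_algebra K V (U 0)"
  and stage_Suc:
    "quotient_bialgebra K (U n)
       (Idl\<^bsub>U n\<^esub> {x \<ominus>\<^bsub>U n\<^esub> stage_incl K V \<pi> n (b n x) | x. x \<in> primitives K (U n)})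
       (U (Suc n)) (\<pi> n)"
  and bracket_linear: "linear_map K (primitive_space K (U n)) V (b n)"
  and bracket_braided_left:
    "\<lbrakk>P = primitives K (U n); W = stage_incl K V \<pi> n ` carrier V;
      X \<in> carrier (tensor_product K (U n) [P, W])\<rbrakk> \<Longrightarrow>
       braiding (U n)
         (tensor_maps K (U n) (U n) [P, W] [stage_incl K V \<pi> n \<circ> b n, id] X) =
       tensor_maps K (U n) (U n) [W, P] [id, stage_incl K V \<pi> n \<circ> b n] (braiding (U n) X)"
  and bracket_braided_right:
    "\<lbrakk>P = primitives K (U n); W = stage_incl K V \<pi> n ` carrier V;
      X \<in> carrier (tensor_product K (U n) [W, P])\<rbrakk> \<Longrightarrow>
       braiding (U n)
         (tensor_maps K (U n) (U n) [W, P] [id, stage_incl K V \<pi> n \<circ> b n] X) =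
       tensor_maps K (U n) (U n) [P, W] [stage_incl K V \<pi> n \<circ> b n, id] (braiding (U n) X)"


section \<open>Universal enveloping algebra\<close>

text \<open>\<open>transition \<pi> n k : U\<^sup>[\<^sup>n\<^sup>] \<rightarrow> U\<^sup>[\<^sup>k\<^sup>]\<close> for \<open>n \<le> k\<close>.\<close>

primrec transition :: "(nat \<Rightarrow> 'u \<Rightarrow> 'u) \<Rightarrow> nat \<Rightarrow> nat \<Rightarrow> 'u \<Rightarrow> 'u" where
  "transition \<pi> n 0 = id"
| "transition \<pi> n (Suc k) = (if n \<le> k then \<pi> k \<circ> transition \<pi> n k else id)"

text \<open>The class in the direct limit of \<open>x \<in> U n\<close>, i.e. the canonical map \<open>U n \<rightarrow> lim U\<close>.\<close>

definition limit_class ::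
  "(nat \<Rightarrow> ('u, 'x) partial_object_scheme) \<Rightarrow> (nat \<Rightarrow> 'u \<Rightarrow> 'u) \<Rightarrow> nat \<Rightarrow> 'u \<Rightarrow> (nat \<times> 'u) set"
where
  "limit_class U \<pi> n x =
     {(m, y). y \<in> carrier (U m) \<and>
        (\<exists>k. n \<le> k \<and> m \<le> k \<and> transition \<pi> n k x = transition \<pi> m k y)}"

definition limit_algebra ::
  "(nat \<Rightarrow> ('k, 'u, 'x) module_scheme) \<Rightarrow> (nat \<Rightarrow> 'u \<Rightarrow> 'u) \<Rightarrow> ('k, (nat \<times> 'u) set) module"
where
  "limit_algebra U \<pi> =
     \<lparr>carrier = (\<Union>n. limit_class U \<pi> n ` carrier (U n)),
      mult = (\<lambda>X Y. THE Z. \<exists>n. \<exists>x\<in>carrier (U n). \<exists>y\<in>carrier (U n).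
        X = limit_class U \<pi> n x \<and> Y = limit_class U \<pi> n y \<and> Z = limit_class U \<pi> n (x \<otimes>\<^bsub>U n\<^esub> y)),
      one = limit_class U \<pi> 0 \<one>\<^bsub>U 0\<^esub>,
      zero = limit_class U \<pi> 0 \<zero>\<^bsub>U 0\<^esub>,
      add = (\<lambda>X Y. THE Z. \<exists>n. \<exists>x\<in>carrier (U n). \<exists>y\<in>carrier (U n).
        X = limit_class U \<pi> n x \<and> Y = limit_class U \<pi> n y \<and> Z = limit_class U \<pi> n (x \<oplus>\<^bsub>U n\<^esub> y)),
      smult = (\<lambda>a X. THE Z. \<exists>n. \<exists>x\<in>carrier (U n).
        X = limit_class U \<pi> n x \<and> Z = limit_class U \<pi> n (a \<odot>\<^bsub>U n\<^esub> x))\<rparr>"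

text \<open>The direct limit of braided bialgebras: braiding, comultiplication and counit are those
  making all canonical maps \<open>U n \<rightarrow> lim U\<close> compatible with the structure.\<close>

definition enveloping_algebra ::
  "('k, 'm) ring_scheme \<Rightarrow> (nat \<Rightarrow> ('k, 'u, 'x) braided_bialgebra_scheme) \<Rightarrow>
   (nat \<Rightarrow> 'u \<Rightarrow> 'u) \<Rightarrow> ('k, (nat \<times> 'u) set) braided_bialgebra"
where
  "enveloping_algebra K U \<pi> =
     (let L = limit_algebra U \<pi>;
          \<psi> = limit_class U \<pi>;
          \<psi>2 = (\<lambda>n. tensor_square_map K (U n) L (\<psi> n))
      in \<lparr>carrier = carrier L, mult = mult L, one = one L, zero = zero L, add = add L,
          smult = smult L,
          braiding = (\<lambda>X. THE Y. \<exists>n. \<exists>Z\<in>carrier (tensor_power K (U n) 2).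
            X = \<psi>2 n Z \<and> Y = \<psi>2 n (braiding (U n) Z)),
          comult = (\<lambda>X. THE Y. \<exists>n. \<exists>x\<in>carrier (U n). X = \<psi> n x \<and> Y = \<psi>2 n (comult (U n) x)),
          counit = (\<lambda>X. THE a. \<exists>n. \<exists>x\<in>carrier (U n). X = \<psi> n x \<and> a = counit (U n) x)\<rparr>)"

definition enveloping_incl ::
  "('k, 'm) ring_scheme \<Rightarrow> ('k, 'v, 'x) module_scheme \<Rightarrow>
   (nat \<Rightarrow> ('k, ('v list \<Rightarrow> 'k) set, 'y) braided_bialgebra_scheme) \<Rightarrow>
   (nat \<Rightarrow> ('v list \<Rightarrow> 'k) set \<Rightarrow> ('v list \<Rightarrow> 'k) set) \<Rightarrow> 'v \<Rightarrow> (nat \<times> ('v list \<Rightarrow> 'k) set) set"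
where
  "enveloping_incl K V U \<pi> v = limit_class U \<pi> 0 (stage_incl K V \<pi> 0 v)"

locale braided_lie_algebra = bracket K V b U \<pi>
  for K (structure) and V (structure) and b U \<pi> +
  assumes incl_inj: "inj_on (enveloping_incl K V U \<pi>) (carrier V)"

end

theory Submission
  imports Defs
begin

text \<open>
  Write \<open>\<psi>\<^sub>n : U\<^sup>[\<^sup>n\<^sup>] \<rightarrow> U\<close> for the canonical maps into the direct limit. Since the tensor square of a direct
  limit is the direct limit of the tensor squares, an equation \<open>\<Delta>(\<psi>\<^sub>n x) = \<psi>\<^sub>n x \<otimes> 1 + 1 \<otimes> \<psi>\<^sub>n x\<close> already
  holds at a finite stage: every primitive element of \<open>U\<close> is \<open>\<psi>\<^sub>k y\<close> with \<open>y\<close> primitive in \<open>U\<^sup>[\<^sup>k\<^sup>]\<close>. In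
  \<open>U\<^sup>[\<^sup>k\<^sup>+\<^sup>1\<^sup>]\<close> the element \<open>y\<close> is identified with the image of \<open>b\<^sup>[\<^sup>k\<^sup>](y) \<in> V\<close>, so \<open>i\<^sub>U\<close> maps \<open>V\<close> onto \<open>P(U)\<close>;
  it is injective by assumption. As \<open>i\<^sub>U\<close> intertwines \<open>c\<close> with the braiding of \<open>U\<close>, the restriction of the
  latter to \<open>P(U)\<close> is the transport of \<open>c\<close> along this bijection, and the braid equation on \<open>P(U)\<close> is
  inherited from \<open>V\<close> rather than from a braided bialgebra structure on \<open>U\<close>.
\<close>

section \<open>The free algebra\<close>

text \<open>The obstacle is the concreteness of the objects: tensor powers consist of cosets in a
  free algebra, \<open>tensor_lift\<close> picks a representative with \<open>SOME\<close>, and the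
  limit operations and the braiding of \<open>primitive_space\<close> are definite descriptions.
  Each of them needs a well-definedness result before anything can be computed. For
  \<open>tensor_lift\<close> it is the vanishing of multilinear extensions on homogeneous elements
  of the linearity ideal. For the operations of the limit it is invariance under transitions. For
  the braiding of the limit it is injectivity of the comparison map from the limit of the tensor
  squares to the tensor square of the limit. For the braiding on primitives it is injectivity of j
  \<otimes> j, obtained from a linear retraction; its existence over a field comes from Zorn's
  lemma. With these in place, \<open>tensor_map\<close> is functorial and identities between maps of
  tensor powers are checked on pure tensors.\<close>

lemma free_algebra_carrier_iff:
  "p \<in> carrier (free_algebra R X) \<longleftrightarrow>
     (\<forall>w. p w \<in> carrier R) \<and> finite (support R p) \<and> support R p \<subseteq> lists X"
  by (auto simp: free_algebra_def)

lemma free_algebra_sel [simp]: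
  "zero (free_algebra R X) = (\<lambda>w. \<zero>\<^bsub>R\<^esub>)"
  "add (free_algebra R X) p q = (\<lambda>w. p w \<oplus>\<^bsub>R\<^esub> q w)"
  "smult (free_algebra R X) a p = (\<lambda>w. a \<otimes>\<^bsub>R\<^esub> p w)"
  "one (free_algebra R X) = word R []"
  by (simp_all add: free_algebra_def word_def fun_eq_iff)

lemma free_algebra_mult:
  "p \<otimes>\<^bsub>free_algebra R X\<^esub> q = (\<lambda>w. \<Oplus>\<^bsub>R\<^esub>i\<in>{..length w}. p (take i w) \<otimes>\<^bsub>R\<^esub> q (drop i w))"
  by (simp add: free_algebra_def)

text \<open>The sum inside \<open>tensor_lift\<close> with the representative made an explicit
  argument, so that it can be studied on the free algebra before passing to cosets.\<close>

definition lin_ext ::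
  "('k, 'm) ring_scheme \<Rightarrow> ('k, 'b, 'y) module_scheme \<Rightarrow> ('v list \<Rightarrow> 'b) \<Rightarrow> ('v list \<Rightarrow> 'k) \<Rightarrow> 'b"
where
  "lin_ext K N \<phi> p = (\<Oplus>\<^bsub>N\<^esub>w\<in>support K p. p w \<odot>\<^bsub>N\<^esub> \<phi> w)"

context cring
begin

text \<open>The second disjunct is there because the context is an arbitrary \<open>cring\<close>:
  over the zero ring every \<open>word\<close> is the zero function.\<close>

lemma word_in_carrier [simp]:
  "word R w \<in> carrier (free_algebra R X) \<longleftrightarrow> w \<in> lists X \<or> \<one> = \<zero>"
proof -
  have "support R (word R w) = (if \<one> = \<zero> then {} else {w})"
    by (auto simp: support_def word_def)
  then show ?thesis by (auto simp: free_algebra_carrier_iff word_def)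
qed

lemma support_zero [simp]: "support R (\<lambda>w. \<zero>) = {}"
  by (simp add: support_def)

lemma support_word: "support R (word R w) \<subseteq> {w}"
  by (auto simp: support_def word_def)

lemma support_add_subset:
  assumes "p \<in> carrier (free_algebra R X)" "q \<in> carrier (free_algebra R X)"
  shows "support R (p \<oplus>\<^bsub>free_algebra R X\<^esub> q) \<subseteq> support R p \<union> support R q"
  using assms by (auto simp: support_def)

lemma support_smult_subset:
  assumes "a \<in> carrier R" "p \<in> carrier (free_algebra R X)"
  shows "support R (a \<odot>\<^bsub>free_algebra R X\<^esub> p) \<subseteq> support R p"
  using assms by (auto simp: support_def)

lemma free_algebra_closed:
  "(\<lambda>w. \<zero>) \<in> carrier (free_algebra R X)"
  "\<lbrakk>p \<in> carrier (free_algebra R X); q \<in> carrier (free_algebra R X)\<rbrakk>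
     \<Longrightarrow> p \<oplus>\<^bsub>free_algebra R X\<^esub> q \<in> carrier (free_algebra R X)"
  "\<lbrakk>a \<in> carrier R; p \<in> carrier (free_algebra R X)\<rbrakk>
     \<Longrightarrow> a \<odot>\<^bsub>free_algebra R X\<^esub> p \<in> carrier (free_algebra R X)"
proof -
  show "(\<lambda>w. \<zero>) \<in> carrier (free_algebra R X)"
    by (simp add: free_algebra_carrier_iff)
  assume p: "p \<in> carrier (free_algebra R X)"
  show "p \<oplus>\<^bsub>free_algebra R X\<^esub> q \<in> carrier (free_algebra R X)"
    if q: "q \<in> carrier (free_algebra R X)"
  proof -
    have "support R (p \<oplus>\<^bsub>free_algebra R X\<^esub> q) \<subseteq> lists X"
      using support_add_subset[OF p q] p q unfolding free_algebra_carrier_iff by blast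
    then show ?thesis
      using p q finite_subset[OF support_add_subset[OF p q]]
      by (simp add: free_algebra_carrier_iff)
  qed
  show "a \<odot>\<^bsub>free_algebra R X\<^esub> p \<in> carrier (free_algebra R X)" if a: "a \<in> carrier R"
  proof -
    have "support R (a \<odot>\<^bsub>free_algebra R X\<^esub> p) \<subseteq> lists X"
      using support_smult_subset[OF a p] p unfolding free_algebra_carrier_iff by blast
    then show ?thesis
      using p a finite_subset[OF support_smult_subset[OF a p]]
      by (simp add: free_algebra_carrier_iff)
  qed
qed

lemma free_algebra_value [simp]: "p \<in> carrier (free_algebra R X) \<Longrightarrow> p w \<in> carrier R"
  by (simp add: free_algebra_carrier_iff)

lemma module_free_algebra: "module R (free_algebra R X)"
proof (rule moduleI)
  show "abelian_group (free_algebra R X)"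
  proof (rule abelian_groupI)
    fix p assume p: "p \<in> carrier (free_algebra R X)"
    have "(\<ominus> \<one>) \<odot>\<^bsub>free_algebra R X\<^esub> p \<in> carrier (free_algebra R X)"
      using p by (intro free_algebra_closed) auto
    moreover have "((\<ominus> \<one>) \<odot>\<^bsub>free_algebra R X\<^esub> p) \<oplus>\<^bsub>free_algebra R X\<^esub> p = (\<lambda>w. \<zero>)"
      using p by (simp add: l_minus l_neg fun_eq_iff)
    ultimately show "\<exists>q\<in>carrier (free_algebra R X).
        q \<oplus>\<^bsub>free_algebra R X\<^esub> p = \<zero>\<^bsub>free_algebra R X\<^esub>"
      by (auto simp del: free_algebra_sel(2,3))
  qed (use free_algebra_closed in \<open>auto simp: fun_eq_iff a_ac\<close>)
qed (use free_algebra_closed in \<open>auto simp: fun_eq_iff l_distr r_distr m_assoc is_cring\<close>)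

text \<open>Induction on a finite set containing the support. The parameter \<open>S\<close>
  confines all summands to a chosen family of words, such as the words of one length, which is what
  homogeneous elements require.\<close>

lemma free_algebra_induct [consumes 3, case_names zero add]:
  assumes p: "p \<in> carrier (free_algebra R X)" and S: "support R p \<subseteq> S" and SX: "S \<subseteq> lists X"
    and zero: "P (\<lambda>w. \<zero>)"
    and add: "\<And>q a w. \<lbrakk>q \<in> carrier (free_algebra R X); support R q \<subseteq> S; P q; a \<in> carrier R; w \<in> S\<rbrakk>
      \<Longrightarrow> P (q \<oplus>\<^bsub>free_algebra R X\<^esub> a \<odot>\<^bsub>free_algebra R X\<^esub> word R w)"
  shows "P p"
proof -
  have "P p" if "finite A" "A \<subseteq> S" "support R p \<subseteq> A" "p \<in> carrier (free_algebra R X)" for A p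
    using that
  proof (induction A arbitrary: p rule: finite_induct)
    case empty
    then have "p = (\<lambda>w. \<zero>)" by (auto simp: support_def)
    then show ?case using zero by simp
  next
    case (insert w A)
    \<comment> \<open>Erasing the coefficient at \<open>w\<close> shrinks the support, and
      \<open>p\<close> is recovered by adding back \<open>p w\<close> times the word
      \<open>w\<close>.\<close>
    define q where "q = p(w := \<zero>)"
    have q: "support R q \<subseteq> A"
      using insert.prems by (auto simp: q_def support_def)
    then have qc: "q \<in> carrier (free_algebra R X)"
      using insert.prems insert.hyps SX
      by (auto simp: free_algebra_carrier_iff q_def intro: finite_subset)
    have "P q" using q qc insert by auto
    then have "P (q \<oplus>\<^bsub>free_algebra R X\<^esub> p w \<odot>\<^bsub>free_algebra R X\<^esub> word R w)"
      using add[OF qc, of "p w" w] q insert.prems by auto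
    moreover have "q \<oplus>\<^bsub>free_algebra R X\<^esub> p w \<odot>\<^bsub>free_algebra R X\<^esub> word R w = p"
      using insert.prems(3) by (auto simp: q_def word_def fun_eq_iff)
    ultimately show ?case by simp
  qed
  then show ?thesis using p S by (auto simp: free_algebra_carrier_iff)
qed

lemma free_algebra_induct_words [consumes 1, case_names zero add]:
  assumes p: "p \<in> carrier (free_algebra R X)"
    and zero: "P (\<lambda>w. \<zero>)"
    and add: "\<And>q a w. \<lbrakk>q \<in> carrier (free_algebra R X); P q; a \<in> carrier R; w \<in> lists X\<rbrakk>
      \<Longrightarrow> P (q \<oplus>\<^bsub>free_algebra R X\<^esub> a \<odot>\<^bsub>free_algebra R X\<^esub> word R w)"
  shows "P p"
  using p _ subset_refl
  by (rule free_algebra_induct)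
    (use p zero add in \<open>auto simp: free_algebra_carrier_iff simp del: in_lists_conv_set free_algebra_sel\<close>)

lemma mult_free_algebra_closed:
  assumes p: "p \<in> carrier (free_algebra R X)" and q: "q \<in> carrier (free_algebra R X)"
  shows "p \<otimes>\<^bsub>free_algebra R X\<^esub> q \<in> carrier (free_algebra R X)"
proof -
  \<comment> \<open>A word in the support of the product must split into a word of one support
    followed by a word of the other; this bounds the support by a finite set.\<close>
  let ?S = "(\<lambda>(u, v). u @ v) ` (support R p \<times> support R q)"
  have "support R (p \<otimes>\<^bsub>free_algebra R X\<^esub> q) \<subseteq> ?S"
  proof
    fix w assume w: "w \<in> support R (p \<otimes>\<^bsub>free_algebra R X\<^esub> q)"
    have "\<exists>i\<le>length w. p (take i w) \<otimes> q (drop i w) \<noteq> \<zero>"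
    proof (rule ccontr)
      assume *: "\<not> (\<exists>i\<le>length w. p (take i w) \<otimes> q (drop i w) \<noteq> \<zero>)"
      have "(\<Oplus>i\<in>{..length w}. p (take i w) \<otimes> q (drop i w)) = (\<Oplus>i\<in>{..length w}. \<zero>)"
        by (rule finsum_cong') (use * in auto)
      then show False using w by (simp add: support_def free_algebra_mult)
    qed
    then obtain i where "p (take i w) \<otimes> q (drop i w) \<noteq> \<zero>" by blast
    then have "take i w \<in> support R p" "drop i w \<in> support R q"
      using p q by (auto simp: support_def)
    then show "w \<in> ?S" by (intro image_eqI[where x = "(take i w, drop i w)"]) auto
  qed
  moreover have "finite ?S"
    using p q by (auto simp: free_algebra_carrier_iff)
  moreover have "?S \<subseteq> lists X"
  proof -
    have "support R p \<subseteq> lists X" "support R q \<subseteq> lists X"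
      using p q by (auto simp only: free_algebra_carrier_iff)
    then show ?thesis by (fastforce simp: subset_iff)
  qed
  moreover have "(p \<otimes>\<^bsub>free_algebra R X\<^esub> q) w \<in> carrier R" for w
    using p q by (auto simp: free_algebra_mult intro!: finsum_closed)
  ultimately show ?thesis
    unfolding free_algebra_carrier_iff by (meson finite_subset order_trans)
qed

lemma mult_free_algebra_add:
  assumes "p \<in> carrier (free_algebra R X)" "q \<in> carrier (free_algebra R X)"
    "r \<in> carrier (free_algebra R X)"
  shows "(p \<oplus>\<^bsub>free_algebra R X\<^esub> q) \<otimes>\<^bsub>free_algebra R X\<^esub> r
      = p \<otimes>\<^bsub>free_algebra R X\<^esub> r \<oplus>\<^bsub>free_algebra R X\<^esub> q \<otimes>\<^bsub>free_algebra R X\<^esub> r"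
    "r \<otimes>\<^bsub>free_algebra R X\<^esub> (p \<oplus>\<^bsub>free_algebra R X\<^esub> q)
      = r \<otimes>\<^bsub>free_algebra R X\<^esub> p \<oplus>\<^bsub>free_algebra R X\<^esub> r \<otimes>\<^bsub>free_algebra R X\<^esub> q"
  using assms
  by (simp_all add: free_algebra_mult fun_eq_iff l_distr r_distr finsum_addf Pi_def)

lemma mult_free_algebra_smult:
  assumes "p \<in> carrier (free_algebra R X)" "q \<in> carrier (free_algebra R X)" "a \<in> carrier R"
  shows "(a \<odot>\<^bsub>free_algebra R X\<^esub> p) \<otimes>\<^bsub>free_algebra R X\<^esub> q
      = a \<odot>\<^bsub>free_algebra R X\<^esub> (p \<otimes>\<^bsub>free_algebra R X\<^esub> q)"
    "p \<otimes>\<^bsub>free_algebra R X\<^esub> (a \<odot>\<^bsub>free_algebra R X\<^esub> q)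
      = a \<odot>\<^bsub>free_algebra R X\<^esub> (p \<otimes>\<^bsub>free_algebra R X\<^esub> q)"
  using assms
  by (auto simp: free_algebra_mult fun_eq_iff finsum_rdistr Pi_def m_ac intro!: finsum_cong')

lemma mult_free_algebra_zero:
  assumes "p \<in> carrier (free_algebra R X)"
  shows "(\<lambda>w. \<zero>) \<otimes>\<^bsub>free_algebra R X\<^esub> p = (\<lambda>w. \<zero>)"
    "p \<otimes>\<^bsub>free_algebra R X\<^esub> (\<lambda>w. \<zero>) = (\<lambda>w. \<zero>)"
  using assms by (simp_all add: free_algebra_mult fun_eq_iff)

lemma word_mult: "word R u \<otimes>\<^bsub>free_algebra R X\<^esub> word R v = word R (u @ v)"
proof
  fix w
  let ?f = "\<lambda>i. word R u (take i w) \<otimes> word R v (drop i w)"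
  \<comment> \<open>Only the cut after \<open>length u\<close> letters can contribute. If
    \<open>w\<close> is shorter than \<open>u\<close>, that cut is not in the range and both sides
    are zero.\<close>
  have "(\<Oplus>i\<in>{..length w}. ?f i) = (\<Oplus>i\<in>{..length w}. if length u = i then word R (u @ v) w else \<zero>)"
  proof (rule finsum_cong')
    fix i assume i: "i \<in> {..length w}"
    show "?f i = (if length u = i then word R (u @ v) w else \<zero>)"
    proof (cases "length u = i")
      case True
      then have "w = u @ v \<longleftrightarrow> take i w = u \<and> drop i w = v"
        by (metis append_eq_conv_conj)
      then show ?thesis using True by (auto simp: word_def)
    qed (use i in \<open>auto simp: word_def\<close>)
  qed (auto simp: word_def)
  also have "\<dots> = word R (u @ v) w"
  proof (cases "length u \<le> length w")
    case True
    then show ?thesis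
      by (subst finsum_singleton) (auto simp: word_def)
  next
    case False
    then have "(\<Oplus>i\<in>{..length w}. if length u = i then word R (u @ v) w else \<zero>)
       = (\<Oplus>i\<in>{..length w}. \<zero>)"
      by (intro finsum_cong') auto
    then show ?thesis using False by (auto simp: word_def)
  qed
  finally show "(word R u \<otimes>\<^bsub>free_algebra R X\<^esub> word R v) w = word R (u @ v) w"
    by (simp add: free_algebra_mult)
qed

lemma ring_free_algebra: "ring (free_algebra R X)"
proof -
  interpret F: module R "free_algebra R X" by (rule module_free_algebra)
  let ?F = "free_algebra R X"
  note sel = free_algebra_sel
  note closed = free_algebra_closed mult_free_algebra_closed
  note bil = mult_free_algebra_add mult_free_algebra_smult mult_free_algebra_zero
  have 1: "(p \<otimes>\<^bsub>?F\<^esub> q) \<otimes>\<^bsub>?F\<^esub> r = p \<otimes>\<^bsub>?F\<^esub> (q \<otimes>\<^bsub>?F\<^esub> r)"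
    if p: "p \<in> carrier ?F" and q: "q \<in> carrier ?F" and r: "r \<in> carrier ?F" for p q r
  proof -
    \<comment> \<open>By trilinearity associativity reduces to associativity of \<open>@\<close>;
      the factors are freed one at a time, beginning with the rightmost.\<close>
    have ww: "(word R u \<otimes>\<^bsub>?F\<^esub> word R v) \<otimes>\<^bsub>?F\<^esub> r = word R u \<otimes>\<^bsub>?F\<^esub> (word R v \<otimes>\<^bsub>?F\<^esub> r)"
      if uv: "u \<in> lists X" "v \<in> lists X" for u v
      using r
    proof (induction r rule: free_algebra_induct_words)
      case (add s a w)
      then show ?case using uv 
        by (simp add: bil closed word_mult del: sel)
    qed (use r uv in \<open>auto simp: bil closed\<close>)
    have w: "(word R u \<otimes>\<^bsub>?F\<^esub> q) \<otimes>\<^bsub>?F\<^esub> r = word R u \<otimes>\<^bsub>?F\<^esub> (q \<otimes>\<^bsub>?F\<^esub> r)"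
      if u: "u \<in> lists X" for u
      using q
    proof (induction q rule: free_algebra_induct_words)
      case (add s a w)
      then show ?case using u ww r by (simp add: bil closed del: sel)
    qed (use q r u in \<open>auto simp: bil closed\<close>)
    show ?thesis
      using p
    proof (induction p rule: free_algebra_induct_words)
      case (add s a u)
      then show ?case using w q r by (simp add: bil closed del: sel)
    qed (use p q r in \<open>auto simp: bil closed\<close>)
  qed
  have 2: "word R [] \<otimes>\<^bsub>?F\<^esub> p = p \<and> p \<otimes>\<^bsub>?F\<^esub> word R [] = p" if p: "p \<in> carrier ?F" for p
    using p
  proof (induction p rule: free_algebra_induct_words)
    case (add s a u)
    then show ?case by (simp add: bil closed word_mult del: sel)
  qed (use p in \<open>auto simp: bil closed\<close>)
  show ?thesis
    by (rule ringI[OF F.abelian_group_axioms])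
      (use 1 2 in \<open>auto intro!: Group.monoidI simp: bil closed simp del: sel(1-3)\<close>)
qed

end

declare free_algebra_sel [simp del]

section \<open>Linear maps\<close>

lemma linear_mapD:
  assumes "linear_map K M N f"
  shows "x \<in> carrier M \<Longrightarrow> f x \<in> carrier N"
    and "\<lbrakk>x \<in> carrier M; y \<in> carrier M\<rbrakk> \<Longrightarrow> f (x \<oplus>\<^bsub>M\<^esub> y) = f x \<oplus>\<^bsub>N\<^esub> f y"
    and "\<lbrakk>a \<in> carrier K; x \<in> carrier M\<rbrakk> \<Longrightarrow> f (a \<odot>\<^bsub>M\<^esub> x) = a \<odot>\<^bsub>N\<^esub> f x"
  using assms by (auto simp: linear_map_def)

lemma linear_mapI:
  assumes "\<And>x. x \<in> carrier M \<Longrightarrow> f x \<in> carrier N"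
    and "\<And>x y. \<lbrakk>x \<in> carrier M; y \<in> carrier M\<rbrakk> \<Longrightarrow> f (x \<oplus>\<^bsub>M\<^esub> y) = f x \<oplus>\<^bsub>N\<^esub> f y"
    and "\<And>a x. \<lbrakk>a \<in> carrier K; x \<in> carrier M\<rbrakk> \<Longrightarrow> f (a \<odot>\<^bsub>M\<^esub> x) = a \<odot>\<^bsub>N\<^esub> f x"
  shows "linear_map K M N f"
  using assms by (auto simp: linear_map_def)

lemma linear_map_zero:
  assumes "module K M" "module K N" "linear_map K M N f"
  shows "f \<zero>\<^bsub>M\<^esub> = \<zero>\<^bsub>N\<^esub>"
proof -
  interpret M: module K M by fact
  interpret N: module K N by fact
  have "f (\<zero>\<^bsub>K\<^esub> \<odot>\<^bsub>M\<^esub> \<zero>\<^bsub>M\<^esub>) = \<zero>\<^bsub>K\<^esub> \<odot>\<^bsub>N\<^esub> f \<zero>\<^bsub>M\<^esub>"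
    by (rule linear_mapD(3)[OF assms(3)]) auto
  then show ?thesis
    using linear_mapD(1)[OF assms(3)] by simp
qed

lemma linear_map_minus:
  assumes "module K M" "module K N" "linear_map K M N f" "x \<in> carrier M"
  shows "f (\<ominus>\<^bsub>M\<^esub> x) = \<ominus>\<^bsub>N\<^esub> f x"
proof -
  interpret M: module K M by fact
  interpret N: module K N by fact
  have "f (\<ominus>\<^bsub>M\<^esub> x) \<oplus>\<^bsub>N\<^esub> f x = \<zero>\<^bsub>N\<^esub>"
    using linear_mapD(2)[OF assms(3), of "\<ominus>\<^bsub>M\<^esub> x" x] linear_map_zero[OF assms(1-3)] assms(4)
    by (simp add: M.M.l_neg)
  then show ?thesis
    using linear_mapD(1)[OF assms(3)] assms(4) by (metis M.M.a_inv_closed N.M.minus_equality)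
qed

lemma linear_map_compose:
  "\<lbrakk>linear_map K M N f; linear_map K N P g\<rbrakk> \<Longrightarrow> linear_map K M P (\<lambda>x. g (f x))"
  by (simp add: linear_map_def Pi_iff)

lemma linear_map_cong:
  "\<lbrakk>linear_map K M N f; \<And>x. x \<in> carrier M \<Longrightarrow> f x = g x; module K M\<rbrakk> \<Longrightarrow> linear_map K M N g"
  by (smt (verit) abelian_monoid.a_closed abelian_group.axioms(1) linear_mapD linear_mapI
      module.smult_closed module.axioms(2))

section \<open>Linear extension of functions on words\<close>

context cring
begin

text \<open>Words outside the support contribute zero. Extensions of different elements can thus be
  summed over a common finite index set, which makes additivity in \<open>lin_ext_linear\<close> a
  termwise identity.\<close>

lemma lin_ext_superset:
  assumes "module R N" "p \<in> carrier (free_algebra R X)" "finite S" "support R p \<subseteq> S"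
    and f: "\<And>w. w \<in> S \<Longrightarrow> f w \<in> carrier N"
  shows "lin_ext R N f p = (\<Oplus>\<^bsub>N\<^esub>w\<in>S. p w \<odot>\<^bsub>N\<^esub> f w)"
proof -
  interpret N: module R N by fact
  show ?thesis
    unfolding lin_ext_def
    by (rule N.M.add.finprod_mono_neutral_cong_left)
      (use assms in \<open>auto simp: support_def\<close>)
qed

lemma lin_ext_cong:
  assumes "module R N" "p \<in> carrier (free_algebra R X)" "\<And>w. w \<in> support R p \<Longrightarrow> f w = g w"
    and "\<And>w. w \<in> support R p \<Longrightarrow> g w \<in> carrier N"
  shows "lin_ext R N f p = lin_ext R N g p"
proof -
  interpret N: module R N by fact
  show ?thesis
    unfolding lin_ext_def by (rule N.M.finsum_cong') (use assms in auto)
qed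

lemma lin_ext_linear:
  assumes "module R N" and f: "\<And>w. w \<in> lists X \<Longrightarrow> f w \<in> carrier N"
  shows "linear_map R (free_algebra R X) N (lin_ext R N f)"
proof (rule linear_mapI)
  interpret N: module R N by fact
  fix p assume p: "p \<in> carrier (free_algebra R X)"
  then have fp: "finite (support R p)" "support R p \<subseteq> lists X"
    by (simp_all only: free_algebra_carrier_iff)
  show "lin_ext R N f p \<in> carrier N"
    unfolding lin_ext_def
    by (rule N.M.finsum_closed) (use p f fp(2) in \<open>blast intro: free_algebra_value\<close>)
  fix q assume q: "q \<in> carrier (free_algebra R X)"
  then have fq: "finite (support R q)" "support R q \<subseteq> lists X"
    by (simp_all only: free_algebra_carrier_iff)
  let ?S = "support R p \<union> support R q"
  have fS: "f w \<in> carrier N" if "w \<in> ?S" for w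
    using that fp fq f by blast
  have "lin_ext R N f (p \<oplus>\<^bsub>free_algebra R X\<^esub> q)
      = (\<Oplus>\<^bsub>N\<^esub>w\<in>?S. (p \<oplus>\<^bsub>free_algebra R X\<^esub> q) w \<odot>\<^bsub>N\<^esub> f w)"
    using fp fq fS support_add_subset[OF p q]
    by (intro lin_ext_superset[where X = X]) (auto intro: free_algebra_closed p q assms)
  also have "\<dots> = (\<Oplus>\<^bsub>N\<^esub>w\<in>?S. p w \<odot>\<^bsub>N\<^esub> f w \<oplus>\<^bsub>N\<^esub> q w \<odot>\<^bsub>N\<^esub> f w)"
    using fS p q by (intro N.M.finsum_cong') (auto simp: N.smult_l_distr free_algebra_sel)
  also have "\<dots> = (\<Oplus>\<^bsub>N\<^esub>w\<in>?S. p w \<odot>\<^bsub>N\<^esub> f w) \<oplus>\<^bsub>N\<^esub> (\<Oplus>\<^bsub>N\<^esub>w\<in>?S. q w \<odot>\<^bsub>N\<^esub> f w)"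
    using fS p q by (intro N.M.finsum_addf) auto
  also have "(\<Oplus>\<^bsub>N\<^esub>w\<in>?S. p w \<odot>\<^bsub>N\<^esub> f w) = lin_ext R N f p"
    using fp fq fS by (intro lin_ext_superset[OF assms(1) p, symmetric]) auto
  also have "(\<Oplus>\<^bsub>N\<^esub>w\<in>?S. q w \<odot>\<^bsub>N\<^esub> f w) = lin_ext R N f q"
    using fp fq fS by (intro lin_ext_superset[OF assms(1) q, symmetric]) auto
  finally show "lin_ext R N f (p \<oplus>\<^bsub>free_algebra R X\<^esub> q) = lin_ext R N f p \<oplus>\<^bsub>N\<^esub> lin_ext R N f q" .
next
  interpret N: module R N by fact
  fix a p assume a: "a \<in> carrier R" and p: "p \<in> carrier (free_algebra R X)"
  then have fp: "finite (support R p)" "support R p \<subseteq> lists X"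
    by (simp_all only: free_algebra_carrier_iff)
  have fS: "f w \<in> carrier N" if "w \<in> support R p" for w
    using that fp f by blast
  have "lin_ext R N f (a \<odot>\<^bsub>free_algebra R X\<^esub> p)
      = (\<Oplus>\<^bsub>N\<^esub>w\<in>support R p. (a \<odot>\<^bsub>free_algebra R X\<^esub> p) w \<odot>\<^bsub>N\<^esub> f w)"
    using fp fS support_smult_subset[OF a p]
    by (intro lin_ext_superset[where X = X]) (auto intro: free_algebra_closed a p assms)
  also have "\<dots> = (\<Oplus>\<^bsub>N\<^esub>w\<in>support R p. a \<odot>\<^bsub>N\<^esub> (p w \<odot>\<^bsub>N\<^esub> f w))"
    using fS p a by (intro N.M.finsum_cong') (auto simp: N.smult_assoc1 free_algebra_sel)
  also have "\<dots> = a \<odot>\<^bsub>N\<^esub> lin_ext R N f p"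
    unfolding lin_ext_def using fS p a fp by (intro N.finsum_smult_ldistr[symmetric]) auto
  finally show "lin_ext R N f (a \<odot>\<^bsub>free_algebra R X\<^esub> p) = a \<odot>\<^bsub>N\<^esub> lin_ext R N f p" .
qed

lemma lin_ext_word:
  assumes "module R N" "f w \<in> carrier N"
  shows "lin_ext R N f (word R w) = f w"
proof -
  interpret N: module R N by fact
  have "lin_ext R N f (word R w) = (\<Oplus>\<^bsub>N\<^esub>u\<in>{w}. word R w u \<odot>\<^bsub>N\<^esub> f u)"
    by (rule lin_ext_superset[where X = UNIV]) (use assms support_word in auto)
  also have "\<dots> = f w" using assms by (simp add: word_def)
  finally show ?thesis .
qed

text \<open>Both sides are bilinear in \<open>p\<close> and \<open>q\<close>, and for words
  \<open>u\<close> and \<open>v\<close> both are \<open>f (u @ v)\<close>. The iterated form is what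
  lets a factor be absorbed into a surrounding word when a kernel is shown to be an ideal.\<close>

lemma lin_ext_mult:
  assumes N: "module R N" and f: "\<And>w. w \<in> lists X \<Longrightarrow> f w \<in> carrier N"
    and p: "p \<in> carrier (free_algebra R X)" and q: "q \<in> carrier (free_algebra R X)"
  shows "lin_ext R N f (p \<otimes>\<^bsub>free_algebra R X\<^esub> q) =
    lin_ext R N (\<lambda>u. lin_ext R N (\<lambda>v. f (u @ v)) q) p"
proof -
  interpret N: module R N by fact
  interpret F: ring "free_algebra R X" by (rule ring_free_algebra)
  interpret F: module R "free_algebra R X" by (rule module_free_algebra)
  have linf: "linear_map R (free_algebra R X) N (lin_ext R N f)"
    by (rule lin_ext_linear[OF N]) (rule f)
  note z = linear_map_zero[OF module_free_algebra N]
  have inner: "f (u @ v) \<in> carrier N" if "u \<in> lists X" "v \<in> lists X" for u v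
    using f that by auto
  have lin1: "linear_map R (free_algebra R X) N (lin_ext R N (\<lambda>v. f (u @ v)))"
    if "u \<in> lists X" for u
    by (rule lin_ext_linear[OF N]) (rule inner[OF that])
  have outer: "linear_map R (free_algebra R X) N (lin_ext R N (\<lambda>u. lin_ext R N (\<lambda>v. f (u @ v)) q))"
    if "q \<in> carrier (free_algebra R X)" for q
    by (rule lin_ext_linear[OF N]) (rule linear_mapD(1)[OF lin1 that])
  have w: "lin_ext R N f (word R u \<otimes>\<^bsub>free_algebra R X\<^esub> q) = lin_ext R N (\<lambda>v. f (u @ v)) q"
    if u: "u \<in> lists X" for u
    using q
  proof (induction q rule: free_algebra_induct_words)
    case zero
    have "word R u \<in> carrier (free_algebra R X)" using u by simp
    then have "word R u \<otimes>\<^bsub>free_algebra R X\<^esub> (\<lambda>w. \<zero>) = (\<lambda>w. \<zero>)"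
      using F.r_null by (simp add: free_algebra_sel)
    then show ?case
      using z[OF lin1[OF u]] z[OF linf] by (simp add: free_algebra_sel)
  next
    case (add q a v)
    then have *: "f (u @ v) \<in> carrier N" using inner u by blast
    show ?case
      using add u * by (simp add: F.r_distr mult_free_algebra_smult word_mult linear_mapD[OF lin1[OF u]]
          linear_mapD[OF linf] lin_ext_word[OF N] del: in_lists_conv_set)
  qed
  show ?thesis
    using p
  proof (induction p rule: free_algebra_induct_words)
    case zero
    have "(\<lambda>w. \<zero>) \<otimes>\<^bsub>free_algebra R X\<^esub> q = (\<lambda>w. \<zero>)"
      using q F.l_null by (simp add: free_algebra_sel)
    then show ?case
      using z[OF outer[OF q]] z[OF linf] by (simp add: free_algebra_sel)
  next
    case (add p a u)
    then have *: "lin_ext R N (\<lambda>v. f (u @ v)) q \<in> carrier N"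
      using linear_mapD(1)[OF lin1 q] by blast
    show ?case
      using add * q by (simp add: F.l_distr mult_free_algebra_smult w linear_mapD[OF outer[OF q]]
          linear_mapD[OF linf] lin_ext_word[OF N] del: in_lists_conv_set)
  qed
qed

end

section \<open>Multilinear functions on words and the linearity ideal\<close>

text \<open>Linearity in a slot is expressed through the context \<open>u\<close>, \<open>v\<close>
  around that slot. Words of length other than \<open>n\<close> are left unconstrained, so a
  function has to be cut off before it is extended to the whole free algebra.\<close>

definition multilinear ::
  "('k, 'm) ring_scheme \<Rightarrow> ('k, 'v, 'x) module_scheme \<Rightarrow> ('k, 'b, 'y) module_scheme \<Rightarrow>
   nat \<Rightarrow> ('v list \<Rightarrow> 'b) \<Rightarrow> bool"
where
  "multilinear K M N n \<phi> \<longleftrightarrow>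
     (\<forall>w\<in>lists (carrier M). length w = n \<longrightarrow> \<phi> w \<in> carrier N) \<and>
     (\<forall>u\<in>lists (carrier M). \<forall>v\<in>lists (carrier M). Suc (length u + length v) = n \<longrightarrow>
       (\<forall>x\<in>carrier M. \<forall>y\<in>carrier M.
         \<phi> (u @ (x \<oplus>\<^bsub>M\<^esub> y) # v) = \<phi> (u @ x # v) \<oplus>\<^bsub>N\<^esub> \<phi> (u @ y # v)) \<and>
       (\<forall>a\<in>carrier K. \<forall>x\<in>carrier M. \<phi> (u @ (a \<odot>\<^bsub>M\<^esub> x) # v) = a \<odot>\<^bsub>N\<^esub> \<phi> (u @ x # v)))"

context module
begin

lemma linearity_ideal_generators:
  "\<lbrakk>x \<in> carrier M; y \<in> carrier M\<rbrakk> \<Longrightarrow>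
     word R [x \<oplus>\<^bsub>M\<^esub> y] \<ominus>\<^bsub>free_algebra R (carrier M)\<^esub>
       (word R [x] \<oplus>\<^bsub>free_algebra R (carrier M)\<^esub> word R [y]) \<in> linearity_ideal R M"
  "\<lbrakk>a \<in> carrier R; x \<in> carrier M\<rbrakk> \<Longrightarrow>
     word R [a \<odot>\<^bsub>M\<^esub> x] \<ominus>\<^bsub>free_algebra R (carrier M)\<^esub>
       (a \<odot>\<^bsub>free_algebra R (carrier M)\<^esub> word R [x]) \<in> linearity_ideal R M"
  by (auto simp: linearity_ideal_def genideal_def Let_def)

lemma ideal_linearity_ideal: "ideal (linearity_ideal R M) (free_algebra R (carrier M))"
proof -
  interpret F: ring "free_algebra R (carrier M)" by (rule ring_free_algebra)
  interpret F: module R "free_algebra R (carrier M)" by (rule module_free_algebra)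
  show ?thesis
    unfolding linearity_ideal_def Let_def
    by (rule F.genideal_ideal) auto
qed

lemma linearity_ideal_subset:
  assumes "ideal J (free_algebra R (carrier M))"
    and "\<And>x y. \<lbrakk>x \<in> carrier M; y \<in> carrier M\<rbrakk> \<Longrightarrow>
     word R [x \<oplus>\<^bsub>M\<^esub> y] \<ominus>\<^bsub>free_algebra R (carrier M)\<^esub>
       (word R [x] \<oplus>\<^bsub>free_algebra R (carrier M)\<^esub> word R [y]) \<in> J"
    and "\<And>a x. \<lbrakk>a \<in> carrier R; x \<in> carrier M\<rbrakk> \<Longrightarrow>
     word R [a \<odot>\<^bsub>M\<^esub> x] \<ominus>\<^bsub>free_algebra R (carrier M)\<^esub>
       (a \<odot>\<^bsub>free_algebra R (carrier M)\<^esub> word R [x]) \<in> J"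
  shows "linearity_ideal R M \<subseteq> J"
  unfolding linearity_ideal_def Let_def
  by (rule ring.genideal_minimal[OF ring_free_algebra assms(1)]) (use assms in auto)

text \<open>This is the source of the independence of \<open>tensor_lift\<close> from the
  representative. Although \<open>p\<close> is homogeneous, its membership in the ideal may involve
  multiples of generators of every degree, so the argument has to control the whole ideal.\<close>

lemma lin_ext_linearity_ideal:
  assumes N: "module R N" and \<phi>: "multilinear R M N n \<phi>"
    and p: "p \<in> linearity_ideal R M"
    and supp: "support R p \<subseteq> {w. length w = n}"
  shows "lin_ext R N \<phi> p = \<zero>\<^bsub>N\<^esub>"
proof -
  let ?F = "free_algebra R (carrier M)"
  interpret N: module R N by fact
  interpret F: ring ?F by (rule ring_free_algebra)
  interpret F: module R ?F by (rule module_free_algebra)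
  \<comment> \<open>Extension by zero outside degree \<open>n\<close> is linear in every slot in all
    degrees, because each generator relation compares words of equal length.\<close>
  define \<psi> where "\<psi> w = (if length w = n then \<phi> w else \<zero>\<^bsub>N\<^esub>)" for w
  have \<psi>: "\<psi> w \<in> carrier N" if "w \<in> lists (carrier M)" for w
    using that \<phi> by (auto simp: multilinear_def \<psi>_def)
  \<comment> \<open>Quantifying over the context \<open>u _ v\<close> turns the kernel of the extension into an ideal.\<close>
  define J where "J = {p \<in> carrier ?F. \<forall>u\<in>lists (carrier M). \<forall>v\<in>lists (carrier M).
    lin_ext R N (\<lambda>w. \<psi> (u @ w @ v)) p = \<zero>\<^bsub>N\<^esub>}"
  have \<psi>': "\<psi> (u @ w @ v) \<in> carrier N"
    if "u \<in> lists (carrier M)" "v \<in> lists (carrier M)" "w \<in> lists (carrier M)" for u v w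
    using that by (intro \<psi>) auto
  have lin: "linear_map R ?F N (lin_ext R N (\<lambda>w. \<psi> (u @ w @ v)))"
    if "u \<in> lists (carrier M)" "v \<in> lists (carrier M)" for u v
    by (rule lin_ext_linear[OF N]) (rule \<psi>'[OF that])
  note ld = linear_mapD[OF lin] linear_map_zero[OF module_free_algebra N lin]
    linear_map_minus[OF module_free_algebra N lin]
  have zero_ext: "lin_ext R N f q = \<zero>\<^bsub>N\<^esub>"
    if "q \<in> carrier ?F" "\<And>w. w \<in> lists (carrier M) \<Longrightarrow> f w = \<zero>\<^bsub>N\<^esub>" for f q
  proof -
    have "lin_ext R N f q = (\<Oplus>\<^bsub>N\<^esub>w\<in>support R q. \<zero>\<^bsub>N\<^esub>)"
      unfolding lin_ext_def
    proof (rule N.M.finsum_cong')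
      fix w assume "w \<in> support R q"
      then have "w \<in> lists (carrier M)" using that(1) by (auto simp only: free_algebra_carrier_iff)
      then show "q w \<odot>\<^bsub>N\<^esub> f w = \<zero>\<^bsub>N\<^esub>" using that by simp
    qed auto
    then show ?thesis by simp
  qed
  have "ideal J ?F"
  proof (rule idealI)
    show "subgroup J (add_monoid ?F)"
    proof (rule group.subgroupI)
      show "group (add_monoid ?F)" by (rule F.add.group_axioms)
      have "\<zero>\<^bsub>?F\<^esub> \<in> J" using ld(4) by (simp add: J_def)
      then show "J \<noteq> {}" by blast
    qed (auto simp: J_def ld a_inv_def[symmetric] simp del: in_lists_conv_set)
    fix p q assume p: "p \<in> J" and q: "q \<in> carrier ?F"
    then have pc: "p \<in> carrier ?F" by (simp add: J_def)
    show "q \<otimes>\<^bsub>?F\<^esub> p \<in> J"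
    proof -
      have "lin_ext R N (\<lambda>w. \<psi> (u @ w @ v)) (q \<otimes>\<^bsub>?F\<^esub> p) = \<zero>\<^bsub>N\<^esub>"
        if u: "u \<in> lists (carrier M)" and v: "v \<in> lists (carrier M)" for u v
      proof -
        have "lin_ext R N (\<lambda>w. \<psi> (u @ w @ v)) (q \<otimes>\<^bsub>?F\<^esub> p)
           = lin_ext R N (\<lambda>x. lin_ext R N (\<lambda>y. \<psi> (u @ (x @ y) @ v)) p) q"
          by (rule lin_ext_mult[OF N _ q pc]) (rule \<psi>'[OF u v])
        also have "\<dots> = \<zero>\<^bsub>N\<^esub>"
        proof (rule zero_ext[OF q])
          fix x assume "x \<in> lists (carrier M)"
          then have "u @ x \<in> lists (carrier M)" using u by auto
          then have "lin_ext R N (\<lambda>y. \<psi> ((u @ x) @ y @ v)) p = \<zero>\<^bsub>N\<^esub>"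
            using p v unfolding J_def by blast
          then show "lin_ext R N (\<lambda>y. \<psi> (u @ (x @ y) @ v)) p = \<zero>\<^bsub>N\<^esub>" by simp
        qed
        finally show ?thesis .
      qed
      then show ?thesis using pc q by (auto simp: J_def simp del: in_lists_conv_set)
    qed
    show "p \<otimes>\<^bsub>?F\<^esub> q \<in> J"
    proof -
      have "lin_ext R N (\<lambda>w. \<psi> (u @ w @ v)) (p \<otimes>\<^bsub>?F\<^esub> q) = \<zero>\<^bsub>N\<^esub>"
        if u: "u \<in> lists (carrier M)" and v: "v \<in> lists (carrier M)" for u v
      proof -
        \<comment> \<open>The two sides differ because \<open>lin_ext_mult\<close> puts the left
          factor outermost. A left multiple has \<open>p\<close> in the inner sum, where the context
          \<open>u @ x\<close> already kills it. For a right multiple, \<open>q\<close> is first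
          reduced by linearity to a word \<open>w\<close>, which then joins the right context as
          \<open>w @ v\<close>.\<close>
        let ?G = "\<lambda>q. lin_ext R N (\<lambda>x. lin_ext R N (\<lambda>y. \<psi> (u @ (x @ y) @ v)) q) p"
        have inner: "linear_map R ?F N (lin_ext R N (\<lambda>y. \<psi> (u @ (x @ y) @ v)))"
          if "x \<in> lists (carrier M)" for x
          using lin[of "u @ x" v] u v that by simp
        have c: "lin_ext R N (\<lambda>y. \<psi> (u @ (x @ y) @ v)) q \<in> carrier N"
          if "x \<in> lists (carrier M)" "q \<in> carrier ?F" for x q
          by (rule linear_mapD(1)[OF inner[OF that(1)] that(2)])
        have G: "lin_ext R N (\<lambda>w. \<psi> (u @ w @ v)) (p \<otimes>\<^bsub>?F\<^esub> q) = ?G q" if "q \<in> carrier ?F" for q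
          by (rule lin_ext_mult[OF N _ pc that]) (rule \<psi>'[OF u v])
        have "lin_ext R N (\<lambda>w. \<psi> (u @ w @ v)) (p \<otimes>\<^bsub>?F\<^esub> q) = \<zero>\<^bsub>N\<^esub>"
          using q
        proof (induction q rule: free_algebra_induct_words)
          case zero
          have "p \<otimes>\<^bsub>?F\<^esub> (\<lambda>w. \<zero>) = (\<lambda>w. \<zero>)"
            using pc F.r_null by (simp add: free_algebra_sel)
          then show ?case using ld(4)[OF u v] by (simp add: free_algebra_sel)
        next
          case (add q a w)
          have "lin_ext R N (\<lambda>w. \<psi> (u @ w @ v)) (p \<otimes>\<^bsub>?F\<^esub> word R w) = ?G (word R w)"
            using add by (intro G) simp
          also have "\<dots> = lin_ext R N (\<lambda>x. \<psi> (u @ x @ (w @ v))) p"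
          proof (rule lin_ext_cong[OF N pc])
            fix x assume "x \<in> support R p"
            then have x: "x \<in> lists (carrier M)" using pc by (auto simp only: free_algebra_carrier_iff)
            show "\<psi> (u @ x @ w @ v) \<in> carrier N" using x u v add by (intro \<psi>) auto
            then show "lin_ext R N (\<lambda>y. \<psi> (u @ (x @ y) @ v)) (word R w) = \<psi> (u @ x @ (w @ v))"
              by (subst lin_ext_word[OF N]) auto
          qed
          also have "\<dots> = \<zero>\<^bsub>N\<^esub>"
          proof -
            have "w @ v \<in> lists (carrier M)" using v add by simp
            then show ?thesis using p u unfolding J_def by blast
          qed
          finally show ?case
            using add pc u v by (simp add: F.r_distr mult_free_algebra_smult ld del: in_lists_conv_set)
        qed
        then show ?thesis .
      qed
      then show ?thesis using pc q by (auto simp: J_def simp del: in_lists_conv_set)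
    qed
  qed (rule ring_free_algebra)
  moreover have "word R [x \<oplus>\<^bsub>M\<^esub> y] \<ominus>\<^bsub>?F\<^esub> (word R [x] \<oplus>\<^bsub>?F\<^esub> word R [y]) \<in> J"
    if xy: "x \<in> carrier M" "y \<in> carrier M" for x y
  proof -
    have "lin_ext R N (\<lambda>w. \<psi> (u @ w @ v)) (word R [x \<oplus>\<^bsub>M\<^esub> y] \<ominus>\<^bsub>?F\<^esub> (word R [x] \<oplus>\<^bsub>?F\<^esub> word R [y]))
        = \<zero>\<^bsub>N\<^esub>" if u: "u \<in> lists (carrier M)" and v: "v \<in> lists (carrier M)" for u v
    proof -
      have c: "\<psi> (u @ z # v) \<in> carrier N" if "z \<in> carrier M" for z
        using \<psi>'[of u v "[z]"] u v that by simp
      have "\<psi> (u @ (x \<oplus>\<^bsub>M\<^esub> y) # v) = \<psi> (u @ x # v) \<oplus>\<^bsub>N\<^esub> \<psi> (u @ y # v)"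
        using \<phi> u v xy unfolding multilinear_def \<psi>_def by simp
      then show ?thesis
        using xy c
        by (simp add: a_minus_def ld[OF u v] lin_ext_word[OF N] N.M.r_neg)
    qed
    then show ?thesis using xy by (auto simp: J_def simp del: in_lists_conv_set)
  qed
  moreover have "word R [a \<odot>\<^bsub>M\<^esub> x] \<ominus>\<^bsub>?F\<^esub> (a \<odot>\<^bsub>?F\<^esub> word R [x]) \<in> J"
    if ax: "a \<in> carrier R" "x \<in> carrier M" for a x
  proof -
    have "lin_ext R N (\<lambda>w. \<psi> (u @ w @ v)) (word R [a \<odot>\<^bsub>M\<^esub> x] \<ominus>\<^bsub>?F\<^esub> (a \<odot>\<^bsub>?F\<^esub> word R [x]))
        = \<zero>\<^bsub>N\<^esub>" if u: "u \<in> lists (carrier M)" and v: "v \<in> lists (carrier M)" for u v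
    proof -
      have c: "\<psi> (u @ z # v) \<in> carrier N" if "z \<in> carrier M" for z
        using \<psi>'[of u v "[z]"] u v that by simp
      have "\<psi> (u @ (a \<odot>\<^bsub>M\<^esub> x) # v) = a \<odot>\<^bsub>N\<^esub> \<psi> (u @ x # v)"
        using \<phi> u v ax unfolding multilinear_def \<psi>_def by simp
      then show ?thesis
        using ax c
        by (simp add: a_minus_def ld[OF u v] lin_ext_word[OF N] N.M.r_neg)
    qed
    then show ?thesis using ax by (auto simp: J_def simp del: in_lists_conv_set)
  qed
  ultimately have "linearity_ideal R M \<subseteq> J" by (rule linearity_ideal_subset)
  then have "p \<in> J" using p by blast
  \<comment> \<open>The empty context recovers the extension itself.\<close>
  then have "lin_ext R N (\<lambda>w. \<psi> ([] @ w @ [])) p = \<zero>\<^bsub>N\<^esub>" and pc: "p \<in> carrier ?F"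
    unfolding J_def by blast+
  moreover have "lin_ext R N \<phi> p = lin_ext R N \<psi> p"
  proof (rule lin_ext_cong[OF N pc])
    fix w assume w: "w \<in> support R p"
    then show "\<phi> w = \<psi> w" using supp by (auto simp: \<psi>_def)
    show "\<psi> w \<in> carrier N" using w pc by (intro \<psi>) (auto simp only: free_algebra_carrier_iff)
  qed
  ultimately show ?thesis by simp
qed

end

section \<open>Tensor powers\<close>

context module
begin

lemma tensor_algebra_sel:
  "carrier (tensor_algebra R M) = a_rcosets\<^bsub>free_algebra R (carrier M)\<^esub> (linearity_ideal R M)"
  "mult (tensor_algebra R M) = rcoset_mult (free_algebra R (carrier M)) (linearity_ideal R M)"
  "add (tensor_algebra R M) = set_add (free_algebra R (carrier M))"
  "zero (tensor_algebra R M) = linearity_ideal R M"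
  "smult (tensor_algebra R M) a X = (\<Union>x\<in>X. linearity_ideal R M +>\<^bsub>free_algebra R (carrier M)\<^esub>
     (a \<odot>\<^bsub>free_algebra R (carrier M)\<^esub> x))"
  by (simp_all add: tensor_algebra_def quotient_algebra_def ring.defs module.defs FactRing_def)

definition tclass :: "('c list \<Rightarrow> 'a) \<Rightarrow> ('c list \<Rightarrow> 'a) set" where
  "tclass p = linearity_ideal R M +>\<^bsub>free_algebra R (carrier M)\<^esub> p"

lemma tens_eq_tclass: "tens R M w = tclass (word R w)"
  by (simp add: tens_def tclass_def)

lemma carrier_tensor_algebra:
  "carrier (tensor_algebra R M) = tclass ` carrier (free_algebra R (carrier M))"
  by (auto simp: tensor_algebra_sel A_RCOSETS_def' tclass_def)

lemma abelian_subgroup_linearity_ideal: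
  "abelian_subgroup (linearity_ideal R M) (free_algebra R (carrier M))"
proof -
  interpret ideal "linearity_ideal R M" "free_algebra R (carrier M)"
    by (rule ideal_linearity_ideal)
  show ?thesis by unfold_locales
qed

lemma tclass_self: "p \<in> carrier (free_algebra R (carrier M)) \<Longrightarrow> p \<in> tclass p"
  using abelian_subgroup.a_rcos_self[OF abelian_subgroup_linearity_ideal]
  by (simp add: tclass_def)

lemma tclass_eq_iff:
  assumes "p \<in> carrier (free_algebra R (carrier M))" "q \<in> carrier (free_algebra R (carrier M))"
  shows "tclass p = tclass q \<longleftrightarrow> p \<ominus>\<^bsub>free_algebra R (carrier M)\<^esub> q \<in> linearity_ideal R M"
  using ring.quotient_eq_iff_same_a_r_cos[OF ring_free_algebra ideal_linearity_ideal assms]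
  by (simp add: tclass_def)

lemma tclass_memD:
  assumes "p \<in> carrier (free_algebra R (carrier M))" "q \<in> tclass p"
  shows "q \<in> carrier (free_algebra R (carrier M))" "tclass q = tclass p"
proof -
  interpret I: ideal "linearity_ideal R M" "free_algebra R (carrier M)"
    by (rule ideal_linearity_ideal)
  show "q \<in> carrier (free_algebra R (carrier M))"
    using assms I.a_elemrcos_carrier by (simp add: tclass_def)
  show "tclass q = tclass p"
    using assms I.a_repr_independence' by (simp add: tclass_def)
qed

lemma tclass_zero: "\<zero>\<^bsub>tensor_algebra R M\<^esub> = tclass \<zero>\<^bsub>free_algebra R (carrier M)\<^esub>"
proof -
  interpret I: ideal "linearity_ideal R M" "free_algebra R (carrier M)"
    by (rule ideal_linearity_ideal)
  show ?thesis
    using I.a_coset_add_zero[OF I.a_subset] by (simp add: tensor_algebra_sel tclass_def)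
qed

lemma tclass_add:
  assumes "p \<in> carrier (free_algebra R (carrier M))" "q \<in> carrier (free_algebra R (carrier M))"
  shows "tclass p \<oplus>\<^bsub>tensor_algebra R M\<^esub> tclass q = tclass (p \<oplus>\<^bsub>free_algebra R (carrier M)\<^esub> q)"
  using abelian_subgroup.a_rcos_sum[OF abelian_subgroup_linearity_ideal assms]
  by (simp add: tclass_def tensor_algebra_sel)

lemma tclass_mult:
  assumes "p \<in> carrier (free_algebra R (carrier M))" "q \<in> carrier (free_algebra R (carrier M))"
  shows "tclass p \<otimes>\<^bsub>tensor_algebra R M\<^esub> tclass q = tclass (p \<otimes>\<^bsub>free_algebra R (carrier M)\<^esub> q)"
  using ideal.rcoset_mult_add[OF ideal_linearity_ideal assms]
  by (simp add: tclass_def tensor_algebra_sel)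

lemma tclass_smult:
  assumes a: "a \<in> carrier R" and p: "p \<in> carrier (free_algebra R (carrier M))"
  shows "a \<odot>\<^bsub>tensor_algebra R M\<^esub> tclass p = tclass (a \<odot>\<^bsub>free_algebra R (carrier M)\<^esub> p)"
proof -
  let ?F = "free_algebra R (carrier M)"
  interpret I: ideal "linearity_ideal R M" ?F by (rule ideal_linearity_ideal)
  interpret F: module R ?F by (rule module_free_algebra)
  \<comment> \<open>A ring ideal is closed under scalars since a scalar acts as multiplication by a
    multiple of the unit.\<close>
  have closed: "a \<odot>\<^bsub>?F\<^esub> x \<in> linearity_ideal R M" if x: "x \<in> linearity_ideal R M" for x
  proof -
    have "a \<odot>\<^bsub>?F\<^esub> x = (a \<odot>\<^bsub>?F\<^esub> \<one>\<^bsub>?F\<^esub>) \<otimes>\<^bsub>?F\<^esub> x"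
      using a I.Icarr[OF x] by (simp add: mult_free_algebra_smult)
    then show ?thesis using a x by (simp add: I.I_l_closed)
  qed
  have "tclass (a \<odot>\<^bsub>?F\<^esub> x) = tclass (a \<odot>\<^bsub>?F\<^esub> p)" if x: "x \<in> tclass p" for x
  proof -
    note xc = tclass_memD[OF p x]
    have "x \<ominus>\<^bsub>?F\<^esub> p \<in> linearity_ideal R M" using xc p tclass_eq_iff by simp
    from closed[OF this] have "a \<odot>\<^bsub>?F\<^esub> x \<ominus>\<^bsub>?F\<^esub> a \<odot>\<^bsub>?F\<^esub> p \<in> linearity_ideal R M"
      using a p xc by (simp add: a_minus_def F.smult_r_distr F.smult_r_minus)
    then show ?thesis using a p xc tclass_eq_iff by simp
  qed
  \<comment> \<open>The scalar action on cosets is a union over all representatives; as they all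
    yield the same coset, the union collapses.\<close>
  then have "(\<Union>x\<in>tclass p. tclass (a \<odot>\<^bsub>?F\<^esub> x)) = (\<Union>x\<in>tclass p. tclass (a \<odot>\<^bsub>?F\<^esub> p))"
    by (rule SUP_cong[OF refl])
  then show ?thesis
    using tclass_self[OF p] by (auto simp: tensor_algebra_sel simp flip: tclass_def)
qed

lemma module_tensor_algebra: "module R (tensor_algebra R M)"
proof -
  interpret F: module R "free_algebra R (carrier M)" by (rule module_free_algebra)
  show ?thesis
  proof (rule moduleI)
    show "abelian_group (tensor_algebra R M)"
    proof (rule abelian_groupI)
      fix X assume "X \<in> carrier (tensor_algebra R M)"
      then obtain p where p: "X = tclass p" "p \<in> carrier (free_algebra R (carrier M))"
        by (auto simp: carrier_tensor_algebra)
      then show "\<exists>Y\<in>carrier (tensor_algebra R M).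
          Y \<oplus>\<^bsub>tensor_algebra R M\<^esub> X = \<zero>\<^bsub>tensor_algebra R M\<^esub>"
        by (intro bexI[where x = "tclass (\<ominus>\<^bsub>free_algebra R (carrier M)\<^esub> p)"])
          (auto simp: carrier_tensor_algebra tclass_add tclass_zero F.M.l_neg)
    qed (auto simp: carrier_tensor_algebra tclass_add tclass_zero F.M.a_ac)
  qed (auto simp: carrier_tensor_algebra tclass_add tclass_smult F.smult_l_distr F.smult_r_distr
      F.smult_assoc1 is_cring)
qed

lemma tensor_algebra_mult_closed:
  "\<lbrakk>X \<in> carrier (tensor_algebra R M); Y \<in> carrier (tensor_algebra R M)\<rbrakk>
    \<Longrightarrow> X \<otimes>\<^bsub>tensor_algebra R M\<^esub> Y \<in> carrier (tensor_algebra R M)"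
  by (auto simp: carrier_tensor_algebra tclass_mult mult_free_algebra_closed)

lemma tensor_algebra_mult_linear:
  assumes "X \<in> carrier (tensor_algebra R M)" "Y \<in> carrier (tensor_algebra R M)"
  shows "Z \<in> carrier (tensor_algebra R M) \<Longrightarrow> (X \<oplus>\<^bsub>tensor_algebra R M\<^esub> Y) \<otimes>\<^bsub>tensor_algebra R M\<^esub> Z =
      X \<otimes>\<^bsub>tensor_algebra R M\<^esub> Z \<oplus>\<^bsub>tensor_algebra R M\<^esub> Y \<otimes>\<^bsub>tensor_algebra R M\<^esub> Z"
    "Z \<in> carrier (tensor_algebra R M) \<Longrightarrow> Z \<otimes>\<^bsub>tensor_algebra R M\<^esub> (X \<oplus>\<^bsub>tensor_algebra R M\<^esub> Y) =
      Z \<otimes>\<^bsub>tensor_algebra R M\<^esub> X \<oplus>\<^bsub>tensor_algebra R M\<^esub> Z \<otimes>\<^bsub>tensor_algebra R M\<^esub> Y"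
    "a \<in> carrier R \<Longrightarrow> (a \<odot>\<^bsub>tensor_algebra R M\<^esub> X) \<otimes>\<^bsub>tensor_algebra R M\<^esub> Y =
      a \<odot>\<^bsub>tensor_algebra R M\<^esub> (X \<otimes>\<^bsub>tensor_algebra R M\<^esub> Y)"
    "a \<in> carrier R \<Longrightarrow> X \<otimes>\<^bsub>tensor_algebra R M\<^esub> (a \<odot>\<^bsub>tensor_algebra R M\<^esub> Y) =
      a \<odot>\<^bsub>tensor_algebra R M\<^esub> (X \<otimes>\<^bsub>tensor_algebra R M\<^esub> Y)"
proof -
  interpret F: module R "free_algebra R (carrier M)" by (rule module_free_algebra)
  interpret F: ring "free_algebra R (carrier M)" by (rule ring_free_algebra)
  show "Z \<in> carrier (tensor_algebra R M) \<Longrightarrow> (X \<oplus>\<^bsub>tensor_algebra R M\<^esub> Y) \<otimes>\<^bsub>tensor_algebra R M\<^esub> Z =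
      X \<otimes>\<^bsub>tensor_algebra R M\<^esub> Z \<oplus>\<^bsub>tensor_algebra R M\<^esub> Y \<otimes>\<^bsub>tensor_algebra R M\<^esub> Z"
    "Z \<in> carrier (tensor_algebra R M) \<Longrightarrow> Z \<otimes>\<^bsub>tensor_algebra R M\<^esub> (X \<oplus>\<^bsub>tensor_algebra R M\<^esub> Y) =
      Z \<otimes>\<^bsub>tensor_algebra R M\<^esub> X \<oplus>\<^bsub>tensor_algebra R M\<^esub> Z \<otimes>\<^bsub>tensor_algebra R M\<^esub> Y"
    "a \<in> carrier R \<Longrightarrow> (a \<odot>\<^bsub>tensor_algebra R M\<^esub> X) \<otimes>\<^bsub>tensor_algebra R M\<^esub> Y =
      a \<odot>\<^bsub>tensor_algebra R M\<^esub> (X \<otimes>\<^bsub>tensor_algebra R M\<^esub> Y)"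
    "a \<in> carrier R \<Longrightarrow> X \<otimes>\<^bsub>tensor_algebra R M\<^esub> (a \<odot>\<^bsub>tensor_algebra R M\<^esub> Y) =
      a \<odot>\<^bsub>tensor_algebra R M\<^esub> (X \<otimes>\<^bsub>tensor_algebra R M\<^esub> Y)"
    using assms
    by (auto simp: carrier_tensor_algebra tclass_add tclass_mult tclass_smult F.l_distr F.r_distr
        mult_free_algebra_smult)
qed

lemma tens_closed: "w \<in> lists (carrier M) \<Longrightarrow> tens R M w \<in> carrier (tensor_algebra R M)"
  by (auto simp: carrier_tensor_algebra tens_eq_tclass)

lemma tens_append:
  assumes "u \<in> lists (carrier M)" "v \<in> lists (carrier M)"
  shows "tens R M (u @ v) = tens R M u \<otimes>\<^bsub>tensor_algebra R M\<^esub> tens R M v"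
  using assms by (simp add: tens_eq_tclass tclass_mult word_mult del: in_lists_conv_set)

lemma tens_singleton_linear: "linear_map R M (tensor_algebra R M) (\<lambda>x. tens R M [x])"
proof (rule linear_mapI)
  interpret F: module R "free_algebra R (carrier M)" by (rule module_free_algebra)
  fix x assume x: "x \<in> carrier M"
  then show "tens R M [x] \<in> carrier (tensor_algebra R M)" by (intro tens_closed) simp
  {
    fix y assume y: "y \<in> carrier M"
    then show "tens R M [x \<oplus>\<^bsub>M\<^esub> y] = tens R M [x] \<oplus>\<^bsub>tensor_algebra R M\<^esub> tens R M [y]"
      using x linearity_ideal_generators(1)[OF x y]
      by (simp add: tens_eq_tclass tclass_add tclass_eq_iff)
  }
  {
    fix a assume a: "a \<in> carrier R"
    then show "tens R M [a \<odot>\<^bsub>M\<^esub> x] = a \<odot>\<^bsub>tensor_algebra R M\<^esub> tens R M [x]"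
      using x linearity_ideal_generators(2)[OF a x]
      by (simp add: tens_eq_tclass tclass_smult tclass_eq_iff)
  }
qed

lemma tens_multilinear: "multilinear R M (tensor_algebra R M) n (tens R M)"
proof -
  have 1: "tens R M (u @ x # v) =
      tens R M u \<otimes>\<^bsub>tensor_algebra R M\<^esub> (tens R M [x] \<otimes>\<^bsub>tensor_algebra R M\<^esub> tens R M v)"
    if "u \<in> lists (carrier M)" "v \<in> lists (carrier M)" "x \<in> carrier M" for u v x
    using that tens_append[of u "x # v"] tens_append[of "[x]" v] by simp
  have 2: "tens R M [x] \<in> carrier (tensor_algebra R M)" if "x \<in> carrier M" for x
    using that by (intro tens_closed) simp
  show ?thesis
    unfolding multilinear_def
    by (auto simp: 1 2 tens_closed tensor_algebra_mult_linear tensor_algebra_mult_closed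
        linear_mapD(2,3)[OF tens_singleton_linear] simp del: in_lists_conv_set)
qed

lemma listset_replicate: "listset (replicate n A) = {w \<in> lists A. length w = n}"
proof (induction n)
  case (Suc n)
  show ?case
    using Suc by (auto simp: set_Cons_def length_Suc_conv)
qed auto

lemma tensor_power_sel [simp]:
  "add (tensor_power R M n) = add (tensor_algebra R M)"
  "zero (tensor_power R M n) = zero (tensor_algebra R M)"
  "mult (tensor_power R M n) = mult (tensor_algebra R M)"
  "smult (tensor_power R M n) = smult (tensor_algebra R M)"
  by (simp_all add: tensor_power_def tensor_product_def)

text \<open>A coset is the class of any of its members, so a member supported on words of length
  \<open>n\<close> may serve as the representative.\<close>

lemma carrier_tensor_power:
  "carrier (tensor_power R M n) =
     tclass ` {p \<in> carrier (free_algebra R (carrier M)). support R p \<subseteq> {w \<in> lists (carrier M). length w = n}}"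
    (is "_ = tclass ` ?S")
proof -
  let ?W = "{w \<in> lists (carrier M). length w = n}"
  have eq: "carrier (tensor_power R M n) =
      {X \<in> tclass ` carrier (free_algebra R (carrier M)). \<exists>p\<in>X. support R p \<subseteq> ?W}"
    unfolding tensor_power_def tensor_product_def listset_replicate carrier_tensor_algebra by simp
  show ?thesis
  proof (intro equalityI subsetI)
    fix X assume "X \<in> carrier (tensor_power R M n)"
    then have X: "X \<in> tclass ` carrier (free_algebra R (carrier M))"
        and "\<exists>p\<in>X. support R p \<subseteq> ?W"
      by (simp_all only: eq mem_Collect_eq)
    then obtain p where p: "p \<in> X" "support R p \<subseteq> ?W" by (elim bexE)
    from X obtain q where q: "q \<in> carrier (free_algebra R (carrier M))" "X = tclass q"
      by (elim imageE)
    have "p \<in> ?S" "X = tclass p"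
      using tclass_memD[OF q(1), of p] p q(2) by simp_all
    then show "X \<in> tclass ` ?S" by (simp only: image_eqI)
  next
    fix X assume "X \<in> tclass ` ?S"
    then obtain p where p: "p \<in> ?S" "X = tclass p" by (elim imageE)
    then show "X \<in> carrier (tensor_power R M n)"
      using tclass_self[of p] by (auto simp: eq simp del: in_lists_conv_set)
  qed
qed

lemma tensor_power_subset: "X \<in> carrier (tensor_power R M n) \<Longrightarrow> X \<in> carrier (tensor_algebra R M)"
  by (auto simp: carrier_tensor_power carrier_tensor_algebra)

lemma tens_in_tensor_power:
  "\<lbrakk>w \<in> lists (carrier M); length w = n\<rbrakk> \<Longrightarrow> tens R M w \<in> carrier (tensor_power R M n)"
  using support_word unfolding carrier_tensor_power tens_eq_tclass
  by (intro imageI) (auto simp del: in_lists_conv_set)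

lemma module_tensor_power: "module R (tensor_power R M n)"
proof -
  interpret T: module R "tensor_algebra R M" by (rule module_tensor_algebra)
  let ?F = "free_algebra R (carrier M)"
  interpret F: module R ?F by (rule module_free_algebra)
  have add: "X \<oplus>\<^bsub>tensor_algebra R M\<^esub> Y \<in> carrier (tensor_power R M n)"
    if XY: "X \<in> carrier (tensor_power R M n)" "Y \<in> carrier (tensor_power R M n)" for X Y
  proof -
    from XY obtain p q where pq: "p \<in> carrier ?F" "q \<in> carrier ?F" "X = tclass p" "Y = tclass q"
      "support R p \<subseteq> {w \<in> lists (carrier M). length w = n}"
      "support R q \<subseteq> {w \<in> lists (carrier M). length w = n}"
      by (auto simp: carrier_tensor_power)
    then have "support R (p \<oplus>\<^bsub>?F\<^esub> q) \<subseteq> {w \<in> lists (carrier M). length w = n}"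
      using support_add_subset by blast
    then show ?thesis using pq by (auto simp: carrier_tensor_power tclass_add simp del: in_lists_conv_set)
  qed
  have smult: "a \<odot>\<^bsub>tensor_algebra R M\<^esub> X \<in> carrier (tensor_power R M n)"
    if a: "a \<in> carrier R" and X: "X \<in> carrier (tensor_power R M n)" for a X
  proof -
    from X obtain p where p: "p \<in> carrier ?F" "X = tclass p"
      "support R p \<subseteq> {w \<in> lists (carrier M). length w = n}"
      by (auto simp: carrier_tensor_power)
    then have "support R (a \<odot>\<^bsub>?F\<^esub> p) \<subseteq> {w \<in> lists (carrier M). length w = n}"
      using support_smult_subset[OF a] by blast
    then show ?thesis using p a by (auto simp: carrier_tensor_power tclass_smult simp del: in_lists_conv_set)
  qed
  have "submodule (carrier (tensor_power R M n)) R (tensor_algebra R M)"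
  proof (rule T.submoduleI)
    have "\<zero>\<^bsub>?F\<^esub> \<in> {p \<in> carrier ?F. support R p \<subseteq> {w \<in> lists (carrier M). length w = n}}"
      using F.M.zero_closed by (simp add: free_algebra_sel(1))
    then show "\<zero>\<^bsub>tensor_algebra R M\<^esub> \<in> carrier (tensor_power R M n)"
      unfolding carrier_tensor_power tclass_zero by (rule imageI)
    fix X assume X: "X \<in> carrier (tensor_power R M n)"
    have "\<ominus>\<^bsub>tensor_algebra R M\<^esub> X = (\<ominus>\<^bsub>R\<^esub> \<one>\<^bsub>R\<^esub>) \<odot>\<^bsub>tensor_algebra R M\<^esub> X"
      using tensor_power_subset[OF X] by (simp add: T.smult_l_minus)
    then show "\<ominus>\<^bsub>tensor_algebra R M\<^esub> X \<in> carrier (tensor_power R M n)"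
      using smult X by simp
  qed (use add smult tensor_power_subset in auto)
  from submodule.submodule_is_module[OF this module_tensor_algebra]
  show ?thesis by (simp add: tensor_power_def tensor_product_def)
qed

text \<open>Pure tensors of degree \<open>n\<close> span, because a homogeneous representative is a
  combination of words of length \<open>n\<close>.\<close>

lemma tensor_power_induct [consumes 1, case_names zero add]:
  assumes X: "X \<in> carrier (tensor_power R M n)"
    and zero: "P \<zero>\<^bsub>tensor_algebra R M\<^esub>"
    and add: "\<And>Y a w. \<lbrakk>Y \<in> carrier (tensor_power R M n); P Y; a \<in> carrier R;
        w \<in> lists (carrier M); length w = n\<rbrakk>
      \<Longrightarrow> P (Y \<oplus>\<^bsub>tensor_algebra R M\<^esub> a \<odot>\<^bsub>tensor_algebra R M\<^esub> tens R M w)"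
  shows "P X"
proof -
  let ?F = "free_algebra R (carrier M)"
  interpret F: module R ?F by (rule module_free_algebra)
  obtain p where p: "p \<in> carrier ?F" "X = tclass p"
      and supp: "support R p \<subseteq> {w \<in> lists (carrier M). length w = n}"
    using X by (auto simp: carrier_tensor_power)
  have "{w \<in> lists (carrier M). length w = n} \<subseteq> lists (carrier M)" by blast
  with p(1) supp have "P (tclass p)"
  proof (induction p rule: free_algebra_induct)
    case zero
    then show ?case using assms(2) by (simp add: tclass_zero free_algebra_sel)
  next
    case (add q a w)
    have w: "w \<in> lists (carrier M)" "length w = n" using add by auto
    have "tclass q \<in> carrier (tensor_power R M n)"
      unfolding carrier_tensor_power using add by blast
    then have "P (tclass q \<oplus>\<^bsub>tensor_algebra R M\<^esub> a \<odot>\<^bsub>tensor_algebra R M\<^esub> tens R M w)"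
      using assms(3) add w by blast
    then show ?case
      using add w by (simp add: tens_eq_tclass tclass_add tclass_smult del: in_lists_conv_set)
  qed
  then show ?thesis using p by simp
qed

lemma tensor_power_linear_eqI:
  assumes "module R N" "linear_map R (tensor_power R M n) N f" "linear_map R (tensor_power R M n) N g"
    and "\<And>w. \<lbrakk>w \<in> lists (carrier M); length w = n\<rbrakk> \<Longrightarrow> f (tens R M w) = g (tens R M w)"
    and "X \<in> carrier (tensor_power R M n)"
  shows "f X = g X"
  using assms(5)
proof (induction X rule: tensor_power_induct)
  case zero
  show ?case
    using linear_map_zero[OF module_tensor_power assms(1,2)]
      linear_map_zero[OF module_tensor_power assms(1,3)] by simp
next
  case (add Y a w)
  interpret T: module R "tensor_power R M n" by (rule module_tensor_power)
  have "a \<odot>\<^bsub>tensor_algebra R M\<^esub> tens R M w \<in> carrier (tensor_power R M n)"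
    using T.smult_closed[OF add(2) tens_in_tensor_power[OF add(3,4)]] by simp
  then show ?case
    using add tens_in_tensor_power[OF add(3,4)] assms(4)[OF add(3,4)]
      linear_mapD(2,3)[OF assms(2)] linear_mapD(2,3)[OF assms(3)]
    by simp
qed

section \<open>Universal property of tensor powers\<close>

text \<open>The representative \<open>q\<close> chosen by \<open>SOME\<close> may differ from
  \<open>p\<close>, but \<open>q\<close> minus \<open>p\<close> is homogeneous of degree
  \<open>n\<close> and lies in the linearity ideal, where multilinear extensions vanish.\<close>

lemma tensor_lift_tclass:
  assumes N: "module R N" and \<phi>: "multilinear R M N n \<phi>"
    and p: "p \<in> carrier (free_algebra R (carrier M))"
    and supp: "support R p \<subseteq> {w \<in> lists (carrier M). length w = n}"
  shows "tensor_lift R M N (replicate n (carrier M)) \<phi> (tclass p) = lin_ext R N \<phi> p"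
proof -
  let ?F = "free_algebra R (carrier M)"
  interpret F: module R ?F by (rule module_free_algebra)
  interpret N: module R N by (rule N)
  define q where "q = (SOME q. q \<in> tclass p \<and> support R q \<subseteq> listset (replicate n (carrier M)))"
  have "q \<in> tclass p \<and> support R q \<subseteq> listset (replicate n (carrier M))"
    unfolding q_def
    by (rule someI[of _ p]) (use p supp tclass_self in \<open>simp add: listset_replicate\<close>)
  then have q: "q \<in> tclass p" and supp_q: "support R q \<subseteq> {w \<in> lists (carrier M). length w = n}"
    by (simp_all add: listset_replicate)
  note qc = tclass_memD[OF p q]
  have \<phi>c: "\<phi> w \<in> carrier N" if "w \<in> lists (carrier M)" "length w = n" for w
    using \<phi> that by (simp add: multilinear_def)
  \<comment> \<open>The cut-off takes values in \<open>N\<close> on all words, so its extension is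
    linear on the whole free algebra and can be applied to differences.\<close>
  define \<psi> where "\<psi> w = (if length w = n then \<phi> w else \<zero>\<^bsub>N\<^esub>)" for w
  have lin: "linear_map R ?F N (lin_ext R N \<psi>)"
    by (rule lin_ext_linear[OF N]) (use \<phi>c in \<open>auto simp: \<psi>_def\<close>)
  have \<psi>: "lin_ext R N \<psi> r = lin_ext R N \<phi> r"
    if "r \<in> carrier ?F" "support R r \<subseteq> {w \<in> lists (carrier M). length w = n}" for r
    by (rule lin_ext_cong[OF N that(1)]) (use that \<phi>c in \<open>auto simp: \<psi>_def\<close>)
  \<comment> \<open>The difference is written with the scalar minus one, since the support bounds
    concern sums and scalar multiples.\<close>
  let ?d = "q \<oplus>\<^bsub>?F\<^esub> (\<ominus>\<^bsub>R\<^esub> \<one>\<^bsub>R\<^esub>) \<odot>\<^bsub>?F\<^esub> p"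
  have d: "?d \<in> carrier ?F" "?d = q \<ominus>\<^bsub>?F\<^esub> p"
    using qc p by (auto simp: a_minus_def F.smult_l_minus)
  have "support R ?d \<subseteq> {w \<in> lists (carrier M). length w = n}"
    using support_add_subset[OF qc(1), of "(\<ominus>\<^bsub>R\<^esub> \<one>\<^bsub>R\<^esub>) \<odot>\<^bsub>?F\<^esub> p"]
      support_smult_subset[OF _ p, of "\<ominus>\<^bsub>R\<^esub> \<one>\<^bsub>R\<^esub>"] supp supp_q p by fastforce
  moreover have "?d \<in> linearity_ideal R M"
    using qc p d tclass_eq_iff by metis
  ultimately have "lin_ext R N \<psi> ?d = \<zero>\<^bsub>N\<^esub>"
    using \<psi>[OF d(1)] lin_ext_linearity_ideal[OF N \<phi>, of ?d] by auto
  moreover have "lin_ext R N \<psi> ?d = lin_ext R N \<psi> q \<ominus>\<^bsub>N\<^esub> lin_ext R N \<psi> p"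
    using qc p linear_mapD(2)[OF lin] linear_map_minus[OF module_free_algebra N lin]
    by (simp add: d(2) a_minus_def)
  ultimately have "lin_ext R N \<psi> q = lin_ext R N \<psi> p"
    using linear_mapD(1)[OF lin qc(1)] linear_mapD(1)[OF lin p]
    by (metis N.M.minus_equality N.M.minus_minus N.M.add.inv_closed a_minus_def)
  then have "lin_ext R N \<phi> q = lin_ext R N \<phi> p"
    using \<psi> qc p supp supp_q by simp
  then show ?thesis
    by (simp add: tensor_lift_def Let_def lin_ext_def flip: q_def)
qed

lemma tensor_lift_tens:
  assumes N: "module R N" and \<phi>: "multilinear R M N n \<phi>"
    and w: "w \<in> lists (carrier M)" "length w = n"
  shows "tensor_lift R M N (replicate n (carrier M)) \<phi> (tens R M w) = \<phi> w"
proof -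
  have "\<phi> w \<in> carrier N" using \<phi> w by (simp add: multilinear_def)
  moreover have "support R (word R w) \<subseteq> {w \<in> lists (carrier M). length w = n}"
    using w support_word by blast
  ultimately show ?thesis
    using w by (simp add: tens_eq_tclass tensor_lift_tclass[OF N \<phi>] lin_ext_word[OF N])
qed

lemma tensor_lift_linear:
  assumes N: "module R N" and \<phi>: "multilinear R M N n \<phi>"
  shows "linear_map R (tensor_power R M n) N (tensor_lift R M N (replicate n (carrier M)) \<phi>)"
proof -
  let ?F = "free_algebra R (carrier M)" and ?W = "{w \<in> lists (carrier M). length w = n}"
  interpret F: module R ?F by (rule module_free_algebra)
  interpret N: module R N by (rule N)
  have \<phi>c: "\<phi> w \<in> carrier N" if "w \<in> lists (carrier M)" "length w = n" for w
    using \<phi> that by (simp add: multilinear_def)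
  define \<psi> where "\<psi> w = (if length w = n then \<phi> w else \<zero>\<^bsub>N\<^esub>)" for w
  have lin: "linear_map R ?F N (lin_ext R N \<psi>)"
    by (rule lin_ext_linear[OF N]) (use \<phi>c in \<open>auto simp: \<psi>_def\<close>)
  have \<psi>: "tensor_lift R M N (replicate n (carrier M)) \<phi> (tclass r) = lin_ext R N \<psi> r"
    if "r \<in> carrier ?F" "support R r \<subseteq> ?W" for r
    unfolding tensor_lift_tclass[OF N \<phi> that]
  proof (rule lin_ext_cong[OF N that(1)])
    fix w assume "w \<in> support R r"
    then have "w \<in> lists (carrier M)" "length w = n" using that(2) by blast+
    then show "\<phi> w = \<psi> w" "\<psi> w \<in> carrier N" using \<phi>c by (simp_all add: \<psi>_def)
  qed
  show ?thesis
  proof (rule linear_mapI)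
    fix X assume "X \<in> carrier (tensor_power R M n)"
    then obtain p where p: "p \<in> carrier ?F" "support R p \<subseteq> ?W" "X = tclass p"
      by (auto simp: carrier_tensor_power)
    then show "tensor_lift R M N (replicate n (carrier M)) \<phi> X \<in> carrier N"
      using linear_mapD(1)[OF lin] \<psi> by simp
    {
      fix Y assume "Y \<in> carrier (tensor_power R M n)"
      then obtain q where q: "q \<in> carrier ?F" "support R q \<subseteq> ?W" "Y = tclass q"
        by (auto simp: carrier_tensor_power)
      have "support R (p \<oplus>\<^bsub>?F\<^esub> q) \<subseteq> ?W"
        using support_add_subset p q by blast
      then show "tensor_lift R M N (replicate n (carrier M)) \<phi> (X \<oplus>\<^bsub>tensor_power R M n\<^esub> Y) =
        tensor_lift R M N (replicate n (carrier M)) \<phi> X \<oplus>\<^bsub>N\<^esub>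
        tensor_lift R M N (replicate n (carrier M)) \<phi> Y"
        using p q by (simp add: tclass_add \<psi> linear_mapD(2)[OF lin])
    }
    fix a assume a: "a \<in> carrier R"
    have "support R (a \<odot>\<^bsub>?F\<^esub> p) \<subseteq> ?W"
      using support_smult_subset[OF a] p by blast
    then show "tensor_lift R M N (replicate n (carrier M)) \<phi> (a \<odot>\<^bsub>tensor_power R M n\<^esub> X) =
        a \<odot>\<^bsub>N\<^esub> tensor_lift R M N (replicate n (carrier M)) \<phi> X"
      using p a by (simp add: tclass_smult \<psi> linear_mapD(3)[OF lin])
  qed
qed

text \<open>Pure tensors span, and \<open>Q\<close> is closed under the operations that it shares
  with \<open>N\<close>. Hence a linear map is corestricted to \<open>Q\<close> by looking at pure
  tensors alone.\<close>

lemma linear_map_into_submodule: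
  assumes "linear_map R (tensor_power R M n) N f" "module R Q"
    and "add Q = add N" "smult Q = smult N" "module R N"
    and "\<And>w. \<lbrakk>w \<in> lists (carrier M); length w = n\<rbrakk> \<Longrightarrow> f (tens R M w) \<in> carrier Q"
    and "zero Q = zero N"
  shows "linear_map R (tensor_power R M n) Q f"
proof -
  interpret Q: module R Q by fact
  interpret T: module R "tensor_power R M n" by (rule module_tensor_power)
  have "f X \<in> carrier Q" if "X \<in> carrier (tensor_power R M n)" for X
    using that
  proof (induction X rule: tensor_power_induct)
    case zero
    show ?case
      using linear_map_zero[OF module_tensor_power assms(5,1)] Q.M.zero_closed assms(7) by simp
  next
    case (add Y a w)
    have 1: "a \<odot>\<^bsub>tensor_algebra R M\<^esub> tens R M w \<in> carrier (tensor_power R M n)"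
      using T.smult_closed[OF add(2) tens_in_tensor_power[OF add(3,4)]] by simp
    have 2: "f (a \<odot>\<^bsub>tensor_algebra R M\<^esub> tens R M w) = a \<odot>\<^bsub>Q\<^esub> f (tens R M w)"
      using linear_mapD(3)[OF assms(1) add(2) tens_in_tensor_power[OF add(3,4)]] assms(4) by simp
    have 3: "f (tens R M w) \<in> carrier Q" by (rule assms(6)[OF add(3,4)])
    have "f (Y \<oplus>\<^bsub>tensor_algebra R M\<^esub> a \<odot>\<^bsub>tensor_algebra R M\<^esub> tens R M w)
      = f Y \<oplus>\<^bsub>Q\<^esub> f (a \<odot>\<^bsub>tensor_algebra R M\<^esub> tens R M w)"
      using linear_mapD(2)[OF assms(1) add(1) 1] assms(3) by simp
    then show ?case using 2 3 add by simp
  qed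
  then show ?thesis using assms by (simp add: linear_map_def Pi_iff)
qed

text \<open>Concatenation settles pure tensors; the product with one factor fixed is linear, so the
  two factors are generalised in turn.\<close>

lemma tensor_power_mult_closed:
  assumes X: "X \<in> carrier (tensor_power R M m)" and Y: "Y \<in> carrier (tensor_power R M n)"
  shows "X \<otimes>\<^bsub>tensor_algebra R M\<^esub> Y \<in> carrier (tensor_power R M (m + n))"
proof -
  interpret T: module R "tensor_algebra R M" by (rule module_tensor_algebra)
  have left: "linear_map R (tensor_power R M m) (tensor_algebra R M)
      (\<lambda>X. X \<otimes>\<^bsub>tensor_algebra R M\<^esub> Y)" if "Y \<in> carrier (tensor_algebra R M)" for Y
    by (rule linear_mapI)
      (use that in \<open>simp_all add: tensor_algebra_mult_linear tensor_algebra_mult_closed tensor_power_subset\<close>)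
  have right: "linear_map R (tensor_power R M n) (tensor_algebra R M)
      (\<lambda>Y. X \<otimes>\<^bsub>tensor_algebra R M\<^esub> Y)" if "X \<in> carrier (tensor_algebra R M)" for X
    by (rule linear_mapI)
      (use that in \<open>simp_all add: tensor_algebra_mult_linear tensor_algebra_mult_closed tensor_power_subset\<close>)
  have "linear_map R (tensor_power R M n) (tensor_power R M (m + n))
      (\<lambda>Y. tens R M u \<otimes>\<^bsub>tensor_algebra R M\<^esub> Y)"
    if u: "u \<in> lists (carrier M)" "length u = m" for u
  proof (rule linear_map_into_submodule[OF right module_tensor_power _ _ module_tensor_algebra])
    fix w assume w: "w \<in> lists (carrier M)" "length w = n"
    show "tens R M u \<otimes>\<^bsub>tensor_algebra R M\<^esub> tens R M w \<in> carrier (tensor_power R M (m + n))"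
      unfolding tens_append[OF u(1) w(1), symmetric]
      by (rule tens_in_tensor_power) (use u w in auto)
  qed (use u in \<open>auto intro: tens_closed\<close>)
  note w = linear_mapD(1)[OF this Y]
  have "linear_map R (tensor_power R M m) (tensor_power R M (m + n))
      (\<lambda>X. X \<otimes>\<^bsub>tensor_algebra R M\<^esub> Y)"
    by (rule linear_map_into_submodule[OF left module_tensor_power _ _ module_tensor_algebra])
      (use w Y in \<open>auto intro: tensor_power_subset\<close>)
  from linear_mapD(1)[OF this X] show ?thesis .
qed

end

section \<open>Maps between tensor powers\<close>

lemma multilinear_cong:
  assumes "\<And>w. \<lbrakk>w \<in> lists (carrier V); length w = n\<rbrakk> \<Longrightarrow> \<phi> w = \<psi> w" "module K V"
    and "multilinear K V N n \<phi>"
  shows "multilinear K V N n \<psi>"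
proof -
  interpret V: module K V by fact
  show ?thesis
    using assms(3) unfolding multilinear_def by (simp add: assms(1)[symmetric])
qed

text \<open>The power f\<otimes>...\<otimes>f with a variable number of factors. Degree two gives
  \<open>tensor_square_map\<close>, and degree three is where the braid equation lives.\<close>

definition tensor_map ::
  "('k, 'm) ring_scheme \<Rightarrow> ('k, 'v, 'x) module_scheme \<Rightarrow> ('k, 'w, 'y) module_scheme \<Rightarrow> nat \<Rightarrow>
   ('v \<Rightarrow> 'w) \<Rightarrow> ('v list \<Rightarrow> 'k) set \<Rightarrow> ('w list \<Rightarrow> 'k) set"
where
  "tensor_map K V W n f =
     tensor_lift K V (tensor_algebra K W) (replicate n (carrier V)) (\<lambda>w. tens K W (map f w))"

lemma map_linear_lists:
  "\<lbrakk>linear_map K V W f; w \<in> lists (carrier V)\<rbrakk> \<Longrightarrow> map f w \<in> lists (carrier W)"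
  by (auto simp: linear_map_def Pi_iff)

context
  fixes K :: "('k, 'm) ring_scheme" and V :: "('k, 'v, 'x) module_scheme"
    and W :: "('k, 'w, 'y) module_scheme" and f :: "'v \<Rightarrow> 'w"
  assumes V: "module K V" and W: "module K W" and f: "linear_map K V W f"
begin

lemma multilinear_tens_map: "multilinear K V (tensor_algebra K W) n (\<lambda>w. tens K W (map f w))"
  using module.tens_multilinear[OF W, of n] map_linear_lists[OF f] linear_mapD[OF f]
  unfolding multilinear_def by simp

lemma tensor_map_tens:
  "\<lbrakk>w \<in> lists (carrier V); length w = n\<rbrakk>
    \<Longrightarrow> tensor_map K V W n f (tens K V w) = tens K W (map f w)"
  unfolding tensor_map_def
  by (rule module.tensor_lift_tens[OF V module.module_tensor_algebra[OF W] multilinear_tens_map])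

lemma tensor_map_linear: "linear_map K (tensor_power K V n) (tensor_power K W n) (tensor_map K V W n f)"
proof (rule module.linear_map_into_submodule[OF V])
  show "linear_map K (tensor_power K V n) (tensor_algebra K W) (tensor_map K V W n f)"
    unfolding tensor_map_def
    by (rule module.tensor_lift_linear[OF V module.module_tensor_algebra[OF W] multilinear_tens_map])
  show "module K (tensor_power K W n)" "module K (tensor_algebra K W)"
    by (rule module.module_tensor_power[OF W] module.module_tensor_algebra[OF W])+
  fix w assume "w \<in> lists (carrier V)" "length w = n"
  then show "tensor_map K V W n f (tens K V w) \<in> carrier (tensor_power K W n)"
    using map_linear_lists[OF f]
    by (simp add: tensor_map_tens module.tens_in_tensor_power[OF W] del: in_lists_conv_set)
qed (simp_all add: module.tensor_power_sel[OF W])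

text \<open>On words of length two, \<open>map2\<close> over \<open>[f, f]\<close> is
  \<open>map f\<close>. On longer words it truncates, so the comparison is confined to the tensor
  square.\<close>

lemma tensor_square_map_eq_tensor_map:
  assumes "X \<in> carrier (tensor_power K V 2)"
  shows "tensor_square_map K V W f X = tensor_map K V W 2 f X"
proof -
  let ?\<psi> = "\<lambda>w. tens K W (map2 (\<lambda>f v. f v) [f, f] w)"
  have eq: "?\<psi> w = tens K W (map f w)" if len: "length w = 2" for w
  proof -
    obtain x y where "w = [x, y]"
      using len unfolding numeral_2_eq_2 length_Suc_conv length_0_conv by blast
    then show ?thesis by simp
  qed
  have ml: "multilinear K V (tensor_algebra K W) 2 ?\<psi>"
    by (rule multilinear_cong[OF _ V multilinear_tens_map]) (simp add: eq)
  have def': "tensor_square_map K V W f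
      = tensor_lift K V (tensor_algebra K W) (replicate 2 (carrier V)) ?\<psi>"
    by (simp add: tensor_square_map_def tensor_maps_def numeral_2_eq_2)
  note TW = module.module_tensor_algebra[OF W]
  show ?thesis
    unfolding def' tensor_map_def
    by (rule module.tensor_power_linear_eqI[OF V TW _ _ _ assms])
      (simp_all add: module.tensor_lift_linear[OF V TW] ml multilinear_tens_map eq
        module.tensor_lift_tens[OF V TW] del: in_lists_conv_set)
qed

lemma tensor_map_cong:
  assumes "linear_map K V W g" "\<And>x. x \<in> carrier V \<Longrightarrow> f x = g x" "X \<in> carrier (tensor_power K V n)"
  shows "tensor_map K V W n f X = tensor_map K V W n g X"
proof -
  have fg: "tens K W (map f w) = tens K W (map g w)" if "w \<in> lists (carrier V)" for w
    using that assms(2) by (intro arg_cong[where f = "tens K W"]) auto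
  then have m: "multilinear K V (tensor_algebra K W) n (\<lambda>w. tens K W (map g w))"
    by (intro multilinear_cong[OF _ V multilinear_tens_map]) simp
  note TW = module.module_tensor_algebra[OF W]
  show ?thesis
    unfolding tensor_map_def
    by (rule module.tensor_power_linear_eqI[OF V TW _ _ _ assms(3)])
      (simp_all add: module.tensor_lift_linear[OF V TW] m multilinear_tens_map
        module.tensor_lift_tens[OF V TW] fg del: in_lists_conv_set)
qed

text \<open>\<open>map f\<close> commutes with concatenation, and the product is bilinear, so each
  factor may be reduced to a pure tensor.\<close>

lemma tensor_map_mult:
  assumes X: "X \<in> carrier (tensor_power K V m)" and Y: "Y \<in> carrier (tensor_power K V n)"
  shows "tensor_map K V W (m + n) f (X \<otimes>\<^bsub>tensor_algebra K V\<^esub> Y) =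
    tensor_map K V W m f X \<otimes>\<^bsub>tensor_algebra K W\<^esub> tensor_map K V W n f Y"
proof -
  interpret V: module K V by (rule V)
  interpret W: module K W by (rule W)
  let ?TV = "tensor_algebra K V" and ?TW = "tensor_algebra K W"
  let ?P = "\<lambda>n. tensor_power K V n"
  note lin = linear_mapD[OF tensor_map_linear, unfolded V.tensor_power_sel W.tensor_power_sel]
  have subset: "X \<in> carrier ?TV" if "X \<in> carrier (?P n)" for X n
    using V.tensor_power_subset that .
  have mc: "tensor_map K V W n f X \<in> carrier ?TW" if "X \<in> carrier (?P n)" for X n
    using W.tensor_power_subset[OF lin(1)[OF that]] .
  have ww: "tensor_map K V W (m + n) f (tens K V u \<otimes>\<^bsub>?TV\<^esub> Y) =
      tensor_map K V W m f (tens K V u) \<otimes>\<^bsub>?TW\<^esub> tensor_map K V W n f Y"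
    if u: "u \<in> lists (carrier V)" "length u = m" for u
  proof (rule V.tensor_power_linear_eqI[OF W.module_tensor_algebra _ _ _ Y])
    note tu = V.tens_in_tensor_power[OF u]
    show "linear_map K (?P n) ?TW (\<lambda>Y. tensor_map K V W (m + n) f (tens K V u \<otimes>\<^bsub>?TV\<^esub> Y))"
      by (rule linear_mapI)
        (simp_all add: mc lin V.tensor_power_mult_closed tu V.tensor_algebra_mult_linear subset[OF tu] subset)
    show "linear_map K (?P n) ?TW (\<lambda>Y. tensor_map K V W m f (tens K V u) \<otimes>\<^bsub>?TW\<^esub> tensor_map K V W n f Y)"
      by (rule linear_mapI)
        (simp_all add: mc lin W.tensor_algebra_mult_closed W.tensor_algebra_mult_linear mc[OF tu])
    fix v assume v: "v \<in> lists (carrier V)" "length v = n"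
    show "tensor_map K V W (m + n) f (tens K V u \<otimes>\<^bsub>?TV\<^esub> tens K V v) =
      tensor_map K V W m f (tens K V u) \<otimes>\<^bsub>?TW\<^esub> tensor_map K V W n f (tens K V v)"
      using u v map_linear_lists[OF f u(1)] map_linear_lists[OF f v(1)]
      by (simp add: tensor_map_tens W.tens_append flip: V.tens_append del: in_lists_conv_set)
  qed
  show ?thesis
  proof (rule V.tensor_power_linear_eqI[OF W.module_tensor_algebra _ _ _ X])
    show "linear_map K (?P m) ?TW (\<lambda>X. tensor_map K V W (m + n) f (X \<otimes>\<^bsub>?TV\<^esub> Y))"
      by (rule linear_mapI)
        (simp_all add: mc lin V.tensor_power_mult_closed Y V.tensor_algebra_mult_linear subset[OF Y] subset)
    show "linear_map K (?P m) ?TW (\<lambda>X. tensor_map K V W m f X \<otimes>\<^bsub>?TW\<^esub> tensor_map K V W n f Y)"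
      by (rule linear_mapI)
        (simp_all add: mc lin W.tensor_algebra_mult_closed W.tensor_algebra_mult_linear mc[OF Y])
  qed (rule ww)
qed

end

text \<open>With \<open>y\<close> the unit, the sum is the value that the comultiplication must take
  on a primitive \<open>x\<close>. This lets the condition of primitivity be compared along
  \<open>f\<close>.\<close>

lemma tensor_map_swap_sum:
  assumes V: "module K V" and W: "module K W" and f: "linear_map K V W f"
    and "x \<in> carrier V" "y \<in> carrier V"
  shows "tensor_map K V W 2 f (tens K V [x, y] \<oplus>\<^bsub>tensor_algebra K V\<^esub> tens K V [y, x]) =
    tens K W [f x, f y] \<oplus>\<^bsub>tensor_algebra K W\<^esub> tens K W [f y, f x]"
proof -
  interpret V: module K V by fact
  interpret W: module K W by fact
  have c: "tens K V [x, y] \<in> carrier (tensor_power K V 2)" "tens K V [y, x] \<in> carrier (tensor_power K V 2)"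
    using assms by (intro V.tens_in_tensor_power; simp)+
  show ?thesis
    using linear_mapD(2)[OF tensor_map_linear[OF V W f] c] assms
    by (simp add: tensor_map_tens[OF V W f])
qed

lemma tens_swap_sum_closed:
  assumes V: "module K V" and "x \<in> carrier V" "y \<in> carrier V"
  shows "tens K V [x, y] \<oplus>\<^bsub>tensor_algebra K V\<^esub> tens K V [y, x] \<in> carrier (tensor_power K V 2)"
proof -
  interpret V: module K V by fact
  interpret V2: module K "tensor_power K V 2" by (rule V.module_tensor_power)
  have "tens K V [x, y] \<in> carrier (tensor_power K V 2)" "tens K V [y, x] \<in> carrier (tensor_power K V 2)"
    using assms by (intro V.tens_in_tensor_power; simp)+
  then show ?thesis using V2.M.a_closed by simp
qed

lemma tensor_map_compose:
  assumes U: "module K U" and V: "module K V" and W: "module K W"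
    and f: "linear_map K U V f" and g: "linear_map K V W g"
    and X: "X \<in> carrier (tensor_power K U n)"
  shows "tensor_map K V W n g (tensor_map K U V n f X) = tensor_map K U W n (\<lambda>x. g (f x)) X"
proof (rule module.tensor_power_linear_eqI[OF U module.module_tensor_power[OF W, of n] _ _ _ X])
  note gf = linear_map_compose[OF f g]
  show "linear_map K (tensor_power K U n) (tensor_power K W n)
      (\<lambda>X. tensor_map K V W n g (tensor_map K U V n f X))"
    by (rule linear_map_compose[OF tensor_map_linear[OF U V f] tensor_map_linear[OF V W g]])
  show "linear_map K (tensor_power K U n) (tensor_power K W n) (tensor_map K U W n (\<lambda>x. g (f x)))"
    by (rule tensor_map_linear[OF U W gf])
  fix w assume w: "w \<in> lists (carrier U)" "length w = n"
  then show "tensor_map K V W n g (tensor_map K U V n f (tens K U w)) =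
      tensor_map K U W n (\<lambda>x. g (f x)) (tens K U w)"
    using map_linear_lists[OF f w(1)]
    by (simp add: tensor_map_tens[OF U V f] tensor_map_tens[OF V W g] tensor_map_tens[OF U W gf] comp_def
        del: in_lists_conv_set)
qed

lemma tensor_map_id:
  assumes V: "module K V" and f: "\<And>x. x \<in> carrier V \<Longrightarrow> f x = x"
    and X: "X \<in> carrier (tensor_power K V n)"
  shows "tensor_map K V V n f X = X"
proof (rule module.tensor_power_linear_eqI[OF V module.module_tensor_power[OF V, of n] _ _ _ X])
  interpret V: module K V by (rule V)
  have lin: "linear_map K V V f" using f by (auto simp: linear_map_def)
  then show "linear_map K (tensor_power K V n) (tensor_power K V n) (tensor_map K V V n f)"
    by (rule tensor_map_linear[OF V V])
  show "linear_map K (tensor_power K V n) (tensor_power K V n) (\<lambda>X. X)"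
    by (simp add: linear_map_def)
  fix w assume w: "w \<in> lists (carrier V)" "length w = n"
  moreover have "map f w = w" using w(1) f by (induction w) auto
  ultimately show "tensor_map K V V n f (tens K V w) = tens K V w"
    by (simp add: tensor_map_tens[OF V V lin] del: in_lists_conv_set)
qed

section \<open>Tensor products of maps between tensor powers\<close>

context module
begin

text \<open>The varied letter lies on one side of the cut after \<open>p\<close> letters: one factor
  is linear in it, and the other does not see it.\<close>

lemma tensor_hom_multilinear:
  assumes f: "linear_map R (tensor_power R M p) (tensor_power R M q) f"
    and g: "linear_map R (tensor_power R M r) (tensor_power R M s) g"
  shows "multilinear R M (tensor_algebra R M) (p + r)
    (\<lambda>w. f (tens R M (take p w)) \<otimes>\<^bsub>tensor_algebra R M\<^esub> g (tens R M (drop p w)))"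
    (is "multilinear R M ?T _ ?h")
proof -
  note f' = linear_mapD[OF f, unfolded tensor_power_sel]
  note g' = linear_mapD[OF g, unfolded tensor_power_sel]
  have fc: "f (tens R M w) \<in> carrier ?T" if "w \<in> lists (carrier M)" "length w = p" for w
    using tensor_power_subset[OF f'(1)[OF tens_in_tensor_power[OF that]]] .
  have gc: "g (tens R M w) \<in> carrier ?T" if "w \<in> lists (carrier M)" "length w = r" for w
    using tensor_power_subset[OF g'(1)[OF tens_in_tensor_power[OF that]]] .
  have tk: "take k w \<in> lists (carrier M)" and dk: "drop k w \<in> lists (carrier M)"
    if "w \<in> lists (carrier M)" for k w
    using that by (auto dest: in_set_takeD in_set_dropD)
  note tml = tens_multilinear[unfolded multilinear_def]
  have ft: "f (tens R M (u @ (x \<oplus>\<^bsub>M\<^esub> y) # v)) = f (tens R M (u @ x # v)) \<oplus>\<^bsub>?T\<^esub> f (tens R M (u @ y # v))"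
      "f (tens R M (u @ (a \<odot>\<^bsub>M\<^esub> x) # v)) = a \<odot>\<^bsub>?T\<^esub> f (tens R M (u @ x # v))"
    if "u \<in> lists (carrier M)" "v \<in> lists (carrier M)" "Suc (length u + length v) = p"
      "x \<in> carrier M" "y \<in> carrier M" "a \<in> carrier R" for u v x y a
    using that tml[of p] f'(2)[of "tens R M (u @ x # v)" "tens R M (u @ y # v)"]
      f'(3)[of a "tens R M (u @ x # v)"] by (simp_all add: tens_in_tensor_power)
  have gt: "g (tens R M (u @ (x \<oplus>\<^bsub>M\<^esub> y) # v)) = g (tens R M (u @ x # v)) \<oplus>\<^bsub>?T\<^esub> g (tens R M (u @ y # v))"
      "g (tens R M (u @ (a \<odot>\<^bsub>M\<^esub> x) # v)) = a \<odot>\<^bsub>?T\<^esub> g (tens R M (u @ x # v))"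
    if "u \<in> lists (carrier M)" "v \<in> lists (carrier M)" "Suc (length u + length v) = r"
      "x \<in> carrier M" "y \<in> carrier M" "a \<in> carrier R" for u v x y a
    using that tml[of r] g'(2)[of "tens R M (u @ x # v)" "tens R M (u @ y # v)"]
      g'(3)[of a "tens R M (u @ x # v)"] by (simp_all add: tens_in_tensor_power)
  have main: "?h (u @ (x \<oplus>\<^bsub>M\<^esub> y) # v) = ?h (u @ x # v) \<oplus>\<^bsub>?T\<^esub> ?h (u @ y # v) \<and>
      ?h (u @ (a \<odot>\<^bsub>M\<^esub> x) # v) = a \<odot>\<^bsub>?T\<^esub> ?h (u @ x # v)"
    if uv: "u \<in> lists (carrier M)" "v \<in> lists (carrier M)" "Suc (length u + length v) = p + r"
      and xy: "x \<in> carrier M" "y \<in> carrier M" "a \<in> carrier R" for u v x y a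
  proof (cases "length u < p")
    case True
    \<comment> \<open>The number of letters of \<open>v\<close> lying before the cut; the one
      subtracted is the varied letter itself.\<close>
    define k where "k = p - length u - 1"
    have split: "take p (u @ z # v) = u @ z # take k v" "drop p (u @ z # v) = drop k v" for z
      using True by (simp_all add: k_def take_Cons' drop_Cons')
    have len: "Suc (length u + length (take k v)) = p" "length (drop k v) = r"
      using True uv(3) by (simp_all add: k_def)
    have c: "f (tens R M (u @ z # take k v)) \<in> carrier ?T" if "z \<in> carrier M" for z
      by (rule fc) (use that uv tk[OF uv(2), of k] len in simp_all)
    show ?thesis
      unfolding split ft[OF uv(1) tk[OF uv(2)] len(1) xy]
      using c xy gc[OF dk[OF uv(2)] len(2)] by (simp add: tensor_algebra_mult_linear)
  next
    case False
    have split: "take p (u @ z # v) = take p u" "drop p (u @ z # v) = drop p u @ z # v" for z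
      using False by simp_all
    have len: "Suc (length (drop p u) + length v) = r" "length (take p u) = p"
      using False uv(3) by simp_all
    have c: "g (tens R M (drop p u @ z # v)) \<in> carrier ?T" if "z \<in> carrier M" for z
      by (rule gc) (use that uv dk[OF uv(1), of p] len in simp_all)
    show ?thesis
      unfolding split gt[OF dk[OF uv(1)] uv(2) len(1) xy]
      using c xy fc[OF tk[OF uv(1)] len(2)] by (simp add: tensor_algebra_mult_linear)
  qed
  have "?h w \<in> carrier ?T" if "w \<in> lists (carrier M)" "length w = p + r" for w
    using fc[OF tk[OF that(1)]] gc[OF dk[OF that(1)]] that(2) by (simp add: tensor_algebra_mult_closed)
  then show ?thesis
    using main unfolding multilinear_def by blast
qed

lemma tensor_hom_linear:
  assumes f: "linear_map R (tensor_power R M p) (tensor_power R M q) f"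
    and g: "linear_map R (tensor_power R M r) (tensor_power R M s) g"
  shows "linear_map R (tensor_power R M (p + r)) (tensor_algebra R M) (tensor_hom R M p r f g)"
  unfolding tensor_hom_def
  by (rule tensor_lift_linear[OF module_tensor_algebra tensor_hom_multilinear[OF f g]])

lemma tensor_hom_tens_append:
  assumes f: "linear_map R (tensor_power R M p) (tensor_power R M q) f"
    and g: "linear_map R (tensor_power R M r) (tensor_power R M s) g"
    and u: "u \<in> lists (carrier M)" "length u = p" and v: "v \<in> lists (carrier M)" "length v = r"
  shows "tensor_hom R M p r f g (tens R M (u @ v)) =
    f (tens R M u) \<otimes>\<^bsub>tensor_algebra R M\<^esub> g (tens R M v)"
  unfolding tensor_hom_def
  by (subst tensor_lift_tens[OF module_tensor_algebra tensor_hom_multilinear[OF f g]]) (use u v in auto)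

lemma tensor_hom_closed:
  assumes f: "linear_map R (tensor_power R M p) (tensor_power R M q) f"
    and g: "linear_map R (tensor_power R M r) (tensor_power R M s) g"
    and X: "X \<in> carrier (tensor_power R M (p + r))"
  shows "tensor_hom R M p r f g X \<in> carrier (tensor_power R M (q + s))"
proof -
  have "linear_map R (tensor_power R M (p + r)) (tensor_power R M (q + s)) (tensor_hom R M p r f g)"
  proof (rule linear_map_into_submodule[OF tensor_hom_linear[OF f g] module_tensor_power _ _
        module_tensor_algebra])
    fix w assume w: "w \<in> lists (carrier M)" "length w = p + r"
    have uv: "take p w \<in> lists (carrier M)" "length (take p w) = p"
        "drop p w \<in> lists (carrier M)" "length (drop p w) = r"
      using w by (auto dest: in_set_takeD in_set_dropD)
    then have "tensor_hom R M p r f g (tens R M (take p w @ drop p w)) \<in> carrier (tensor_power R M (q + s))"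
      using linear_mapD(1)[OF f] linear_mapD(1)[OF g]
      by (simp only: tensor_hom_tens_append[OF f g] tensor_power_mult_closed tens_in_tensor_power)
    then show "tensor_hom R M p r f g (tens R M w) \<in> carrier (tensor_power R M (q + s))" by simp
  qed simp_all
  from linear_mapD(1)[OF this X] show ?thesis .
qed

end

text \<open>On a pure tensor cut after \<open>p\<close> letters both sides are products, and
  \<open>ff'\<close> and \<open>gg'\<close> treat the two factors separately. With a braiding as one
  map and the identity as the other, this carries a factor of the braid equation along the third
  tensor power of \<open>i\<close>.\<close>

lemma tensor_map_tensor_hom:
  assumes V: "module K V" and W: "module K W" and i: "linear_map K V W i"
    and f: "linear_map K (tensor_power K V p) (tensor_power K V q) f"
    and g: "linear_map K (tensor_power K V r) (tensor_power K V s) g"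
    and f': "linear_map K (tensor_power K W p) (tensor_power K W q) f'"
    and g': "linear_map K (tensor_power K W r) (tensor_power K W s) g'"
    and ff': "\<And>X. X \<in> carrier (tensor_power K V p) \<Longrightarrow>
      f' (tensor_map K V W p i X) = tensor_map K V W q i (f X)"
    and gg': "\<And>X. X \<in> carrier (tensor_power K V r) \<Longrightarrow>
      g' (tensor_map K V W r i X) = tensor_map K V W s i (g X)"
    and X: "X \<in> carrier (tensor_power K V (p + r))"
  shows "tensor_hom K W p r f' g' (tensor_map K V W (p + r) i X) =
    tensor_map K V W (q + s) i (tensor_hom K V p r f g X)"
proof -
  interpret V: module K V by (rule V)
  interpret W: module K W by (rule W)
  have hom: "linear_map K (tensor_power K V (p + r)) (tensor_power K V (q + s)) (tensor_hom K V p r f g)"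
    using V.tensor_hom_linear[OF f g] V.tensor_hom_closed[OF f g]
    by (simp add: linear_map_def)
  have hom': "linear_map K (tensor_power K W (p + r)) (tensor_power K W (q + s)) (tensor_hom K W p r f' g')"
    using W.tensor_hom_linear[OF f' g'] W.tensor_hom_closed[OF f' g']
    by (simp add: linear_map_def)
  show ?thesis
  proof (rule V.tensor_power_linear_eqI[OF W.module_tensor_power[of "q + s"] _ _ _ X])
    show "linear_map K (tensor_power K V (p + r)) (tensor_power K W (q + s))
        (\<lambda>X. tensor_hom K W p r f' g' (tensor_map K V W (p + r) i X))"
      by (rule linear_map_compose[OF tensor_map_linear[OF V W i] hom'])
    show "linear_map K (tensor_power K V (p + r)) (tensor_power K W (q + s))
        (\<lambda>X. tensor_map K V W (q + s) i (tensor_hom K V p r f g X))"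
      by (rule linear_map_compose[OF hom tensor_map_linear[OF V W i]])
    fix w assume w: "w \<in> lists (carrier V)" "length w = p + r"
    define u v where "u = take p w" and "v = drop p w"
    have u: "u \<in> lists (carrier V)" "length u = p" and v: "v \<in> lists (carrier V)" "length v = r"
      using w by (auto simp: u_def v_def dest: in_set_takeD in_set_dropD)
    have uv: "w = u @ v" by (simp add: u_def v_def)
    note mu = map_linear_lists[OF i u(1)] and mv = map_linear_lists[OF i v(1)]
    have "tensor_hom K W p r f' g' (tensor_map K V W (p + r) i (tens K V w))
      = f' (tens K W (map i u)) \<otimes>\<^bsub>tensor_algebra K W\<^esub> g' (tens K W (map i v))"
      using w(1) u v mu mv unfolding uv
      by (simp add: tensor_map_tens[OF V W i] W.tensor_hom_tens_append[OF f' g'] del: in_lists_conv_set)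
    also have "\<dots> = tensor_map K V W q i (f (tens K V u)) \<otimes>\<^bsub>tensor_algebra K W\<^esub>
        tensor_map K V W s i (g (tens K V v))"
      using ff'[OF V.tens_in_tensor_power[OF u]] gg'[OF V.tens_in_tensor_power[OF v]] u v
      by (simp add: tensor_map_tens[OF V W i] del: in_lists_conv_set)
    also have "\<dots> = tensor_map K V W (q + s) i (tensor_hom K V p r f g (tens K V w))"
      unfolding uv V.tensor_hom_tens_append[OF f g u v]
      by (rule tensor_map_mult[OF V W i linear_mapD(1)[OF f] linear_mapD(1)[OF g], symmetric])
        (rule V.tens_in_tensor_power[OF u] V.tens_in_tensor_power[OF v])+
    finally show "tensor_hom K W p r f' g' (tensor_map K V W (p + r) i (tens K V w)) =
        tensor_map K V W (q + s) i (tensor_hom K V p r f g (tens K V w))" .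
  qed
qed

section \<open>Direct limits\<close>

text \<open>Only linear structure is recorded, so that the tensor squares of the stages form a
  second instance whose limit can be compared with the tensor square of the first.\<close>

locale direct_system =
  fixes K :: "('k, 'm) ring_scheme" and A :: "nat \<Rightarrow> ('k, 'u, 'x) module_scheme"
    and \<pi> :: "nat \<Rightarrow> 'u \<Rightarrow> 'u"
  assumes stage_module: "module K (A n)"
    and step_linear: "linear_map K (A n) (A (Suc n)) (\<pi> n)"
begin

sublocale K: cring K
  using stage_module by (rule module.axioms)

abbreviation "L \<equiv> limit_algebra A \<pi>"
abbreviation "\<psi> \<equiv> limit_class A \<pi>"
abbreviation "t \<equiv> transition \<pi>"

lemma transition_self [simp]: "t n n = id"
  by (cases n) auto

lemma transition_linear: "n \<le> k \<Longrightarrow> linear_map K (A n) (A k) (t n k)"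
proof (induction k)
  case (Suc k)
  show ?case
  proof (cases "n \<le> k")
    case True
    then show ?thesis
      using linear_map_compose[OF Suc.IH[OF True] step_linear] by (simp add: comp_def)
  next
    case False
    then have "n = Suc k" using Suc.prems by simp
    then show ?thesis by (simp add: linear_map_def)
  qed
qed (simp add: linear_map_def)

lemmas transition_closed = linear_mapD(1)[OF transition_linear]

lemma transition_trans:
  assumes "n \<le> k" "k \<le> l"
  shows "t k l (t n k x) = t n l x"
  using assms(2)
proof (induction l rule: dec_induct)
  case (step l)
  then show ?case using assms(1) by simp
qed simp

lemma limit_class_transition:
  assumes "n \<le> k" "x \<in> carrier (A n)"
  shows "\<psi> k (t n k x) = \<psi> n x"
proof -
  have "(\<exists>l\<ge>k. m \<le> l \<and> t k l (t n k x) = t m l y) \<longleftrightarrow> (\<exists>l\<ge>n. m \<le> l \<and> t n l x = t m l y)"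
    for m y
  proof
    assume "\<exists>l\<ge>k. m \<le> l \<and> t k l (t n k x) = t m l y"
    then obtain l where l: "k \<le> l" "m \<le> l" "t k l (t n k x) = t m l y" by blast
    then have "n \<le> l" "t n l x = t m l y"
      using assms(1) transition_trans[OF assms(1) l(1), of x] by simp_all
    then show "\<exists>l\<ge>n. m \<le> l \<and> t n l x = t m l y" using l(2) by blast
  next
    assume "\<exists>l\<ge>n. m \<le> l \<and> t n l x = t m l y"
    then obtain l where l: "n \<le> l" "m \<le> l" "t n l x = t m l y" by blast
    \<comment> \<open>An equality reached at stage \<open>l\<close> persists at every later stage,
      in particular at one beyond \<open>k\<close>.\<close>
    let ?l = "max l k"
    have "t k ?l (t n k x) = t l ?l (t n l x)"
      using l(1) assms(1) by (simp add: transition_trans)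
    also have "\<dots> = t m ?l y"
      using l by (simp add: transition_trans)
    finally show "\<exists>l\<ge>k. m \<le> l \<and> t k l (t n k x) = t m l y"
      using l(2) by (intro exI[of _ ?l]) auto
  qed
  then show ?thesis by (simp add: limit_class_def)
qed

lemma limit_class_eq_iff:
  assumes x: "x \<in> carrier (A n)" and y: "y \<in> carrier (A m)"
  shows "\<psi> n x = \<psi> m y \<longleftrightarrow> (\<exists>k\<ge>n. m \<le> k \<and> t n k x = t m k y)"
proof
  assume "\<psi> n x = \<psi> m y"
  moreover have "(m, y) \<in> \<psi> m y" using y by (auto simp: limit_class_def)
  ultimately have "(m, y) \<in> \<psi> n x" by simp
  then show "\<exists>k\<ge>n. m \<le> k \<and> t n k x = t m k y" by (simp add: limit_class_def)
next
  assume "\<exists>k\<ge>n. m \<le> k \<and> t n k x = t m k y"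
  then obtain k where "n \<le> k" "m \<le> k" "t n k x = t m k y" by blast
  then show "\<psi> n x = \<psi> m y"
    using limit_class_transition x y by metis
qed

lemma carrier_limit: "carrier L = (\<Union>n. \<psi> n ` carrier (A n))"
  by (simp add: limit_algebra_def)

lemma limit_class_closed: "x \<in> carrier (A n) \<Longrightarrow> \<psi> n x \<in> carrier L"
  by (auto simp: carrier_limit)

text \<open>The bound \<open>N\<close> allows a representative to be chosen at a stage beyond those
  of elements already fixed.\<close>

lemma limit_cases:
  assumes "X \<in> carrier L"
  obtains n x where "x \<in> carrier (A n)" "X = \<psi> n x" "N \<le> n"
proof -
  from assms obtain m y where my: "y \<in> carrier (A m)" "X = \<psi> m y" by (auto simp: carrier_limit)
  have "t m (max m N) y \<in> carrier (A (max m N))" using my by (intro transition_closed) auto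
  moreover have "X = \<psi> (max m N) (t m (max m N) y)"
    using limit_class_transition[of m "max m N" y] my by simp
  ultimately show ?thesis using that[of "t m (max m N) y" "max m N"] by auto
qed

lemma limit_cases2:
  assumes "X \<in> carrier L" "Y \<in> carrier L"
  obtains n x y where "x \<in> carrier (A n)" "y \<in> carrier (A n)" "X = \<psi> n x" "Y = \<psi> n y"
proof -
  obtain m z where z: "z \<in> carrier (A m)" "X = \<psi> m z"
    using limit_cases[OF assms(1), of 0] by blast
  obtain n y where y: "y \<in> carrier (A n)" "Y = \<psi> n y" "m \<le> n"
    using limit_cases[OF assms(2), of m] by blast
  have "t m n z \<in> carrier (A n)" using z y by (intro transition_closed)
  moreover have "X = \<psi> n (t m n z)" using limit_class_transition[OF y(3) z(1)] z(2) by simp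
  ultimately show ?thesis using that y by blast
qed

text \<open>The operations of the limit are descriptions ranging over all representatives. Two
  representatives of one class meet at a later stage, so a value that is constant along transitions
  is unique.\<close>

lemma limit_the:
  assumes compat: "\<And>n k x. \<lbrakk>n \<le> k; x \<in> carrier (A n)\<rbrakk> \<Longrightarrow> g k (t n k x) = g n x"
    and x: "x \<in> carrier (A n)"
  shows "(THE Z. \<exists>m. \<exists>y\<in>carrier (A m). \<psi> n x = \<psi> m y \<and> Z = g m y) = g n x"
proof (rule the_equality)
  show "\<exists>m. \<exists>y\<in>carrier (A m). \<psi> n x = \<psi> m y \<and> g n x = g m y" using x by blast
  fix Z assume "\<exists>m. \<exists>y\<in>carrier (A m). \<psi> n x = \<psi> m y \<and> Z = g m y"
  then obtain m y where y: "y \<in> carrier (A m)" "\<psi> n x = \<psi> m y" "Z = g m y" by blast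
  then obtain k where "n \<le> k" "m \<le> k" "t n k x = t m k y"
    using limit_class_eq_iff x by blast
  then show "Z = g n x" using compat x y by metis
qed

lemma limit_the2:
  assumes compat: "\<And>n k x y. \<lbrakk>n \<le> k; x \<in> carrier (A n); y \<in> carrier (A n)\<rbrakk>
      \<Longrightarrow> g k (t n k x) (t n k y) = g n x y"
    and x: "x \<in> carrier (A n)" and y: "y \<in> carrier (A n)"
  shows "(THE Z. \<exists>m. \<exists>x'\<in>carrier (A m). \<exists>y'\<in>carrier (A m).
    \<psi> n x = \<psi> m x' \<and> \<psi> n y = \<psi> m y' \<and> Z = g m x' y') = g n x y"
proof (rule the_equality)
  show "\<exists>m. \<exists>x'\<in>carrier (A m). \<exists>y'\<in>carrier (A m).
    \<psi> n x = \<psi> m x' \<and> \<psi> n y = \<psi> m y' \<and> g n x y = g m x' y'" using x y by blast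
  fix Z assume "\<exists>m. \<exists>x'\<in>carrier (A m). \<exists>y'\<in>carrier (A m).
    \<psi> n x = \<psi> m x' \<and> \<psi> n y = \<psi> m y' \<and> Z = g m x' y'"
  then obtain m x' y' where *: "x' \<in> carrier (A m)" "y' \<in> carrier (A m)"
    "\<psi> n x = \<psi> m x'" "\<psi> n y = \<psi> m y'" "Z = g m x' y'" by blast
  obtain k where k: "n \<le> k" "m \<le> k" "t n k x = t m k x'"
    using * limit_class_eq_iff x by blast
  obtain l where l: "n \<le> l" "m \<le> l" "t n l y = t m l y'"
    using * limit_class_eq_iff y by blast
  \<comment> \<open>The two arguments may become equal at different stages; \<open>compat\<close>
    needs one stage that serves both.\<close>
  let ?j = "max k l"
  have "t n ?j x = t m ?j x'" using k by (metis max.cobounded1 transition_trans)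
  moreover have "t n ?j y = t m ?j y'" using l by (metis max.cobounded2 transition_trans)
  moreover have "n \<le> ?j" "m \<le> ?j" using k by auto
  ultimately show "Z = g n x y" using compat * x y by metis
qed

lemma limit_add:
  assumes "x \<in> carrier (A n)" "y \<in> carrier (A n)"
  shows "\<psi> n x \<oplus>\<^bsub>L\<^esub> \<psi> n y = \<psi> n (x \<oplus>\<^bsub>A n\<^esub> y)"
proof -
  have "\<psi> k (t n k x \<oplus>\<^bsub>A k\<^esub> t n k y) = \<psi> n (x \<oplus>\<^bsub>A n\<^esub> y)"
    if "n \<le> k" "x \<in> carrier (A n)" "y \<in> carrier (A n)" for n k x y
  proof -
    interpret An: module K "A n" by (rule stage_module)
    show ?thesis
      using linear_mapD(2)[OF transition_linear[OF that(1)] that(2,3)]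
        limit_class_transition[OF that(1), of "x \<oplus>\<^bsub>A n\<^esub> y"] that by simp
  qed
  from limit_the2[of "\<lambda>n x y. \<psi> n (x \<oplus>\<^bsub>A n\<^esub> y)", OF this assms]
  show ?thesis by (simp add: limit_algebra_def)
qed

lemma limit_smult:
  assumes "a \<in> carrier K" "x \<in> carrier (A n)"
  shows "a \<odot>\<^bsub>L\<^esub> \<psi> n x = \<psi> n (a \<odot>\<^bsub>A n\<^esub> x)"
proof -
  have "\<psi> k (a \<odot>\<^bsub>A k\<^esub> t n k x) = \<psi> n (a \<odot>\<^bsub>A n\<^esub> x)"
    if "n \<le> k" "x \<in> carrier (A n)" for n k x
  proof -
    interpret An: module K "A n" by (rule stage_module)
    show ?thesis
      using linear_mapD(3)[OF transition_linear[OF that(1)] assms(1) that(2)]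
        limit_class_transition[OF that(1), of "a \<odot>\<^bsub>A n\<^esub> x"] that assms(1) by simp
  qed
  from limit_the[of "\<lambda>n x. \<psi> n (a \<odot>\<^bsub>A n\<^esub> x)", OF this assms(2)]
  show ?thesis by (simp add: limit_algebra_def)
qed

lemma limit_zero: "\<psi> n \<zero>\<^bsub>A n\<^esub> = \<zero>\<^bsub>L\<^esub>"
proof -
  interpret A0: module K "A 0" by (rule stage_module)
  have "t 0 n \<zero>\<^bsub>A 0\<^esub> = \<zero>\<^bsub>A n\<^esub>"
    by (rule linear_map_zero[OF stage_module stage_module transition_linear]) simp
  then have "\<psi> n \<zero>\<^bsub>A n\<^esub> = \<psi> 0 \<zero>\<^bsub>A 0\<^esub>"
    using limit_class_transition[of 0 n "\<zero>\<^bsub>A 0\<^esub>"] by simp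
  then show ?thesis by (simp add: limit_algebra_def)
qed

lemma module_limit: "module K L"
proof (rule moduleI)
  show "cring K" ..
  show "abelian_group L"
  proof (rule abelian_groupI)
    fix X Y Z assume X: "X \<in> carrier L" and Y: "Y \<in> carrier L" and Z: "Z \<in> carrier L"
    obtain n x y where xy: "x \<in> carrier (A n)" "y \<in> carrier (A n)" "X = \<psi> n x" "Y = \<psi> n y"
      using limit_cases2[OF X Y] by blast
    obtain m z where z: "z \<in> carrier (A m)" "Z = \<psi> m z" "n \<le> m"
      using limit_cases[OF Z, of n] by blast
    interpret Am: module K "A m" by (rule stage_module)
    have *: "t n m x \<in> carrier (A m)" "t n m y \<in> carrier (A m)"
      "X = \<psi> m (t n m x)" "Y = \<psi> m (t n m y)"
      using xy z(3) by (simp_all add: transition_closed limit_class_transition)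
    then show "X \<oplus>\<^bsub>L\<^esub> Y \<oplus>\<^bsub>L\<^esub> Z = X \<oplus>\<^bsub>L\<^esub> (Y \<oplus>\<^bsub>L\<^esub> Z)"
      using z by (simp add: limit_add Am.M.a_assoc)
  next
    fix X Y assume X: "X \<in> carrier L" and Y: "Y \<in> carrier L"
    obtain n x y where xy: "x \<in> carrier (A n)" "y \<in> carrier (A n)" "X = \<psi> n x" "Y = \<psi> n y"
      using limit_cases2[OF X Y] by blast
    interpret An: module K "A n" by (rule stage_module)
    show "X \<oplus>\<^bsub>L\<^esub> Y \<in> carrier L" using xy by (simp add: limit_add limit_class_closed)
    show "X \<oplus>\<^bsub>L\<^esub> Y = Y \<oplus>\<^bsub>L\<^esub> X" using xy by (simp add: limit_add An.M.a_comm)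
  next
    interpret A0: module K "A 0" by (rule stage_module)
    show "\<zero>\<^bsub>L\<^esub> \<in> carrier L" using limit_class_closed[of "\<zero>\<^bsub>A 0\<^esub>" 0] limit_zero by simp
  next
    fix X assume "X \<in> carrier L"
    then obtain n x where x: "x \<in> carrier (A n)" "X = \<psi> n x" using limit_cases[of X 0] by blast
    interpret An: module K "A n" by (rule stage_module)
    show "\<zero>\<^bsub>L\<^esub> \<oplus>\<^bsub>L\<^esub> X = X" using x by (simp add: limit_add flip: limit_zero[of n])
    have "\<psi> n (\<ominus>\<^bsub>A n\<^esub> x) \<oplus>\<^bsub>L\<^esub> X = \<zero>\<^bsub>L\<^esub>"
      using x by (simp add: limit_add An.M.l_neg flip: limit_zero[of n])
    then show "\<exists>Y\<in>carrier L. Y \<oplus>\<^bsub>L\<^esub> X = \<zero>\<^bsub>L\<^esub>"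
      using limit_class_closed[of "\<ominus>\<^bsub>A n\<^esub> x" n] x by blast
  qed
next
  fix X assume "X \<in> carrier L"
  then obtain n x where x: "x \<in> carrier (A n)" "X = \<psi> n x" using limit_cases[of X 0] by blast
  interpret An: module K "A n" by (rule stage_module)
  show "\<one>\<^bsub>K\<^esub> \<odot>\<^bsub>L\<^esub> X = X" using x by (simp add: limit_smult)
next
  fix a X assume a: "a \<in> carrier K" and "X \<in> carrier L"
  then obtain n x where x: "x \<in> carrier (A n)" "X = \<psi> n x" using limit_cases[of X 0] by blast
  interpret An: module K "A n" by (rule stage_module)
  show "a \<odot>\<^bsub>L\<^esub> X \<in> carrier L" using a x by (simp add: limit_smult limit_class_closed)
  {
    fix b assume b: "b \<in> carrier K"
    show "(a \<oplus>\<^bsub>K\<^esub> b) \<odot>\<^bsub>L\<^esub> X = a \<odot>\<^bsub>L\<^esub> X \<oplus>\<^bsub>L\<^esub> b \<odot>\<^bsub>L\<^esub> X"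
      using a b x by (simp add: limit_smult limit_add An.smult_l_distr)
    show "(a \<otimes>\<^bsub>K\<^esub> b) \<odot>\<^bsub>L\<^esub> X = a \<odot>\<^bsub>L\<^esub> (b \<odot>\<^bsub>L\<^esub> X)"
      using a b x by (simp add: limit_smult An.smult_assoc1)
  }
next
  fix a X Y assume a: "a \<in> carrier K" and XY: "X \<in> carrier L" "Y \<in> carrier L"
  obtain n x y where xy: "x \<in> carrier (A n)" "y \<in> carrier (A n)" "X = \<psi> n x" "Y = \<psi> n y"
    using limit_cases2[OF XY] by blast
  interpret An: module K "A n" by (rule stage_module)
  show "a \<odot>\<^bsub>L\<^esub> (X \<oplus>\<^bsub>L\<^esub> Y) = a \<odot>\<^bsub>L\<^esub> X \<oplus>\<^bsub>L\<^esub> a \<odot>\<^bsub>L\<^esub> Y"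
    using a xy by (simp add: limit_smult limit_add An.smult_r_distr)
qed

lemma limit_class_linear: "linear_map K (A n) L (\<psi> n)"
  by (rule linear_mapI) (simp_all add: limit_class_closed limit_add limit_smult)

lemma limit_class_eq_zero:
  assumes "x \<in> carrier (A n)" "\<psi> n x = \<zero>\<^bsub>L\<^esub>"
  obtains k where "n \<le> k" "t n k x = \<zero>\<^bsub>A k\<^esub>"
proof -
  interpret An: module K "A n" by (rule stage_module)
  have "\<psi> n x = \<psi> n \<zero>\<^bsub>A n\<^esub>" using assms(2) limit_zero by simp
  then obtain k where k: "n \<le> k" "t n k x = t n k \<zero>\<^bsub>A n\<^esub>"
    using limit_class_eq_iff[OF assms(1) An.M.zero_closed] by blast
  then show ?thesis
    using that linear_map_zero[OF stage_module stage_module transition_linear[OF k(1)]] by simp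
qed

subsection \<open>Tensor squares of direct limits\<close>

abbreviation "A2 \<equiv> \<lambda>n. tensor_power K (A n) 2"
abbreviation "\<pi>2 \<equiv> \<lambda>n. tensor_map K (A n) (A (Suc n)) 2 (\<pi> n)"

lemma direct_system_square: "direct_system K A2 \<pi>2"
  by (rule direct_system.intro)
    (rule module.module_tensor_power[OF stage_module]
      tensor_map_linear[OF stage_module stage_module step_linear])+

lemma transition_square:
  assumes "n \<le> k" "X \<in> carrier (A2 n)"
  shows "transition \<pi>2 n k X = tensor_map K (A n) (A k) 2 (t n k) X"
  using assms(1)
proof (induction k rule: dec_induct)
  case base
  interpret S: direct_system K A2 \<pi>2 by (rule direct_system_square)
  show ?case
    using tensor_map_id[OF stage_module _ assms(2), of id] by (simp add: id_def)
next
  case (step k)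
  then show ?case
    using tensor_map_compose[OF stage_module stage_module stage_module
        transition_linear[OF step(1)] step_linear assms(2)]
    by (simp add: comp_def)
qed

text \<open>The tensor square of the limit is the limit of the tensor squares: the bilinear map
  \<open>(\<psi> x, \<psi> y) \<mapsto> [x \<otimes> y]\<close> inverts the canonical map in one direction, which suffices for injectivity.\<close>

lemma square_limit_kernel:
  assumes X: "X \<in> carrier (A2 n)" and 0: "tensor_map K (A n) L 2 (\<psi> n) X = \<zero>\<^bsub>tensor_algebra K L\<^esub>"
  obtains k where "n \<le> k" "tensor_map K (A n) (A k) 2 (t n k) X = \<zero>\<^bsub>tensor_algebra K (A k)\<^esub>"
proof -
  interpret S: direct_system K A2 \<pi>2 by (rule direct_system_square)
  interpret L: module K L by (rule module_limit)
  have tens2: "tens K (A n) [x, y] \<in> carrier (A2 n)"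
    if "x \<in> carrier (A n)" "y \<in> carrier (A n)" for x y n
    using that by (intro module.tens_in_tensor_power[OF stage_module]) auto
  \<comment> \<open>A function on words, as \<open>tensor_lift\<close> expects; only words of length
    two matter. It is well defined because the class of x \<otimes> y does not depend on the stage,
    which is \<open>compat\<close> below.\<close>
  define \<phi> where "\<phi> w = (THE Z. \<exists>n. \<exists>x\<in>carrier (A n). \<exists>y\<in>carrier (A n).
    w ! 0 = \<psi> n x \<and> w ! 1 = \<psi> n y \<and> Z = S.\<psi> n (tens K (A n) [x, y]))" for w
  have compat: "S.\<psi> k (tens K (A k) [t n k x, t n k y]) = S.\<psi> n (tens K (A n) [x, y])"
    if "n \<le> k" "x \<in> carrier (A n)" "y \<in> carrier (A n)" for n k x y
  proof -
    have "S.t n k (tens K (A n) [x, y]) = tens K (A k) [t n k x, t n k y]"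
      using transition_square[OF that(1) tens2[OF that(2,3)]] that
      by (simp add: tensor_map_tens[OF stage_module stage_module transition_linear])
    then show ?thesis
      using S.limit_class_transition[OF that(1) tens2[OF that(2,3)]] by simp
  qed
  have \<phi>: "\<phi> [\<psi> n x, \<psi> n y] = S.\<psi> n (tens K (A n) [x, y])"
    if "x \<in> carrier (A n)" "y \<in> carrier (A n)" for n x y
    using limit_the2[of "\<lambda>n x y. S.\<psi> n (tens K (A n) [x, y])", OF compat that]
    by (simp add: \<phi>_def)
  have bilin: "tens K (A n) [x \<oplus>\<^bsub>A n\<^esub> y, z] = tens K (A n) [x, z] \<oplus>\<^bsub>tensor_algebra K (A n)\<^esub> tens K (A n) [y, z]"
      "tens K (A n) [z, x \<oplus>\<^bsub>A n\<^esub> y] = tens K (A n) [z, x] \<oplus>\<^bsub>tensor_algebra K (A n)\<^esub> tens K (A n) [z, y]"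
      "a \<in> carrier K \<Longrightarrow> tens K (A n) [a \<odot>\<^bsub>A n\<^esub> x, z] = a \<odot>\<^bsub>tensor_algebra K (A n)\<^esub> tens K (A n) [x, z]"
      "a \<in> carrier K \<Longrightarrow> tens K (A n) [z, a \<odot>\<^bsub>A n\<^esub> x] = a \<odot>\<^bsub>tensor_algebra K (A n)\<^esub> tens K (A n) [z, x]"
    if "x \<in> carrier (A n)" "y \<in> carrier (A n)" "z \<in> carrier (A n)" for n x y z a
  proof -
    note ml = module.tens_multilinear[OF stage_module[of n], of 2, unfolded multilinear_def, THEN conjunct2]
    note l = ml[THEN bspec[of _ _ "[]"], THEN bspec[of _ _ "[z]"]]
    note r = ml[THEN bspec[of _ _ "[z]"], THEN bspec[of _ _ "[]"]]
    show "tens K (A n) [x \<oplus>\<^bsub>A n\<^esub> y, z] = tens K (A n) [x, z] \<oplus>\<^bsub>tensor_algebra K (A n)\<^esub> tens K (A n) [y, z]"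
      "a \<in> carrier K \<Longrightarrow> tens K (A n) [a \<odot>\<^bsub>A n\<^esub> x, z] = a \<odot>\<^bsub>tensor_algebra K (A n)\<^esub> tens K (A n) [x, z]"
      using l that by simp_all
    show "tens K (A n) [z, x \<oplus>\<^bsub>A n\<^esub> y] = tens K (A n) [z, x] \<oplus>\<^bsub>tensor_algebra K (A n)\<^esub> tens K (A n) [z, y]"
      "a \<in> carrier K \<Longrightarrow> tens K (A n) [z, a \<odot>\<^bsub>A n\<^esub> x] = a \<odot>\<^bsub>tensor_algebra K (A n)\<^esub> tens K (A n) [z, x]"
      using r that by simp_all
  qed
  have \<psi>2_add: "S.\<psi> n (P \<oplus>\<^bsub>tensor_algebra K (A n)\<^esub> Q) = S.\<psi> n P \<oplus>\<^bsub>S.L\<^esub> S.\<psi> n Q"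
    if "P \<in> carrier (A2 n)" "Q \<in> carrier (A2 n)" for n P Q
    using S.limit_add[OF that] by (simp add: module.tensor_power_sel[OF stage_module])
  have \<psi>2_smult: "S.\<psi> n (a \<odot>\<^bsub>tensor_algebra K (A n)\<^esub> P) = a \<odot>\<^bsub>S.L\<^esub> S.\<psi> n P"
    if "a \<in> carrier K" "P \<in> carrier (A2 n)" for n P a
    using S.limit_smult[OF that] by (simp add: module.tensor_power_sel[OF stage_module])
  \<comment> \<open>Bilinearity of \<open>\<phi>\<close> relates three elements of the limit, which
    have to be represented at a common stage.\<close>
  have three: "\<exists>n x' y' z'. x' \<in> carrier (A n) \<and> y' \<in> carrier (A n) \<and> z' \<in> carrier (A n) \<and>
      x = \<psi> n x' \<and> y = \<psi> n y' \<and> z = \<psi> n z'"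
    if xyz: "x \<in> carrier L" "y \<in> carrier L" "z \<in> carrier L" for x y z
  proof -
    obtain m x' y' where xy: "x' \<in> carrier (A m)" "y' \<in> carrier (A m)" "x = \<psi> m x'" "y = \<psi> m y'"
      using limit_cases2[OF xyz(1,2)] by blast
    obtain k z' where z: "z' \<in> carrier (A k)" "z = \<psi> k z'" "m \<le> k"
      using limit_cases[OF xyz(3), of m] by blast
    have "t m k x' \<in> carrier (A k)" "t m k y' \<in> carrier (A k)"
      "x = \<psi> k (t m k x')" "y = \<psi> k (t m k y')"
      using xy z(3) by (simp_all add: transition_closed limit_class_transition)
    with z show ?thesis by blast
  qed
  have \<phi>_bilin: "\<phi> [x \<oplus>\<^bsub>L\<^esub> y, z] = \<phi> [x, z] \<oplus>\<^bsub>S.L\<^esub> \<phi> [y, z]" "\<phi> [z, x \<oplus>\<^bsub>L\<^esub> y] = \<phi> [z, x] \<oplus>\<^bsub>S.L\<^esub> \<phi> [z, y]"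
      "a \<in> carrier K \<Longrightarrow> \<phi> [a \<odot>\<^bsub>L\<^esub> x, z] = a \<odot>\<^bsub>S.L\<^esub> \<phi> [x, z]"
      "a \<in> carrier K \<Longrightarrow> \<phi> [z, a \<odot>\<^bsub>L\<^esub> x] = a \<odot>\<^bsub>S.L\<^esub> \<phi> [z, x]"
      "\<phi> [x, z] \<in> carrier S.L"
    if xyz: "x \<in> carrier L" "y \<in> carrier L" "z \<in> carrier L" for x y z a
  proof -
    from three[OF xyz] obtain n x' y' z' where *: "x' \<in> carrier (A n)" "y' \<in> carrier (A n)" "z' \<in> carrier (A n)"
        and eq: "x = \<psi> n x'" "y = \<psi> n y'" "z = \<psi> n z'"
      by blast
    interpret An: module K "A n" by (rule stage_module)
    show "\<phi> [x \<oplus>\<^bsub>L\<^esub> y, z] = \<phi> [x, z] \<oplus>\<^bsub>S.L\<^esub> \<phi> [y, z]" "\<phi> [z, x \<oplus>\<^bsub>L\<^esub> y] = \<phi> [z, x] \<oplus>\<^bsub>S.L\<^esub> \<phi> [z, y]"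
      "a \<in> carrier K \<Longrightarrow> \<phi> [a \<odot>\<^bsub>L\<^esub> x, z] = a \<odot>\<^bsub>S.L\<^esub> \<phi> [x, z]"
      "a \<in> carrier K \<Longrightarrow> \<phi> [z, a \<odot>\<^bsub>L\<^esub> x] = a \<odot>\<^bsub>S.L\<^esub> \<phi> [z, x]"
      "\<phi> [x, z] \<in> carrier S.L"
      unfolding eq using *
      by (simp_all add: limit_add limit_smult \<phi> bilin tens2 \<psi>2_add \<psi>2_smult S.limit_class_closed)
  qed
  have ml: "multilinear K L S.L 2 \<phi>"
    unfolding multilinear_def
  proof (intro conjI ballI impI)
    fix w assume w: "w \<in> lists (carrier L)" "length w = 2"
    then obtain x y where "w = [x, y]"
      unfolding numeral_2_eq_2 length_Suc_conv length_0_conv by blast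
    then show "\<phi> w \<in> carrier S.L" using w \<phi>_bilin(5)[of x x y] by simp
  next
    fix u v x y
    assume uv: "u \<in> lists (carrier L)" "v \<in> lists (carrier L)" "Suc (length u + length v) = 2"
      and xy: "x \<in> carrier L" "y \<in> carrier L"
    from uv(3) consider z where "u = []" "v = [z]" | z where "u = [z]" "v = []"
      by (auto simp: length_Suc_conv numeral_2_eq_2 add_is_1)
    then show "\<phi> (u @ (x \<oplus>\<^bsub>L\<^esub> y) # v) = \<phi> (u @ x # v) \<oplus>\<^bsub>S.L\<^esub> \<phi> (u @ y # v)"
      using uv xy \<phi>_bilin by cases auto
  next
    fix u v a x
    assume uv: "u \<in> lists (carrier L)" "v \<in> lists (carrier L)" "Suc (length u + length v) = 2"
      and ax: "a \<in> carrier K" "x \<in> carrier L"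
    from uv(3) consider z where "u = []" "v = [z]" | z where "u = [z]" "v = []"
      by (auto simp: length_Suc_conv numeral_2_eq_2 add_is_1)
    then show "\<phi> (u @ (a \<odot>\<^bsub>L\<^esub> x) # v) = a \<odot>\<^bsub>S.L\<^esub> \<phi> (u @ x # v)"
      using uv ax \<phi>_bilin by cases auto
  qed
  let ?\<Phi> = "tensor_lift K L S.L (replicate 2 (carrier L)) \<phi>"
  note \<Phi> = L.tensor_lift_linear[OF S.module_limit ml]
  \<comment> \<open>The left inverse property: for a pure tensor this is the value of
    \<open>\<phi>\<close>, and both sides are linear.\<close>
  have "?\<Phi> (tensor_map K (A n) L 2 (\<psi> n) X) = S.\<psi> n X"
  proof (rule module.tensor_power_linear_eqI[OF stage_module S.module_limit _ S.limit_class_linear _ X])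
    show "linear_map K (A2 n) S.L (\<lambda>X. ?\<Phi> (tensor_map K (A n) L 2 (\<psi> n) X))"
      by (rule linear_map_compose[OF tensor_map_linear[OF stage_module module_limit limit_class_linear] \<Phi>])
    fix w assume w: "w \<in> lists (carrier (A n))" "length w = 2"
    then obtain x y where xy: "w = [x, y]"
      unfolding numeral_2_eq_2 length_Suc_conv length_0_conv by blast
    have "map (\<psi> n) w \<in> lists (carrier L)" using w map_linear_lists[OF limit_class_linear] by blast
    then have "?\<Phi> (tens K L (map (\<psi> n) w)) = \<phi> (map (\<psi> n) w)"
      using w by (intro L.tensor_lift_tens[OF S.module_limit ml]) auto
    then show "?\<Phi> (tensor_map K (A n) L 2 (\<psi> n) (tens K (A n) w)) = S.\<psi> n (tens K (A n) w)"
      using w \<phi> by (simp add: tensor_map_tens[OF stage_module module_limit limit_class_linear] xy)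
  qed
  moreover have "?\<Phi> \<zero>\<^bsub>tensor_algebra K L\<^esub> = \<zero>\<^bsub>S.L\<^esub>"
    using linear_map_zero[OF L.module_tensor_power S.module_limit \<Phi>] by simp
  \<comment> \<open>In the limit of the squares a zero class vanishes at a finite stage, and there
    the transitions are the tensor squares of the transitions of \<open>A\<close>.\<close>
  ultimately have "S.\<psi> n X = \<zero>\<^bsub>S.L\<^esub>" using 0 by simp
  from S.limit_class_eq_zero[OF X this] obtain k where "n \<le> k" "S.t n k X = \<zero>\<^bsub>A2 k\<^esub>" by blast
  then show ?thesis
    using that transition_square[OF _ X] by (simp add: module.tensor_power_sel[OF stage_module])
qed

text \<open>The kernel statement applied to the difference of the two tensors, after both have been
  moved to the later of their stages.\<close>

lemma square_limit_eq:
  assumes X: "X \<in> carrier (A2 n)" and Y: "Y \<in> carrier (A2 m)"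
    and eq: "tensor_map K (A n) L 2 (\<psi> n) X = tensor_map K (A m) L 2 (\<psi> m) Y"
  obtains k where "n \<le> k" "m \<le> k"
    "tensor_map K (A n) (A k) 2 (t n k) X = tensor_map K (A m) (A k) 2 (t m k) Y"
proof -
  note lin = tensor_map_linear[OF stage_module stage_module transition_linear]
  define N where "N = max n m"
  have N: "n \<le> N" "m \<le> N" by (simp_all add: N_def)
  interpret T: module K "A2 N" by (rule module.module_tensor_power[OF stage_module])
  let ?X = "tensor_map K (A n) (A N) 2 (t n N) X" and ?Y = "tensor_map K (A m) (A N) 2 (t m N) Y"
  have XY: "?X \<in> carrier (A2 N)" "?Y \<in> carrier (A2 N)"
    using linear_mapD(1)[OF lin[OF N(1)] X] linear_mapD(1)[OF lin[OF N(2)] Y] by simp_all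
  have down: "tensor_map K (A l) L 2 (\<psi> l) (tensor_map K (A j) (A l) 2 (t j l) Z) =
      tensor_map K (A j) L 2 (\<psi> j) Z" if "j \<le> l" "Z \<in> carrier (A2 j)" for j l Z
    using tensor_map_compose[OF stage_module stage_module module_limit
        transition_linear[OF that(1)] limit_class_linear that(2)]
      tensor_map_cong[OF stage_module module_limit
        linear_map_compose[OF transition_linear[OF that(1)] limit_class_linear]
        limit_class_linear _ that(2)] limit_class_transition[OF that(1)]
    by simp
  note \<psi>N = tensor_map_linear[OF stage_module module_limit limit_class_linear]
  interpret L2: module K "tensor_power K L 2"
    by (rule module.module_tensor_power[OF module_limit])
  have "tensor_map K (A N) L 2 (\<psi> N) (?X \<ominus>\<^bsub>A2 N\<^esub> ?Y) =
      tensor_map K (A N) L 2 (\<psi> N) ?X \<ominus>\<^bsub>tensor_power K L 2\<^esub> tensor_map K (A N) L 2 (\<psi> N) ?Y"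
    using XY linear_mapD(2)[OF \<psi>N] linear_map_minus[OF T.module_axioms L2.module_axioms \<psi>N]
    by (simp add: a_minus_def)
  also have "\<dots> = \<zero>\<^bsub>tensor_power K L 2\<^esub>"
    using eq down[OF N(1) X] down[OF N(2) Y] linear_mapD(1)[OF \<psi>N XY(2)]
    by (simp add: a_minus_def L2.M.r_neg)
  finally have "tensor_map K (A N) L 2 (\<psi> N) (?X \<ominus>\<^bsub>A2 N\<^esub> ?Y) = \<zero>\<^bsub>tensor_algebra K L\<^esub>"
    by (simp add: module.tensor_power_sel[OF module_limit])
  from square_limit_kernel[OF _ this] XY obtain k where k: "N \<le> k"
      and 0: "tensor_map K (A N) (A k) 2 (t N k) (?X \<ominus>\<^bsub>A2 N\<^esub> ?Y) = \<zero>\<^bsub>tensor_algebra K (A k)\<^esub>"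
    by (auto simp: a_minus_def)
  interpret Tk: module K "A2 k" by (rule module.module_tensor_power[OF stage_module])
  let ?t = "tensor_map K (A N) (A k) 2 (t N k)"
  have "?t ?X \<ominus>\<^bsub>A2 k\<^esub> ?t ?Y = \<zero>\<^bsub>A2 k\<^esub>"
    using 0 XY linear_mapD(2)[OF lin[OF k]]
      linear_map_minus[OF T.module_axioms Tk.module_axioms lin[OF k]]
    by (simp add: a_minus_def module.tensor_power_sel[OF stage_module])
  then have "?t ?X = ?t ?Y"
    using linear_mapD(1)[OF lin[OF k] XY(1)] linear_mapD(1)[OF lin[OF k] XY(2)]
    by (metis Tk.M.minus_equality Tk.M.minus_minus Tk.M.add.inv_closed a_minus_def)
  moreover have "?t (tensor_map K (A j) (A N) 2 (t j N) Z) = tensor_map K (A j) (A k) 2 (t j k) Z"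
    if "j \<le> N" "Z \<in> carrier (A2 j)" for j Z
    using tensor_map_compose[OF stage_module stage_module stage_module
        transition_linear[OF that(1)] transition_linear[OF k] that(2)] transition_trans[OF that(1) k]
    by simp
  ultimately have "tensor_map K (A n) (A k) 2 (t n k) X = tensor_map K (A m) (A k) 2 (t m k) Y"
    using N X Y by simp
  from that[OF _ _ this] N k show ?thesis by simp
qed

end

section \<open>Linear retractions onto subspaces\<close>

text \<open>Zorn's lemma provides a submodule \<open>W\<close> maximal among those meeting
  \<open>S\<close> only in zero. If some \<open>x\<close> were outside W + S, then W + Kx would be a
  larger one.\<close>

lemma exists_complement:
  assumes K: "field K" and M: "module K M" and S: "submodule S K M"
  obtains W where "submodule W K M" "W \<inter> S \<subseteq> {\<zero>\<^bsub>M\<^esub>}"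
    "\<And>x. x \<in> carrier M \<Longrightarrow> \<exists>w\<in>W. \<exists>s\<in>S. x = w \<oplus>\<^bsub>M\<^esub> s"
proof -
  interpret K: field K by fact
  interpret M: module K M by fact
  note S' = M.submoduleE[OF S]
  define \<A> where "\<A> = {W. submodule W K M \<and> W \<inter> S \<subseteq> {\<zero>\<^bsub>M\<^esub>}}"
  have zero_mem: "\<zero>\<^bsub>M\<^esub> \<in> W" if "submodule W K M" for W
  proof -
    note W = M.submoduleE[OF that]
    obtain w where w: "w \<in> W" using W(2) by blast
    then have "\<zero>\<^bsub>K\<^esub> \<odot>\<^bsub>M\<^esub> w \<in> W" by (intro W(4)) auto
    moreover have "w \<in> carrier M" using w W(1) by blast
    ultimately show ?thesis by simp
  qed
  have "submodule {\<zero>\<^bsub>M\<^esub>} K M" by (rule M.submoduleI) auto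
  then have "\<A> \<noteq> {}" unfolding \<A>_def by blast
  moreover have "\<Union>\<C> \<in> \<A>" if C: "\<C> \<noteq> {}" "subset.chain \<A> \<C>" for \<C>
  proof -
    have sub: "submodule W K M" "W \<inter> S \<subseteq> {\<zero>\<^bsub>M\<^esub>}" if "W \<in> \<C>" for W
      using C(2) that by (auto simp: subset.chain_def \<A>_def)
    have "submodule (\<Union>\<C>) K M"
    proof (rule M.submoduleI)
      show "\<Union>\<C> \<subseteq> carrier M" using sub(1) M.submoduleE(1) by blast
      show "\<zero>\<^bsub>M\<^esub> \<in> \<Union>\<C>" using C(1) sub(1) zero_mem by blast
      show "\<ominus>\<^bsub>M\<^esub> x \<in> \<Union>\<C>" if "x \<in> \<Union>\<C>" for x
        using that sub(1) M.submoduleE(3) by blast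
      show "a \<odot>\<^bsub>M\<^esub> x \<in> \<Union>\<C>" if "a \<in> carrier K" "x \<in> \<Union>\<C>" for a x
        using that sub(1) M.submoduleE(4) by blast
      fix x y assume "x \<in> \<Union>\<C>" "y \<in> \<Union>\<C>"
      \<comment> \<open>In a chain the larger of two members contains both elements, hence also
        their sum.\<close>
      then obtain X Y where XY: "x \<in> X" "y \<in> Y" "X \<in> \<C>" "Y \<in> \<C>" by blast
      then have "X \<subseteq> Y \<or> Y \<subseteq> X" using C(2) by (auto simp: subset.chain_def)
      then obtain Z where "x \<in> Z" "y \<in> Z" "Z \<in> \<C>" using XY by blast
      then show "x \<oplus>\<^bsub>M\<^esub> y \<in> \<Union>\<C>" using sub(1) M.submoduleE(5) by blast
    qed
    then show ?thesis using sub(2) by (auto simp: \<A>_def)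
  qed
  ultimately obtain W where W: "W \<in> \<A>" and max: "\<And>X. \<lbrakk>X \<in> \<A>; W \<subseteq> X\<rbrakk> \<Longrightarrow> X = W"
    using subset_Zorn_nonempty[of \<A>] by blast
  then have Wsub: "submodule W K M" and WS: "W \<inter> S \<subseteq> {\<zero>\<^bsub>M\<^esub>}" by (auto simp: \<A>_def)
  note W' = M.submoduleE[OF Wsub]
  have Wc: "w \<in> carrier M" if "w \<in> W" for w using that W'(1) by blast
  have Sc: "w \<in> carrier M" if "w \<in> S" for w using that S'(1) by blast
  have "\<exists>w\<in>W. \<exists>s\<in>S. x = w \<oplus>\<^bsub>M\<^esub> s" if x: "x \<in> carrier M" for x
  proof (rule ccontr)
    assume *: "\<not> (\<exists>w\<in>W. \<exists>s\<in>S. x = w \<oplus>\<^bsub>M\<^esub> s)"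
    let ?X = "{w \<oplus>\<^bsub>M\<^esub> a \<odot>\<^bsub>M\<^esub> x | w a. w \<in> W \<and> a \<in> carrier K}"
    have memI: "y \<in> ?X" if "w \<in> W" "a \<in> carrier K" "y = w \<oplus>\<^bsub>M\<^esub> a \<odot>\<^bsub>M\<^esub> x" for y w a
      using that by blast
    have WX: "W \<subseteq> ?X"
    proof
      fix w assume "w \<in> W"
      then show "w \<in> ?X" using x Wc by (intro memI[of w "\<zero>\<^bsub>K\<^esub>"]) auto
    qed
    have xX: "x \<in> ?X" using x zero_mem[OF Wsub] by (intro memI[of "\<zero>\<^bsub>M\<^esub>" "\<one>\<^bsub>K\<^esub>"]) auto
    have "submodule ?X K M"
    proof (rule M.submoduleI)
      show "?X \<subseteq> carrier M" using Wc x by auto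
      show "\<zero>\<^bsub>M\<^esub> \<in> ?X" using WX zero_mem[OF Wsub] by blast
      fix y assume "y \<in> ?X"
      then obtain w a where y: "y = w \<oplus>\<^bsub>M\<^esub> a \<odot>\<^bsub>M\<^esub> x" "w \<in> W" "a \<in> carrier K" by blast
      show "\<ominus>\<^bsub>M\<^esub> y \<in> ?X"
        using y x Wc W'(3)
        by (intro memI[of "\<ominus>\<^bsub>M\<^esub> w" "\<ominus>\<^bsub>K\<^esub> a"]) (auto simp: M.M.minus_add M.smult_l_minus)
      show "c \<odot>\<^bsub>M\<^esub> y \<in> ?X" if "c \<in> carrier K" for c
        using y x Wc W'(4) that
        by (intro memI[of "c \<odot>\<^bsub>M\<^esub> w" "c \<otimes>\<^bsub>K\<^esub> a"]) (auto simp: M.smult_r_distr M.smult_assoc1)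
      fix z assume "z \<in> ?X"
      then obtain v c where z: "z = v \<oplus>\<^bsub>M\<^esub> c \<odot>\<^bsub>M\<^esub> x" "v \<in> W" "c \<in> carrier K" by blast
      show "y \<oplus>\<^bsub>M\<^esub> z \<in> ?X"
        using y z x Wc W'(5)
        by (intro memI[of "w \<oplus>\<^bsub>M\<^esub> v" "a \<oplus>\<^bsub>K\<^esub> c"]) (auto simp: M.smult_l_distr M.M.a_ac)
    qed
    moreover have "?X \<inter> S \<subseteq> {\<zero>\<^bsub>M\<^esub>}"
    proof
      fix s assume "s \<in> ?X \<inter> S"
      then obtain w a where s: "s = w \<oplus>\<^bsub>M\<^esub> a \<odot>\<^bsub>M\<^esub> x" "w \<in> W" "a \<in> carrier K" "s \<in> S" by blast
      show "s \<in> {\<zero>\<^bsub>M\<^esub>}"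
      proof (cases "a = \<zero>\<^bsub>K\<^esub>")
        case True
        then have "s = w" using s x Wc by simp
        then show ?thesis using s WS by blast
      next
        case False
        \<comment> \<open>Division by the nonzero coefficient solves for \<open>x\<close> and writes
          it as an element of W + S, against its choice.\<close>
        then have a: "inv\<^bsub>K\<^esub> a \<in> carrier K" "inv\<^bsub>K\<^esub> a \<otimes>\<^bsub>K\<^esub> a = \<one>\<^bsub>K\<^esub>"
          using s(3) by (simp_all add: K.field_Units)
        have "inv\<^bsub>K\<^esub> a \<odot>\<^bsub>M\<^esub> s = inv\<^bsub>K\<^esub> a \<odot>\<^bsub>M\<^esub> w \<oplus>\<^bsub>M\<^esub> (inv\<^bsub>K\<^esub> a \<otimes>\<^bsub>K\<^esub> a) \<odot>\<^bsub>M\<^esub> x"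
          unfolding s(1) using s(2,3) x Wc a(1) by (simp add: M.smult_r_distr M.smult_assoc1)
        then have eq: "inv\<^bsub>K\<^esub> a \<odot>\<^bsub>M\<^esub> s = inv\<^bsub>K\<^esub> a \<odot>\<^bsub>M\<^esub> w \<oplus>\<^bsub>M\<^esub> x" using a(2) x by simp
        have "x = \<ominus>\<^bsub>M\<^esub> (inv\<^bsub>K\<^esub> a \<odot>\<^bsub>M\<^esub> w) \<oplus>\<^bsub>M\<^esub> inv\<^bsub>K\<^esub> a \<odot>\<^bsub>M\<^esub> s"
          unfolding eq using a(1) s(2) Wc x by (simp add: M.M.r_neg1)
        moreover have "\<ominus>\<^bsub>M\<^esub> (inv\<^bsub>K\<^esub> a \<odot>\<^bsub>M\<^esub> w) \<in> W" "inv\<^bsub>K\<^esub> a \<odot>\<^bsub>M\<^esub> s \<in> S"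
          using a(1) s(2,4) by (simp_all add: W'(3,4) S'(4))
        ultimately have "\<exists>w\<in>W. \<exists>s\<in>S. x = w \<oplus>\<^bsub>M\<^esub> s" by (intro bexI)
        then show ?thesis using * by simp
      qed
    qed
    ultimately have "?X \<in> \<A>" unfolding \<A>_def by blast
    then have "?X = W" using max WX by blast
    then have "x \<in> W" using xX by blast
    moreover have "x = x \<oplus>\<^bsub>M\<^esub> \<zero>\<^bsub>M\<^esub>" using x by simp
    ultimately show False using * zero_mem[OF S] by blast
  qed
  then show ?thesis using that Wsub WS by blast
qed

text \<open>Projection along a complement. For the inclusion j of \<open>S\<close>, the map r
  \<otimes> r is then a left inverse of j \<otimes> j, which makes the latter injective.\<close>

lemma exists_retraction:
  assumes K: "field K" and M: "module K M" and S: "submodule S K M"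
  obtains r where "linear_map K M (M\<lparr>carrier := S\<rparr>) r" "\<And>s. s \<in> S \<Longrightarrow> r s = s"
proof -
  interpret M: module K M by fact
  note S' = M.submoduleE[OF S]
  obtain W where Wsub: "submodule W K M" and WS: "W \<inter> S \<subseteq> {\<zero>\<^bsub>M\<^esub>}"
    and dec: "\<And>x. x \<in> carrier M \<Longrightarrow> \<exists>w\<in>W. \<exists>s\<in>S. x = w \<oplus>\<^bsub>M\<^esub> s"
    using exists_complement[OF assms] by blast
  note W' = M.submoduleE[OF Wsub]
  have Wc: "w \<in> carrier M" if "w \<in> W" for w using that W'(1) by blast
  have Sc: "w \<in> carrier M" if "w \<in> S" for w using that S'(1) by blast
  define r where "r x = (THE s. s \<in> S \<and> (\<exists>w\<in>W. x = w \<oplus>\<^bsub>M\<^esub> s))" for x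
  have r: "r (w \<oplus>\<^bsub>M\<^esub> s) = s" if ws: "w \<in> W" "s \<in> S" for w s
    unfolding r_def
  proof (rule the_equality)
    show "s \<in> S \<and> (\<exists>w'\<in>W. w \<oplus>\<^bsub>M\<^esub> s = w' \<oplus>\<^bsub>M\<^esub> s)" using ws by blast
    fix s' assume "s' \<in> S \<and> (\<exists>w'\<in>W. w \<oplus>\<^bsub>M\<^esub> s = w' \<oplus>\<^bsub>M\<^esub> s')"
    \<comment> \<open>Two decompositions of one element differ by something in both \<open>W\<close>
      and \<open>S\<close>, that is, by zero.\<close>
    then obtain w' where s': "s' \<in> S" "w' \<in> W" "w \<oplus>\<^bsub>M\<^esub> s = w' \<oplus>\<^bsub>M\<^esub> s'" by blast
    note c = Wc[OF ws(1)] Sc[OF ws(2)] Wc[OF s'(2)] Sc[OF s'(1)]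
    have "\<ominus>\<^bsub>M\<^esub> w' \<oplus>\<^bsub>M\<^esub> w = (\<ominus>\<^bsub>M\<^esub> w' \<oplus>\<^bsub>M\<^esub> (w \<oplus>\<^bsub>M\<^esub> s)) \<oplus>\<^bsub>M\<^esub> \<ominus>\<^bsub>M\<^esub> s"
      using c by (simp add: M.M.a_assoc M.M.r_neg)
    also have "\<dots> = s' \<oplus>\<^bsub>M\<^esub> \<ominus>\<^bsub>M\<^esub> s"
      unfolding s'(3) using c by (simp add: M.M.r_neg1)
    finally have eq: "\<ominus>\<^bsub>M\<^esub> w' \<oplus>\<^bsub>M\<^esub> w = s' \<oplus>\<^bsub>M\<^esub> \<ominus>\<^bsub>M\<^esub> s" .
    have "\<ominus>\<^bsub>M\<^esub> w' \<oplus>\<^bsub>M\<^esub> w \<in> W" "s' \<oplus>\<^bsub>M\<^esub> \<ominus>\<^bsub>M\<^esub> s \<in> S"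
      using ws s' by (simp_all add: W'(3,5) S'(3,5))
    then have "s' \<oplus>\<^bsub>M\<^esub> \<ominus>\<^bsub>M\<^esub> s = \<zero>\<^bsub>M\<^esub>" using eq WS by auto
    then show "s' = s"
      using c by (metis M.M.minus_equality M.M.minus_minus M.M.add.inv_closed)
  qed
  have zero_W: "\<zero>\<^bsub>M\<^esub> \<in> W"
  proof -
    obtain w where "w \<in> W" using W'(2) by blast
    then show ?thesis using W'(3,5)[of w] W'(5)[of w "\<ominus>\<^bsub>M\<^esub> w"] Wc[of w] by (simp add: M.M.r_neg)
  qed
  have "linear_map K M (M\<lparr>carrier := S\<rparr>) r"
  proof (rule linear_mapI)
    fix x assume "x \<in> carrier M"
    then obtain w s where x: "w \<in> W" "s \<in> S" "x = w \<oplus>\<^bsub>M\<^esub> s" using dec by blast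
    then show "r x \<in> carrier (M\<lparr>carrier := S\<rparr>)" using r by simp
    {
      fix y assume "y \<in> carrier M"
      then obtain v u where y: "v \<in> W" "u \<in> S" "y = v \<oplus>\<^bsub>M\<^esub> u" using dec by blast
      have "x \<oplus>\<^bsub>M\<^esub> y = (w \<oplus>\<^bsub>M\<^esub> v) \<oplus>\<^bsub>M\<^esub> (s \<oplus>\<^bsub>M\<^esub> u)"
        using x y Wc Sc by (simp add: M.M.a_ac)
      moreover have "r ((w \<oplus>\<^bsub>M\<^esub> v) \<oplus>\<^bsub>M\<^esub> (s \<oplus>\<^bsub>M\<^esub> u)) = s \<oplus>\<^bsub>M\<^esub> u"
        by (rule r) (use x y in \<open>simp_all add: W'(5) S'(5)\<close>)
      ultimately show "r (x \<oplus>\<^bsub>M\<^esub> y) = r x \<oplus>\<^bsub>M\<lparr>carrier := S\<rparr>\<^esub> r y"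
        using x y r by simp
    }
    fix a assume a: "a \<in> carrier K"
    have "a \<odot>\<^bsub>M\<^esub> x = a \<odot>\<^bsub>M\<^esub> w \<oplus>\<^bsub>M\<^esub> a \<odot>\<^bsub>M\<^esub> s"
      using x a Wc Sc by (simp add: M.smult_r_distr)
    moreover have "r (a \<odot>\<^bsub>M\<^esub> w \<oplus>\<^bsub>M\<^esub> a \<odot>\<^bsub>M\<^esub> s) = a \<odot>\<^bsub>M\<^esub> s"
      by (rule r) (use x a in \<open>simp_all add: W'(4) S'(4)\<close>)
    ultimately show "r (a \<odot>\<^bsub>M\<^esub> x) = a \<odot>\<^bsub>M\<lparr>carrier := S\<rparr>\<^esub> r x"
      using x r by simp
  qed
  moreover have "r s = s" if "s \<in> S" for s
    using r[OF zero_W that] Sc[OF that] by simp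
  ultimately show ?thesis using that by blast
qed

section \<open>Transport of a braiding\<close>

text \<open>Transfers the vector space structure between records with different extension fields,
  such as the limit restricted to its primitives and \<open>primitive_space\<close>.\<close>

lemma module_cong:
  assumes "module K M" and "carrier N = carrier M" "add N = add M" "zero N = zero M" "smult N = smult M"
  shows "module K N"
proof -
  interpret M: module K M by fact
  show ?thesis
  proof (rule moduleI)
    show "abelian_group N"
    proof (rule abelian_groupI)
      fix x assume "x \<in> carrier N"
      then show "\<exists>y\<in>carrier N. y \<oplus>\<^bsub>N\<^esub> x = \<zero>\<^bsub>N\<^esub>"
        using M.M.l_neg[of x] M.M.a_inv_closed[of x] by (auto simp: assms(2-))
    qed (simp_all add: assms(2-) M.M.a_ac)
  qed (simp_all add: assms(2-) M.smult_l_distr M.smult_r_distr M.smult_assoc1 M.R.is_cring)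
qed

text \<open>The linearity ideal mentions only the carrier, the addition and the scalar
  multiplication. The limit as an algebra and the limit as a bialgebra thus have literally the same
  tensor algebra.\<close>

lemma tensor_algebra_cong:
  assumes "carrier V' = carrier V" "add V' = add V" "smult V' = smult V"
  shows "tensor_algebra K V' = tensor_algebra K V" "tens K V' = tens K V"
    "tensor_power K V' n = tensor_power K V n"
proof -
  have "linearity_ideal K V' = linearity_ideal K V"
    by (simp add: linearity_ideal_def assms)
  then show "tensor_algebra K V' = tensor_algebra K V" "tens K V' = tens K V"
    by (simp_all add: tensor_algebra_def tens_def fun_eq_iff assms)
  then show "tensor_power K V' n = tensor_power K V n"
    by (simp add: tensor_power_def tensor_product_def assms)
qed

lemma tensor_square_map_cong:
  assumes "carrier V' = carrier V" "add V' = add V" "smult V' = smult V"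
    and "carrier W' = carrier W" "add W' = add W" "smult W' = smult W"
  shows "tensor_square_map K V' W' f = tensor_square_map K V W f"
  by (simp add: tensor_square_map_def tensor_maps_def tensor_lift_def fun_eq_iff
      tensor_algebra_cong[OF assms(4-6)] assms(1))

text \<open>The tensor powers of \<open>i\<close> are bijective with inverses the tensor powers of
  its inverse \<open>g\<close>. Hence \<open>comm\<close> determines \<open>braiding P\<close> on
  the tensor square as the conjugate of \<open>braiding V\<close>; its linearity, the braid equation
  and the compatibility of \<open>g\<close> follow from this.\<close>

lemma braided_iso_transport:
  fixes K :: "('k, 'm) ring_scheme" and V :: "('k, 'v, 'x) braided_space_scheme"
    and P :: "('k, 'w, 'y) braided_space_scheme"
  assumes V: "braided_vector_space K V" and P: "module K P"
    and i: "linear_map K V P i" and bij: "bij_betw i (carrier V) (carrier P)"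
    and comm: "\<And>X. X \<in> carrier (tensor_power K V 2) \<Longrightarrow>
      braiding P (tensor_map K V P 2 i X) = tensor_map K V P 2 i (braiding V X)"
  shows "braided_iso K V P i"
proof -
  interpret V: braided_vector_space K V by (rule V)
  interpret P: module K P by (rule P)
  have mV: "module K V" by (rule V.module_axioms)
  define g where "g = inv_into (carrier V) i"
  have gi: "g (i v) = v" if "v \<in> carrier V" for v
    using that bij by (simp add: g_def bij_betw_def)
  have ig: "i (g w) = w" and gc: "g w \<in> carrier V" if "w \<in> carrier P" for w
    using that bij by (simp_all add: g_def bij_betw_inv_into_right bij_betw_apply[OF bij_betw_inv_into])
  have g: "linear_map K P V g"
  proof (rule linear_mapI)
    fix x y assume x: "x \<in> carrier P" and y: "y \<in> carrier P"
    have "i (g x \<oplus>\<^bsub>V\<^esub> g y) = x \<oplus>\<^bsub>P\<^esub> y"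
      using linear_mapD(2)[OF i gc[OF x] gc[OF y]] ig x y by simp
    then show "g (x \<oplus>\<^bsub>P\<^esub> y) = g x \<oplus>\<^bsub>V\<^esub> g y"
      using gi[of "g x \<oplus>\<^bsub>V\<^esub> g y"] gc x y by simp
  next
    fix a x assume a: "a \<in> carrier K" and x: "x \<in> carrier P"
    have "i (a \<odot>\<^bsub>V\<^esub> g x) = a \<odot>\<^bsub>P\<^esub> x"
      using linear_mapD(3)[OF i a gc[OF x]] ig x by simp
    then show "g (a \<odot>\<^bsub>P\<^esub> x) = a \<odot>\<^bsub>V\<^esub> g x"
      using gi[of "a \<odot>\<^bsub>V\<^esub> g x"] gc a x by simp
  qed (rule gc)
  note in_lin = tensor_map_linear[OF mV P i] and gn_lin = tensor_map_linear[OF P mV g]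
  have gin: "tensor_map K P V n g (tensor_map K V P n i X) = X"
    if "X \<in> carrier (tensor_power K V n)" for n X
    unfolding tensor_map_compose[OF mV P mV i g that] by (rule tensor_map_id[OF mV gi that])
  have ign: "tensor_map K V P n i (tensor_map K P V n g X) = X"
    if "X \<in> carrier (tensor_power K P n)" for n X
    unfolding tensor_map_compose[OF P mV P g i that] by (rule tensor_map_id[OF P ig that])
  have cP: "braiding P X = tensor_map K V P 2 i (braiding V (tensor_map K P V 2 g X))"
    if "X \<in> carrier (tensor_power K P 2)" for X
    using comm[OF linear_mapD(1)[OF gn_lin that]] ign[OF that] by simp
  have cP_lin: "linear_map K (tensor_power K P 2) (tensor_power K P 2) (braiding P)"
    by (rule linear_map_cong[OF linear_map_compose[OF linear_map_compose[OF gn_lin V.braiding_linear] in_lin]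
          _ P.module_tensor_power]) (simp add: cP)
  have id_linV: "linear_map K (tensor_power K V 1) (tensor_power K V 1) id"
    and id_linP: "linear_map K (tensor_power K P 1) (tensor_power K P 1) id"
    by (simp_all add: linear_map_def)
  \<comment> \<open>The naturality lemma yields degrees as sums p + r, while the braid equation is
    stated in degree three.\<close>
  have three: "(2::nat) + 1 = 3" "(1::nat) + 2 = 3" by simp_all
  have c1: "tensor_hom K P 2 1 (braiding P) id (tensor_map K V P 3 i X) =
      tensor_map K V P 3 i (tensor_hom K V 2 1 (braiding V) id X)"
    and c2: "tensor_hom K P 1 2 id (braiding P) (tensor_map K V P 3 i X) =
      tensor_map K V P 3 i (tensor_hom K V 1 2 id (braiding V) X)"
    and h1: "tensor_hom K V 2 1 (braiding V) id X \<in> carrier (tensor_power K V 3)"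
    and h2: "tensor_hom K V 1 2 id (braiding V) X \<in> carrier (tensor_power K V 3)"
    if X: "X \<in> carrier (tensor_power K V 3)" for X
  proof -
    have X': "X \<in> carrier (tensor_power K V (2 + 1))" "X \<in> carrier (tensor_power K V (1 + 2))"
      using X by (simp_all only: three)
    show "tensor_hom K P 2 1 (braiding P) id (tensor_map K V P 3 i X) =
      tensor_map K V P 3 i (tensor_hom K V 2 1 (braiding V) id X)"
      using tensor_map_tensor_hom[OF mV P i V.braiding_linear id_linV cP_lin id_linP comm _ X'(1), unfolded three] by simp
    show "tensor_hom K P 1 2 id (braiding P) (tensor_map K V P 3 i X) =
      tensor_map K V P 3 i (tensor_hom K V 1 2 id (braiding V) X)"
      using tensor_map_tensor_hom[OF mV P i id_linV V.braiding_linear id_linP cP_lin _ comm X'(2), unfolded three] by simp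
    show "tensor_hom K V 2 1 (braiding V) id X \<in> carrier (tensor_power K V 3)"
      using V.tensor_hom_closed[OF V.braiding_linear id_linV X'(1), unfolded three] .
    show "tensor_hom K V 1 2 id (braiding V) X \<in> carrier (tensor_power K V 3)"
      using V.tensor_hom_closed[OF id_linV V.braiding_linear X'(2), unfolded three] .
  qed
  have "braided_vector_space K P"
  proof (intro braided_vector_space.intro braided_vector_space_axioms.intro)
    show "field K" by (rule V.field_axioms)
    show "module K P" by (rule P)
    show "linear_map K (tensor_power K P 2) (tensor_power K P 2) (braiding P)" by (rule cP_lin)
    fix Y assume Y: "Y \<in> carrier (tensor_power K P 3)"
    define X where "X = tensor_map K P V 3 g Y"
    have X: "X \<in> carrier (tensor_power K V 3)" using linear_mapD(1)[OF gn_lin Y] by (simp add: X_def)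
    have YX: "Y = tensor_map K V P 3 i X" using ign[OF Y] by (simp add: X_def)
    show "tensor_hom K P 2 1 (braiding P) id
         (tensor_hom K P 1 2 id (braiding P)
           (tensor_hom K P 2 1 (braiding P) id Y)) =
       tensor_hom K P 1 2 id (braiding P)
         (tensor_hom K P 2 1 (braiding P) id
           (tensor_hom K P 1 2 id (braiding P) Y))"
      \<comment> \<open>On either side the three factors slide past the third tensor power of
        \<open>i\<close> one after the other, leaving the braid equation of \<open>V\<close>
        inside.\<close>
      unfolding YX by (simp only: c1 c2 h1 h2 X V.braid_equation)
  qed
  moreover have "braiding P (tensor_square_map K V P i X) = tensor_square_map K V P i (braiding V X)"
    if X: "X \<in> carrier (tensor_power K V 2)" for X
    using comm[OF X] linear_mapD(1)[OF V.braiding_linear X] X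
    by (simp add: tensor_square_map_eq_tensor_map[OF mV P i])
  moreover have "braiding V (tensor_square_map K P V g X) = tensor_square_map K P V g (braiding P X)"
    if X: "X \<in> carrier (tensor_power K P 2)" for X
    using cP[OF X] linear_mapD(1)[OF cP_lin X] X
      gin[OF linear_mapD(1)[OF V.braiding_linear linear_mapD(1)[OF gn_lin X]]]
    by (simp add: tensor_square_map_eq_tensor_map[OF P mV g])
  ultimately show ?thesis
    unfolding braided_iso_def braided_morphism_def
    using V i g gi ig by blast
qed

section \<open>The universal enveloping algebra\<close>

lemma enveloping_algebra_sel [simp]:
  "carrier (enveloping_algebra K U \<pi>) = carrier (limit_algebra U \<pi>)"
  "add (enveloping_algebra K U \<pi>) = add (limit_algebra U \<pi>)"
  "zero (enveloping_algebra K U \<pi>) = zero (limit_algebra U \<pi>)"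
  "smult (enveloping_algebra K U \<pi>) = smult (limit_algebra U \<pi>)"
  "one (enveloping_algebra K U \<pi>) = limit_class U \<pi> 0 \<one>\<^bsub>U 0\<^esub>"
  by (simp_all add: enveloping_algebra_def Let_def limit_algebra_def)

lemma primitive_space_sel [simp]:
  "carrier (primitive_space K B) = primitives K B"
  "add (primitive_space K B) = add B"
  "zero (primitive_space K B) = zero B"
  "smult (primitive_space K B) = smult B"
  by (simp_all add: primitive_space_def Let_def module.defs braided_space.defs)

text \<open>Collects what holds for the limit of any sequence of braided bialgebra maps, separately
  from the brackets and the ideals that produce the stages.\<close>

locale bialgebra_system =
  fixes K :: "('k, 'm) ring_scheme" and U :: "nat \<Rightarrow> ('k, 'u, 'x) braided_bialgebra_scheme"
    and \<pi> :: "nat \<Rightarrow> 'u \<Rightarrow> 'u"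
  assumes step_map: "braided_bialgebra_map K (U n) (U (Suc n)) (\<pi> n)"
begin

lemma stage_bialgebra: "braided_bialgebra K (U n)"
  using step_map by (simp add: braided_bialgebra_map_def)

sublocale direct_system K U \<pi>
proof (rule direct_system.intro)
  fix n
  interpret Un: braided_bialgebra K "U n" by (rule stage_bialgebra)
  show "module K (U n)" by (rule Un.module_axioms)
  show "linear_map K (U n) (U (Suc n)) (\<pi> n)"
    using step_map[of n] by (simp add: braided_bialgebra_map_def braided_morphism_def)
qed

abbreviation "E \<equiv> enveloping_algebra K U \<pi>"
abbreviation "\<psi>2 \<equiv> \<lambda>n. tensor_map K (U n) L 2 (\<psi> n)"

lemma comult_linear: "linear_map K (U n) (A2 n) (comult (U n))"
  using stage_bialgebra[of n]
  by (simp add: braided_bialgebra_def braided_coalgebra_def braided_coalgebra_axioms_def)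

lemma braiding_linear: "linear_map K (A2 n) (A2 n) (braiding (U n))"
  using stage_bialgebra[of n]
  by (simp add: braided_bialgebra_def braided_algebra_def braided_vector_space_def
      braided_vector_space_axioms_def)

lemma one_stage_closed: "\<one>\<^bsub>U n\<^esub> \<in> carrier (U n)"
proof -
  interpret Un: braided_bialgebra K "U n" by (rule stage_bialgebra)
  interpret Un: ring "U n" by (rule Un.ring_axioms)
  show ?thesis by simp
qed

lemma transition_bialgebra:
  assumes "n \<le> k"
  shows "x \<in> carrier (U n) \<Longrightarrow>
      comult (U k) (t n k x) = tensor_map K (U n) (U k) 2 (t n k) (comult (U n) x)"
    and "X \<in> carrier (A2 n) \<Longrightarrow> braiding (U k) (tensor_map K (U n) (U k) 2 (t n k) X) =
      tensor_map K (U n) (U k) 2 (t n k) (braiding (U n) X)"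
    and "t n k \<one>\<^bsub>U n\<^esub> = \<one>\<^bsub>U k\<^esub>"
proof -
  have "(\<forall>x\<in>carrier (U n). comult (U k) (t n k x) =
        tensor_map K (U n) (U k) 2 (t n k) (comult (U n) x)) \<and>
      (\<forall>X\<in>carrier (A2 n). braiding (U k) (tensor_map K (U n) (U k) 2 (t n k) X) =
        tensor_map K (U n) (U k) 2 (t n k) (braiding (U n) X)) \<and>
      t n k \<one>\<^bsub>U n\<^esub> = \<one>\<^bsub>U k\<^esub>"
    using assms
  proof (induction k rule: dec_induct)
    case base
    have "tensor_map K (U n) (U n) 2 id X = X" if "X \<in> carrier (A2 n)" for X
      by (rule tensor_map_id[OF stage_module _ that]) simp
    then show ?case
      using linear_mapD(1)[OF comult_linear] linear_mapD(1)[OF braiding_linear] by (simp add: id_def)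
  next
    case (step k)
    note sq = tensor_square_map_eq_tensor_map[OF stage_module stage_module step_linear]
    have c: "comult (U (Suc k)) (\<pi> k x) = \<pi>2 k (comult (U k) x)" if "x \<in> carrier (U k)" for x
      using step_map[of k] that sq[OF linear_mapD(1)[OF comult_linear that]]
      by (simp add: braided_bialgebra_map_def)
    have b: "braiding (U (Suc k)) (\<pi>2 k X) = \<pi>2 k (braiding (U k) X)" if "X \<in> carrier (A2 k)" for X
    proof -
      have "braiding (U (Suc k)) (tensor_square_map K (U k) (U (Suc k)) (\<pi> k) X) =
          tensor_square_map K (U k) (U (Suc k)) (\<pi> k) (braiding (U k) X)"
        using step_map[of k] that by (simp add: braided_bialgebra_map_def braided_morphism_def)
      then show ?thesis
        by (simp only: sq[OF that] sq[OF linear_mapD(1)[OF braiding_linear that]])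
    qed
    have o: "\<pi> k \<one>\<^bsub>U k\<^esub> = \<one>\<^bsub>U (Suc k)\<^esub>"
      using step_map[of k] by (simp add: braided_bialgebra_map_def ring_hom_def)
    have comp: "tensor_map K (U n) (U (Suc k)) 2 (\<lambda>x. \<pi> k (t n k x)) X =
        \<pi>2 k (tensor_map K (U n) (U k) 2 (t n k) X)" if "X \<in> carrier (A2 n)" for X
      by (rule tensor_map_compose[OF stage_module stage_module stage_module
            transition_linear[OF step(1)] step_linear that, symmetric])
    note tl = linear_mapD(1)[OF tensor_map_linear[OF stage_module stage_module transition_linear[OF step(1)]]]
    show ?case
      using step c b o comp tl transition_closed[OF step(1)]
        linear_mapD(1)[OF comult_linear] linear_mapD(1)[OF braiding_linear]
      by (simp add: comp_def)
  qed
  then show "x \<in> carrier (U n) \<Longrightarrow>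
      comult (U k) (t n k x) = tensor_map K (U n) (U k) 2 (t n k) (comult (U n) x)"
    and "X \<in> carrier (A2 n) \<Longrightarrow> braiding (U k) (tensor_map K (U n) (U k) 2 (t n k) X) =
      tensor_map K (U n) (U k) 2 (t n k) (braiding (U n) X)"
    and "t n k \<one>\<^bsub>U n\<^esub> = \<one>\<^bsub>U k\<^esub>"
    by simp_all
qed

text \<open>The composite of \<open>\<psi> k\<close> with the transition equals
  \<open>\<psi> n\<close> on the carrier of stage \<open>n\<close> only, whence
  \<open>tensor_map_cong\<close> after functoriality.\<close>

lemma psi2_transition:
  assumes "n \<le> k" "X \<in> carrier (A2 n)"
  shows "\<psi>2 k (tensor_map K (U n) (U k) 2 (t n k) X) = \<psi>2 n X"
  using tensor_map_compose[OF stage_module stage_module module_limit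
      transition_linear[OF assms(1)] limit_class_linear assms(2)]
    tensor_map_cong[OF stage_module module_limit
      linear_map_compose[OF transition_linear[OF assms(1)] limit_class_linear]
      limit_class_linear _ assms(2)] limit_class_transition[OF assms(1)]
  by simp

lemma tensor_square_map_psi:
  "X \<in> carrier (A2 n) \<Longrightarrow> tensor_square_map K (U n) L (\<psi> n) X = \<psi>2 n X"
  by (rule tensor_square_map_eq_tensor_map[OF stage_module module_limit limit_class_linear])

lemma comult_enveloping:
  assumes x: "x \<in> carrier (U n)"
  shows "comult E (\<psi> n x) = \<psi>2 n (comult (U n) x)"
proof -
  note tsm = tensor_square_map_psi[OF linear_mapD(1)[OF comult_linear]]
  have compat: "tensor_square_map K (U k) L (\<psi> k) (comult (U k) (t n k x)) =
      tensor_square_map K (U n) L (\<psi> n) (comult (U n) x)"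
    if "n \<le> k" "x \<in> carrier (U n)" for n k x
    using psi2_transition[OF that(1) linear_mapD(1)[OF comult_linear that(2)]]
    by (subst tsm[OF transition_closed[OF that]], subst tsm[OF that(2)])
      (simp add: transition_bialgebra(1)[OF that])
  from limit_the[of "\<lambda>n x. tensor_square_map K (U n) L (\<psi> n) (comult (U n) x)", OF this x]
  show ?thesis by (simp add: enveloping_algebra_def Let_def tsm x)
qed

text \<open>The comultiplication is described through representatives of elements of the limit, for
  which \<open>limit_the\<close> suffices. The braiding is described through representatives of
  tensors over the limit, so uniqueness rests on \<open>square_limit_eq\<close>: two such
  representatives agree at a finite stage.\<close>

lemma braiding_enveloping:
  assumes X: "X \<in> carrier (A2 n)"
  shows "braiding E (\<psi>2 n X) = \<psi>2 n (braiding (U n) X)"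
proof -
  have "(THE Y. \<exists>m. \<exists>Z\<in>carrier (A2 m). \<psi>2 n X = tensor_square_map K (U m) L (\<psi> m) Z \<and>
      Y = tensor_square_map K (U m) L (\<psi> m) (braiding (U m) Z)) = \<psi>2 n (braiding (U n) X)"
    (is "The ?P = _")
  proof (rule the_equality)
    show "?P (\<psi>2 n (braiding (U n) X))"
      using X tensor_square_map_psi[OF X]
        tensor_square_map_psi[OF linear_mapD(1)[OF braiding_linear X]] by metis
    fix Y assume "?P Y"
    then obtain m Z where Z: "Z \<in> carrier (A2 m)" "\<psi>2 n X = \<psi>2 m Z" "Y = \<psi>2 m (braiding (U m) Z)"
      using tensor_square_map_psi linear_mapD(1)[OF braiding_linear] by metis
    obtain k where k: "n \<le> k" "m \<le> k"
        "tensor_map K (U n) (U k) 2 (t n k) X = tensor_map K (U m) (U k) 2 (t m k) Z"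
      using square_limit_eq[OF X Z(1,2)] by blast
    \<comment> \<open>At stage \<open>k\<close> the two representatives coincide, and the
      transitions commute with the braidings.\<close>
    have "\<psi>2 n (braiding (U n) X) = \<psi>2 k (braiding (U k) (tensor_map K (U n) (U k) 2 (t n k) X))"
      using psi2_transition[OF k(1) linear_mapD(1)[OF braiding_linear X]]
      by (simp add: transition_bialgebra(2)[OF k(1) X])
    also have "\<dots> = \<psi>2 m (braiding (U m) Z)"
      using psi2_transition[OF k(2) linear_mapD(1)[OF braiding_linear Z(1)]]
      by (simp add: k(3) transition_bialgebra(2)[OF k(2) Z(1)])
    finally show "Y = \<psi>2 n (braiding (U n) X)" using Z(3) by simp
  qed
  then show ?thesis by (simp add: enveloping_algebra_def Let_def)
qed

lemma one_limit: "\<psi> n \<one>\<^bsub>U n\<^esub> = \<one>\<^bsub>E\<^esub>"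
  using limit_class_transition[of 0 n "\<one>\<^bsub>U 0\<^esub>"] transition_bialgebra(3)[of 0 n] one_stage_closed
  by simp

section \<open>Primitive elements of the limit and their braiding\<close>

lemma primitive_limit_class:
  assumes x: "x \<in> primitives K (U n)"
  shows "\<psi> n x \<in> primitives K E"
proof -
  have xc: "x \<in> carrier (U n)" using x by (simp add: primitives_def)
  have "comult E (\<psi> n x) = \<psi>2 n (tens K (U n) [x, \<one>\<^bsub>U n\<^esub>] \<oplus>\<^bsub>tensor_algebra K (U n)\<^esub>
      tens K (U n) [\<one>\<^bsub>U n\<^esub>, x])"
    using x by (simp add: comult_enveloping[OF xc] primitives_def)
  also have "\<dots> = tens K L [\<psi> n x, \<psi> n \<one>\<^bsub>U n\<^esub>] \<oplus>\<^bsub>tensor_algebra K L\<^esub> tens K L [\<psi> n \<one>\<^bsub>U n\<^esub>, \<psi> n x]"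
    by (rule tensor_map_swap_sum[OF stage_module module_limit limit_class_linear xc one_stage_closed])
  finally show ?thesis
    using limit_class_closed[OF xc]
    \<comment> \<open>The selector rule for the unit would undo \<open>one_limit\<close> at stage
      zero and make the simplifier loop.\<close>
    by (simp add: primitives_def one_limit tensor_algebra_cong[of E L] del: enveloping_algebra_sel(5))
qed

lemma primitive_enveloping_cases:
  assumes X: "X \<in> primitives K E"
  obtains n x where "x \<in> primitives K (U n)" "X = \<psi> n x"
proof -
  have "X \<in> carrier L" using X by (simp add: primitives_def)
  then obtain n x where x: "x \<in> carrier (U n)" "X = \<psi> n x" using limit_cases[of X 0] by blast
  let ?p = "\<lambda>n x. tens K (U n) [x, \<one>\<^bsub>U n\<^esub>] \<oplus>\<^bsub>tensor_algebra K (U n)\<^esub> tens K (U n) [\<one>\<^bsub>U n\<^esub>, x]"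
  have "\<psi>2 n (comult (U n) x) = comult E X" by (simp add: x comult_enveloping)
  also have "\<dots> = tens K L [\<psi> n x, \<psi> n \<one>\<^bsub>U n\<^esub>] \<oplus>\<^bsub>tensor_algebra K L\<^esub> tens K L [\<psi> n \<one>\<^bsub>U n\<^esub>, \<psi> n x]"
    using X by (simp add: primitives_def one_limit x(2) tensor_algebra_cong[of E L]
        del: enveloping_algebra_sel(5))
  also have "\<dots> = \<psi>2 n (?p n x)"
    by (rule tensor_map_swap_sum[OF stage_module module_limit limit_class_linear x(1) one_stage_closed,
          symmetric])
  finally have eq: "\<psi>2 n (comult (U n) x) = \<psi>2 n (?p n x)" .
  from square_limit_eq[OF linear_mapD(1)[OF comult_linear x(1)]
      tens_swap_sum_closed[OF stage_module x(1) one_stage_closed] eq]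
  obtain k where k: "n \<le> k" and "tensor_map K (U n) (U k) 2 (t n k) (comult (U n) x) =
      tensor_map K (U n) (U k) 2 (t n k) (?p n x)" by blast
  \<comment> \<open>Transitions respect the comultiplication and the unit, so the equation of
    tensors at stage \<open>k\<close> is exactly primitivity of the transported element.\<close>
  then have "comult (U k) (t n k x) = ?p k (t n k x)"
    using tensor_map_swap_sum[OF stage_module stage_module transition_linear[OF k] x(1) one_stage_closed]
    by (simp add: transition_bialgebra(1,3)[OF k] x(1))
  then have "t n k x \<in> primitives K (U k)"
    using transition_closed[OF k x(1)] by (simp add: primitives_def)
  moreover have "X = \<psi> k (t n k x)" using limit_class_transition[OF k x(1)] x(2) by simp
  ultimately show ?thesis using that by blast
qed

text \<open>Over a field, \<open>j \<otimes> j\<close> is injective for the inclusion \<open>j\<close> of the primitives, so the description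
  operator defining the braiding of \<^const>\<open>primitive_space\<close> picks any witness.\<close>

lemma braiding_primitive_space:
  assumes K: "field K" and S: "submodule (primitives K E) K L"
    and X: "X \<in> carrier (tensor_power K (primitive_space K E) 2)"
    and Y: "Y \<in> carrier (tensor_power K (primitive_space K E) 2)"
    and eq: "tensor_map K (primitive_space K E) L 2 (\<lambda>x. x) Y =
      braiding E (tensor_map K (primitive_space K E) L 2 (\<lambda>x. x) X)"
  shows "braiding (primitive_space K E) X = Y"
proof -
  \<comment> \<open>\<open>?S\<close> is the bare vector space over which the definition of
    \<open>primitive_space\<close> takes tensor squares; it shares the fields that matter with
    \<open>?P\<close>.\<close>
  let ?P = "primitive_space K E" and ?S = "(module.truncate E)\<lparr>carrier := primitives K E\<rparr>"
  have S_sel: "carrier ?S = carrier ?P" "add ?S = add ?P" "smult ?S = smult ?P"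
    by (simp_all add: module.defs)
  have mL': "module K (L\<lparr>carrier := primitives K E\<rparr>)"
    by (rule submodule.submodule_is_module[OF S module_limit])
  have mP: "module K ?P" by (rule module_cong[OF mL']) simp_all
  have sub: "x \<in> carrier L" if "x \<in> primitives K E" for x
    using that by (simp add: primitives_def)
  have j: "linear_map K ?P L (\<lambda>x. x)"
    by (rule linear_mapI) (simp_all add: sub)
  \<comment> \<open>Since \<open>r0\<close> is the identity on primitives, its tensor square undoes
    the tensor square of the inclusion; this is the injectivity used below.\<close>
  obtain r0 where r0: "linear_map K L (L\<lparr>carrier := primitives K E\<rparr>) r0"
      and r0_id: "\<And>s. s \<in> primitives K E \<Longrightarrow> r0 s = s"
    using exists_retraction[OF K module_limit S] by blast
  have r: "linear_map K L ?P r0" using r0 by (simp add: linear_map_def)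
  have inj: "Z = Z'" if Z: "Z \<in> carrier (tensor_power K ?P 2)" "Z' \<in> carrier (tensor_power K ?P 2)"
      and e: "tensor_map K ?P L 2 (\<lambda>x. x) Z = tensor_map K ?P L 2 (\<lambda>x. x) Z'" for Z Z'
  proof -
    have "tensor_map K L ?P 2 r0 (tensor_map K ?P L 2 (\<lambda>x. x) Z) = Z"
      if "Z \<in> carrier (tensor_power K ?P 2)" for Z
      unfolding tensor_map_compose[OF mP module_limit mP j r that]
      by (rule tensor_map_id[OF mP _ that]) (simp add: r0_id)
    then show ?thesis using Z e by metis
  qed
  have tsm: "tensor_square_map K ?S E (\<lambda>x. x) Z = tensor_map K ?P L 2 (\<lambda>x. x) Z"
    if "Z \<in> carrier (tensor_power K ?P 2)" for Z
    using tensor_square_map_cong[of ?S ?P E L K "\<lambda>x. x"] S_sel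
      tensor_square_map_eq_tensor_map[OF mP module_limit j that] by simp
  have "braiding ?P X = (THE Y. Y \<in> carrier (tensor_power K ?S 2) \<and>
      tensor_square_map K ?S E (\<lambda>x. x) Y = braiding E (tensor_square_map K ?S E (\<lambda>x. x) X))"
    by (simp add: primitive_space_def Let_def module.defs braided_space.defs)
  also have "\<dots> = Y"
    unfolding tensor_algebra_cong(3)[OF S_sel]
  proof (rule the_equality)
    show "Y \<in> carrier (tensor_power K ?P 2) \<and>
        tensor_square_map K ?S E (\<lambda>x. x) Y = braiding E (tensor_square_map K ?S E (\<lambda>x. x) X)"
      using X Y eq by (simp only: tsm)
    fix Z assume Z: "Z \<in> carrier (tensor_power K ?P 2) \<and>
        tensor_square_map K ?S E (\<lambda>x. x) Z = braiding E (tensor_square_map K ?S E (\<lambda>x. x) X)"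
    then have "tensor_map K ?P L 2 (\<lambda>x. x) Z = tensor_map K ?P L 2 (\<lambda>x. x) Y"
      unfolding eq tsm[OF X, symmetric] using tsm[of Z] by simp
    then show "Z = Y" using inj Z Y by blast
  qed
  finally show ?thesis .
qed

end

section \<open>Braided Lie algebras\<close>

context bracket
begin

lemma stage_step: "braided_bialgebra_map K (U n) (U (Suc n)) (\<pi> n)"
  using stage_Suc[of n] by (simp add: quotient_bialgebra_def)

sublocale B: bialgebra_system K U \<pi>
  by unfold_locales (rule stage_step)

lemma tens_linear: "linear_map K V (U 0) (\<lambda>v. tens K V [v])"
  using stage_0 by (simp add: braided_tensor_algebra_def braided_morphism_def)

lemma stage_incl_eq_transition: "stage_incl K V \<pi> n v = B.t 0 n (tens K V [v])"
  by (induction n) simp_all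

lemma stage_incl_closed: "v \<in> carrier V \<Longrightarrow> stage_incl K V \<pi> n v \<in> carrier (U n)"
  using B.transition_closed linear_mapD(1)[OF tens_linear] by (simp add: stage_incl_eq_transition)

text \<open>The canonical map may be read off at any stage; surjectivity uses the stage following
  that of the given primitive.\<close>

lemma enveloping_incl_eq_limit_class:
  "v \<in> carrier V \<Longrightarrow> enveloping_incl K V U \<pi> v = B.\<psi> n (stage_incl K V \<pi> n v)"
  using B.limit_class_transition[of 0 n "tens K V [v]"] linear_mapD(1)[OF tens_linear]
  by (simp add: stage_incl_eq_transition enveloping_incl_def)

lemma enveloping_incl_linear: "linear_map K V B.L (enveloping_incl K V U \<pi>)"
  using linear_map_compose[OF tens_linear B.limit_class_linear]
  by (simp add: enveloping_incl_def[abs_def])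

lemma bracket_closed: "x \<in> primitives K (U n) \<Longrightarrow> b n x \<in> carrier V"
  using linear_mapD(1)[OF bracket_linear[of n]] by simp

text \<open>The element \<open>x\<close> and its image under the bracket, put back into
  \<open>U n\<close>, differ by a generator of the ideal. They share a coset, and
  \<open>\<pi> n\<close> depends on the coset alone. Composing \<open>\<pi> n\<close> with the
  inclusion at stage \<open>n\<close> gives the inclusion at the next stage.\<close>

lemma step_bracket:
  assumes x: "x \<in> primitives K (U n)"
  shows "\<pi> n x = stage_incl K V \<pi> (Suc n) (b n x)"
proof -
  interpret Un: braided_bialgebra K "U n" by (rule B.stage_bialgebra)
  have ring: "ring (U n)" by (rule Un.ring_axioms)
  interpret Un: ring "U n" by (rule ring)
  let ?G = "{x \<ominus>\<^bsub>U n\<^esub> stage_incl K V \<pi> n (b n x) | x. x \<in> primitives K (U n)}"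
  let ?y = "stage_incl K V \<pi> n (b n x)"
  have xc: "x \<in> carrier (U n)" if "x \<in> primitives K (U n)" for x
    using that by (simp add: primitives_def)
  have yc: "stage_incl K V \<pi> n (b n x) \<in> carrier (U n)" if "x \<in> primitives K (U n)" for x
    by (rule stage_incl_closed[OF bracket_closed[OF that]])
  have G: "?G \<subseteq> carrier (U n)" using xc yc by auto
  have ideal: "ideal (Idl\<^bsub>U n\<^esub> ?G) (U n)" by (rule Un.genideal_ideal[OF G])
  have "x \<ominus>\<^bsub>U n\<^esub> ?y \<in> Idl\<^bsub>U n\<^esub> ?G"
    using Un.genideal_self[OF G] x by blast
  then have "Idl\<^bsub>U n\<^esub> ?G +>\<^bsub>U n\<^esub> x = Idl\<^bsub>U n\<^esub> ?G +>\<^bsub>U n\<^esub> ?y"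
    using Un.quotient_eq_iff_same_a_r_cos[OF ideal xc[OF x] yc[OF x]] by simp
  moreover obtain \<phi> where "\<And>z. z \<in> carrier (U n) \<Longrightarrow> \<pi> n z = \<phi> (Idl\<^bsub>U n\<^esub> ?G +>\<^bsub>U n\<^esub> z)"
    using stage_Suc[of n] unfolding quotient_bialgebra_def by blast
  ultimately show ?thesis using xc[OF x] yc[OF x] by simp
qed

lemma enveloping_incl_image: "enveloping_incl K V U \<pi> ` carrier V = primitives K B.E"
proof (intro equalityI subsetI)
  fix X assume "X \<in> enveloping_incl K V U \<pi> ` carrier V"
  then obtain v where v: "v \<in> carrier V" "X = enveloping_incl K V U \<pi> v" by blast
  have "tens K V [v] \<in> primitives K (U 0)"
    using stage_0 v(1) linear_mapD(1)[OF tens_linear v(1)]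
    by (simp add: braided_tensor_algebra_def primitives_def)
  from B.primitive_limit_class[OF this] show "X \<in> primitives K B.E"
    using v(2) by (simp add: enveloping_incl_def)
next
  fix X assume "X \<in> primitives K B.E"
  then obtain n x where x: "x \<in> primitives K (U n)" "X = B.\<psi> n x"
    using B.primitive_enveloping_cases by blast
  have "x \<in> carrier (U n)" using x(1) by (simp add: primitives_def)
  \<comment> \<open>The representative is pushed one stage further, because the relation imposed by
    the bracket on \<open>x\<close> holds only after \<open>\<pi> n\<close>.\<close>
  then have "X = B.\<psi> (Suc n) (\<pi> n x)"
    using B.limit_class_transition[of n "Suc n" x] x(2) by simp
  also have "\<dots> = enveloping_incl K V U \<pi> (b n x)"
    using step_bracket[OF x(1)] enveloping_incl_eq_limit_class[OF bracket_closed[OF x(1)], of "Suc n"]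
    by simp
  finally show "X \<in> enveloping_incl K V U \<pi> ` carrier V"
    using bracket_closed[OF x(1)] by blast
qed

text \<open>The primitives are the image of a linear map by \<open>enveloping_incl_image\<close>, so
  closure is inherited from \<open>V\<close>.\<close>

lemma submodule_primitives: "submodule (primitives K B.E) K B.L"
proof -
  interpret L: module K B.L by (rule B.module_limit)
  note i = linear_mapD[OF enveloping_incl_linear]
  let ?i = "enveloping_incl K V U \<pi>"
  note V = module_axioms
  show ?thesis
    unfolding enveloping_incl_image[symmetric]
  proof (rule L.submoduleI)
    show "\<zero>\<^bsub>B.L\<^esub> \<in> ?i ` carrier V"
      using linear_map_zero[OF V B.module_limit enveloping_incl_linear]
      by (intro image_eqI[of _ _ "\<zero>\<^bsub>V\<^esub>"]) auto
    show "\<ominus>\<^bsub>B.L\<^esub> x \<in> ?i ` carrier V" if x: "x \<in> ?i ` carrier V" for x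
    proof -
      from x obtain v where "v \<in> carrier V" "x = ?i v" by blast
      then show ?thesis
        using linear_map_minus[OF V B.module_limit enveloping_incl_linear, of v]
        by (intro image_eqI[of _ _ "\<ominus>\<^bsub>V\<^esub> v"]) auto
    qed
    show "x \<oplus>\<^bsub>B.L\<^esub> y \<in> ?i ` carrier V" if "x \<in> ?i ` carrier V" "y \<in> ?i ` carrier V" for x y
    proof -
      from that obtain v w where "v \<in> carrier V" "x = ?i v" "w \<in> carrier V" "y = ?i w" by blast
      then show ?thesis using i(2)[of v w] by (intro image_eqI[of _ _ "v \<oplus>\<^bsub>V\<^esub> w"]) auto
    qed
    show "a \<odot>\<^bsub>B.L\<^esub> x \<in> ?i ` carrier V" if "a \<in> carrier K" "x \<in> ?i ` carrier V" for a x
    proof -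
      from that obtain v where "v \<in> carrier V" "x = ?i v" by blast
      then show ?thesis using i(3)[of a v] that(1) by (intro image_eqI[of _ _ "a \<odot>\<^bsub>V\<^esub> v"]) auto
    qed
  qed (use i(1) in auto)
qed

lemma module_primitive_space: "module K (primitive_space K B.E)"
  by (rule module_cong[OF submodule.submodule_is_module[OF submodule_primitives B.module_limit]]) simp_all

lemma enveloping_incl_linear_primitive:
  "linear_map K V (primitive_space K B.E) (enveloping_incl K V U \<pi>)"
  using enveloping_incl_linear enveloping_incl_image by (auto simp: linear_map_def)

text \<open>Followed by the inclusion of the primitives, the canonical map is
  \<open>\<psi> 0\<close> after the embedding of \<open>V\<close> into \<open>U 0\<close>. The
  comparison thus takes place in the tensor square of the limit, through
  \<open>braiding_enveloping\<close> at stage zero and the compatibility contained in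
  \<open>stage_0\<close>; \<open>braiding_primitive_space\<close> brings it back to the
  primitives.\<close>

lemma enveloping_incl_braided:
  assumes X: "X \<in> carrier (tensor_power K V 2)"
  shows "braiding (primitive_space K B.E)
      (tensor_map K V (primitive_space K B.E) 2 (enveloping_incl K V U \<pi>) X) =
    tensor_map K V (primitive_space K B.E) 2 (enveloping_incl K V U \<pi>) (braiding V X)"
proof -
  let ?P = "primitive_space K B.E" and ?i = "enveloping_incl K V U \<pi>"
  note V = module_axioms
  note P = module_primitive_space
  note iP = enveloping_incl_linear_primitive
  note cX = linear_mapD(1)[OF braiding_linear X]
  have j: "linear_map K ?P B.L (\<lambda>x. x)"
    by (rule linear_mapI) (simp_all add: primitives_def)
  have incl: "tensor_map K ?P B.L 2 (\<lambda>x. x) (tensor_map K V ?P 2 ?i Z) =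
      B.\<psi>2 0 (tensor_map K V (U 0) 2 (\<lambda>v. tens K V [v]) Z)"
    if "Z \<in> carrier (tensor_power K V 2)" for Z
    unfolding tensor_map_compose[OF V P B.module_limit iP j that]
      tensor_map_compose[OF V B.stage_module B.module_limit tens_linear B.limit_class_linear that]
    by (simp add: enveloping_incl_def[abs_def])
  have e: "tensor_map K V (U 0) 2 (\<lambda>v. tens K V [v]) Z \<in> carrier (B.A2 0)"
    if "Z \<in> carrier (tensor_power K V 2)" for Z
    by (rule linear_mapD(1)[OF tensor_map_linear[OF V B.stage_module tens_linear] that])
  have comm: "braiding (U 0) (tensor_map K V (U 0) 2 (\<lambda>v. tens K V [v]) X) =
      tensor_map K V (U 0) 2 (\<lambda>v. tens K V [v]) (braiding V X)"
    using stage_0 X tensor_square_map_eq_tensor_map[OF V B.stage_module tens_linear]  cX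
    by (simp add: braided_tensor_algebra_def braided_morphism_def)
  show ?thesis
  proof (rule B.braiding_primitive_space[OF field_axioms submodule_primitives])
    show "tensor_map K V ?P 2 ?i X \<in> carrier (tensor_power K ?P 2)"
      "tensor_map K V ?P 2 ?i (braiding V X) \<in> carrier (tensor_power K ?P 2)"
      using X cX by (simp_all add: linear_mapD(1)[OF tensor_map_linear[OF V P iP]])
    show "tensor_map K ?P B.L 2 (\<lambda>x. x) (tensor_map K V ?P 2 ?i (braiding V X)) =
      braiding B.E (tensor_map K ?P B.L 2 (\<lambda>x. x) (tensor_map K V ?P 2 ?i X))"
      by (simp add: incl X cX B.braiding_enveloping e comm)
  qed
qed

end

theorem corollary5p6:
  fixes K :: "('k, 'm) ring_scheme"
    and V :: "('k, 'v, 'x) braided_space_scheme"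
    and b :: "nat \<Rightarrow> ('v list \<Rightarrow> 'k) set \<Rightarrow> 'v"
    and U :: "nat \<Rightarrow> ('k, ('v list \<Rightarrow> 'k) set) braided_bialgebra"
    and \<pi> :: "nat \<Rightarrow> ('v list \<Rightarrow> 'k) set \<Rightarrow> ('v list \<Rightarrow> 'k) set"
  assumes "field K"
    and "braided_lie_algebra K V b U \<pi>"
  shows "braided_iso K V (primitive_space K (enveloping_algebra K U \<pi>)) (enveloping_incl K V U \<pi>)"
proof -
  interpret braided_lie_algebra K V b U \<pi> by fact
  have "bij_betw (enveloping_incl K V U \<pi>) (carrier V)
      (carrier (primitive_space K (enveloping_algebra K U \<pi>)))"
    using incl_inj enveloping_incl_image by (simp add: bij_betw_def)
  then show ?thesis
    by (rule braided_iso_transport[OF braided_vector_space_axioms module_primitive_space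
          enveloping_incl_linear_primitive _ enveloping_incl_braided])
qed

end
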